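(* Let $q\in(-1,1)$, let $\nu$ be a compactly supported probability measure on $\mathbb{R}$, and let $X$ be the associated $q$-Lévy process on $\mathcal{F}_q(\mathcal{H})$, $\mathcal{H}=L^2(\mathbb{R}_+,dt)\otimes L^2(\mathbb{R},\nu)$, as in the context. Then the vacuum vector $\Omega$ is cyclic and separating for the algebra $\mathcal{A}^{\mathrm{alg}}_X$ (i.e. $\mathcal{A}^{\mathrm{alg}}_X\Omega$ is dense in $\mathcal{F}_q(\mathcal{H})$, and $A\in\mathcal{A}^{\mathrm{alg}}_X$, $A\Omega=0$ imply $A=0$). The representation $A\mapsto A\Omega$ of $\mathcal{A}^{\mathrm{alg}}_X$ is faithful, and extends to an isomorphism between $L^2(\mathcal{A}^{\mathrm{alg}}_X,\varphi)$ and $\mathcal{F}_q(\mathcal{H})$. The Wick map $W$ extends to the inverse isomorphism.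
   Context: **Process.** $\mathcal{H}=L^2(\mathbb{R}_+,dt)\otimes L^2(\mathbb{R},\nu)$ (complexification of the real $L^2$ space). $\mathcal{F}_q(\mathcal{H})$ is the completion of $\bigoplus_{n\ge0}\mathcal{H}^{\otimes n}$ (algebraic sum, $\mathcal{H}^{\otimes0}=\mathbb{C}\Omega$) in the inner product $\langle\vec\xi,\vec\eta\rangle_q=\langle\vec\xi,P\vec\eta\rangle_0$, where $\langle\cdot,\cdot\rangle_0$ is the usual inner product and $P(\xi_1\otimes\dots\otimes\xi_n)=\sum_{\sigma\in\mathrm{Sym}(n)}q^{i(\sigma)}\xi_{\sigma(1)}\otimes\dots\otimes\xi_{\sigma(n)}$, $i(\sigma)$ = number of inversions. On it, $a^*(\zeta)$ is left tensoring by $\zeta$; $a(\zeta)\Omega=0$, $a(\zeta)(\eta_1\otimes\dots\otimes\eta_n)=\sum_kq^{k-1}\langle\zeta,\eta_k\rangle\eta_1\otimes\dots\check\eta_k\dots\otimes\eta_n$; $p(T)\Omega=0$, $p(T)(\eta_1\otimes\dots\otimes\eta_n)=\sum_kq^{k-1}(T\eta_k)\otimes\eta_1\otimes\dots\check\eta_k\dots\otimes\eta_n$ (check = omit). For a bounded interval $I=[a,b)\subset\mathbb{R}_+$ and $k\ge1$, $Y_k(I)=a(\mathbf{1}_I\otimes x^{k-1})+a^*(\mathbf{1}_I\otimes x^{k-1})+p(M_{\mathbf{1}_I\otimes x^k})$, with $M_g$ multiplication by $g$. $X(I)=Y_1(I)$, $X(t)=X([0,t))$, $Y_k(t)=Y_k([0,t))$.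 $\mathcal{A}^{\mathrm{alg}}_X$ is the complex unital algebra (no closure) generated by $\{X(t)\}_{t\ge0}$, and $\mathcal{A}^{\mathrm{alg}}_{X,\Delta}$ that generated by $\{Y_k(t)\}_{k\ge1,t\ge0}$. $\varphi[A]=\langle\Omega,A\Omega\rangle$ and $L^2(\mathcal{A}^{\mathrm{alg}}_X,\varphi)$ is the completion of $\mathcal{A}^{\mathrm{alg}}_X$ in $\langle A,B\rangle_\varphi=\varphi[A^*B]=\langle A\Omega,B\Omega\rangle_q$ (similarly for $\mathcal{A}^{\mathrm{alg}}_{X,\Delta}$; both $L^2$ spaces are viewed inside $\mathcal{F}_q(\mathcal{H})$ via $A\mapsto A\Omega$). **Wick map.** Let $\mathcal{D}_0$ be the real span of the functions $\mathbf{1}_I\otimes x^k$ ($I$ a bounded interval $[a,b)$, $k\ge0$), and $\mathcal{D}$ its complexification. For $f\in\mathcal{D}_0$ let $T_f$ be multiplication by $x f(t,x)$ and $X(f)=a(f)+a^*(f)+p(T_f)$. $W:\bigoplus_n\mathcal{D}^{\otimes n}\to\mathcal{A}^{\mathrm{alg}}_{X,\Delta}$ is the linear map with $W(\Omega)=\mathrm{Id}$, $W(f)=X(f)$, and for $f_0,\dots,f_n\in\mathcal{D}_0$ $$W(f_0\otimes f_1\otimes\dots\otimes f_n)=X(f_0)W(f_1\otimes\dots\otimes f_n)-\sum_{i=1}^nq^{i-1}\langle f_0,f_i\rangle W(f_1\otimes\dots\check f_i\dots\otimes f_n)-\sum_{i=1}^nq^{i-1}W(T_{f_0}f_i\otimes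 f_1\otimes\dots\check f_i\dots\otimes f_n).$$ *)

theory Defs
  imports "HOL-Probability.Probability" "HOL-Library.Poly_Mapping" "HOL-Combinatorics.Permutations"
begin

section \<open>Complex Hilbert spaces\<close>

text \<open>
  The distribution has no class of complex inner product spaces.  Here the real inner product
  (hence the norm) is required to be the real part of the complex one, and inner products are
  antilinear in the first argument.
\<close>

class complex_inner = real_inner +
  fixes scaleC :: "complex \<Rightarrow> 'a \<Rightarrow> 'a" (infixr "*\<^sub>C" 75)
    and cinner :: "'a \<Rightarrow> 'a \<Rightarrow> complex"
  assumes scaleC_add_right: "c *\<^sub>C (x + y) = c *\<^sub>C x + c *\<^sub>C y"
    and scaleC_add_left: "(c + d) *\<^sub>C x = c *\<^sub>C x + d *\<^sub>C x"
    and scaleC_scaleC: "c *\<^sub>C (d *\<^sub>C x) = (c * d) *\<^sub>C x"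
    and scaleC_of_real: "complex_of_real r *\<^sub>C x = r *\<^sub>R x"
    and cinner_commute: "cinner x y = cnj (cinner y x)"
    and cinner_add_right: "cinner x (y + z) = cinner x y + cinner x z"
    and cinner_scaleC_right: "cinner x (c *\<^sub>C y) = c * cinner x y"
    and Re_cinner: "Re (cinner x y) = inner x y"

class chilbert_space = complex_inner + complete_space

definition bounded_clinear :: "('a::complex_inner \<Rightarrow> 'b::complex_inner) \<Rightarrow> bool" where
  "bounded_clinear B \<longleftrightarrow> bounded_linear B \<and> (\<forall>c x. B (c *\<^sub>C x) = c *\<^sub>C B x)"

definition cadjoint :: "('a::complex_inner \<Rightarrow> 'a) \<Rightarrow> ('a \<Rightarrow> 'a)" where
  "cadjoint A = (THE B. \<forall>x y. cinner (A x) y = cinner x (B y))"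

definition hilbert_iso :: "('a::complex_inner \<Rightarrow> 'b::complex_inner) \<Rightarrow> bool" where
  "hilbert_iso U \<longleftrightarrow> bij U \<and> (\<forall>x y. U (x + y) = U x + U y) \<and>
     (\<forall>c x. U (c *\<^sub>C x) = c *\<^sub>C U x) \<and> (\<forall>x y. cinner (U x) (U y) = cinner x y)"

text \<open>
  The Hilbert space \<open>'f\<close> together with \<open>j\<close> is the completion of the complex vector space \<open>V\<close>
  (with operations \<open>add\<close>, \<open>scl\<close>) in the sesquilinear form \<open>form\<close>.  As usual,
  vectors of length 0 are identified with 0, so \<open>j\<close> need not be injective.
\<close>

definition is_completion ::
  "'v set \<Rightarrow> ('v \<Rightarrow> 'v \<Rightarrow> 'v) \<Rightarrow> (complex \<Rightarrow> 'v \<Rightarrow> 'v) \<Rightarrow> ('v \<Rightarrow> 'v \<Rightarrow> complex)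
    \<Rightarrow> ('v \<Rightarrow> 'f::chilbert_space) \<Rightarrow> bool" where
  "is_completion V add scl form j \<longleftrightarrow>
     (\<forall>u\<in>V. \<forall>v\<in>V. j (add u v) = j u + j v) \<and>
     (\<forall>c. \<forall>u\<in>V. j (scl c u) = c *\<^sub>C j u) \<and>
     (\<forall>u\<in>V. \<forall>v\<in>V. cinner (j u) (j v) = form u v) \<and>
     closure (j ` V) = UNIV"

section \<open>The one-particle space\<close>

text \<open>
  \<open>L\<^sup>2(\<real>\<^sub>+, dt) \<otimes> L\<^sup>2(\<real>, \<nu>)\<close> is \<open>L\<^sup>2\<close> of the product measure; its elements are given by
  square integrable representatives.
\<close>

type_synonym l2fun = "real \<times> real \<Rightarrow> complex"

definition base_measure :: "real measure \<Rightarrow> (real \<times> real) measure" where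
  "base_measure \<nu> = restrict_space lborel {0..} \<Otimes>\<^sub>M \<nu>"

definition sq_integrable :: "real measure \<Rightarrow> l2fun set" where
  "sq_integrable \<nu> = {f \<in> borel_measurable (base_measure \<nu>).
     integrable (base_measure \<nu>) (\<lambda>z. (cmod (f z))\<^sup>2)}"

definition l2_inner :: "real measure \<Rightarrow> l2fun \<Rightarrow> l2fun \<Rightarrow> complex" where
  "l2_inner \<nu> f g = (LINT z|base_measure \<nu>. cnj (f z) * g z)"

definition mult_op :: "l2fun \<Rightarrow> l2fun \<Rightarrow> l2fun" where
  "mult_op g f = (\<lambda>z. g z * f z)"

text \<open>\<open>\<one>\<^bsub>[a,b)\<^esub> \<otimes> x\<^sup>k\<close>\<close>

definition ind_pow :: "real \<Rightarrow> real \<Rightarrow> nat \<Rightarrow> l2fun" where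
  "ind_pow a b k = (\<lambda>(t, x). complex_of_real (indicator {a..<b} t * x ^ k))"

definition D0 :: "l2fun set" where
  "D0 = {f. \<exists>(n::nat) (c::nat \<Rightarrow> real) a b k. (\<forall>j<n. 0 \<le> a j \<and> a j \<le> b j) \<and>
     f = (\<lambda>z. \<Sum>j<n. complex_of_real (c j) * ind_pow (a j) (b j) (k j) z)}"

section \<open>The algebraic Fock space\<close>

text \<open>
  Vectors are finite formal complex combinations of lists of functions, the list
  \<open>[\<xi>\<^sub>1, \<dots>, \<xi>\<^sub>n]\<close> standing for \<open>\<xi>\<^sub>1 \<otimes> \<dots> \<otimes> \<xi>\<^sub>n\<close> and \<open>[]\<close> for the vacuum.  The multilinearity
  relations and almost everywhere equality are not divided out here: such differences have
  length 0 for the forms below and hence become 0 in any completion.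
\<close>

type_synonym fock_vec = "l2fun list \<Rightarrow>\<^sub>0 complex"

definition fscale :: "complex \<Rightarrow> fock_vec \<Rightarrow> fock_vec" where
  "fscale c v = Poly_Mapping.map (\<lambda>x. c * x) v"

definition tensor :: "l2fun list \<Rightarrow> fock_vec" where
  "tensor xs = Poly_Mapping.single xs 1"

definition fock_on :: "l2fun set \<Rightarrow> fock_vec set" where
  "fock_on S = {v. Poly_Mapping.keys v \<subseteq> lists S}"

abbreviation fock_alg :: "real measure \<Rightarrow> fock_vec set" where
  "fock_alg \<nu> \<equiv> fock_on (sq_integrable \<nu>)"

text \<open>
  For the complexification \<open>D\<close> of \<open>D0\<close>, complex combinations of tensors of functions
  in \<open>D0\<close> exhaust the tensor powers of \<open>D\<close>.
\<close>

abbreviation fock_D :: "fock_vec set" where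
  "fock_D \<equiv> fock_on D0"

definition lin_ext :: "(l2fun list \<Rightarrow> fock_vec) \<Rightarrow> fock_vec \<Rightarrow> fock_vec" where
  "lin_ext f v = (\<Sum>xs\<in>Poly_Mapping.keys v. fscale (Poly_Mapping.lookup v xs) (f xs))"

definition inversions :: "nat \<Rightarrow> (nat \<Rightarrow> nat) \<Rightarrow> nat" where
  "inversions n \<sigma> = card {(i, j). i < j \<and> j < n \<and> \<sigma> j < \<sigma> i}"

definition P_op :: "real \<Rightarrow> fock_vec \<Rightarrow> fock_vec" where
  "P_op q = lin_ext (\<lambda>xs. \<Sum>\<sigma> | \<sigma> permutes {..<length xs}.
     fscale (complex_of_real (q ^ inversions (length xs) \<sigma>)) (tensor (permute_list \<sigma> xs)))"

definition inner0 :: "real measure \<Rightarrow> fock_vec \<Rightarrow> fock_vec \<Rightarrow> complex" where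
  "inner0 \<nu> v w = (\<Sum>xs\<in>Poly_Mapping.keys v. \<Sum>ys\<in>Poly_Mapping.keys w.
     cnj (Poly_Mapping.lookup v xs) * Poly_Mapping.lookup w ys *
     (if length xs = length ys then (\<Prod>i<length xs. l2_inner \<nu> (xs ! i) (ys ! i)) else 0))"

definition innerq :: "real \<Rightarrow> real measure \<Rightarrow> fock_vec \<Rightarrow> fock_vec \<Rightarrow> complex" where
  "innerq q \<nu> v w = inner0 \<nu> v (P_op q w)"

definition omit :: "nat \<Rightarrow> 'a list \<Rightarrow> 'a list" where
  "omit k xs = take k xs @ drop (Suc k) xs"

text \<open>List positions start at 0, so the weight of position \<open>k\<close> is \<open>q\<^sup>k\<close>.\<close>

definition creation :: "l2fun \<Rightarrow> fock_vec \<Rightarrow> fock_vec" where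
  "creation z = lin_ext (\<lambda>xs. tensor (z # xs))"

definition annihilation :: "real \<Rightarrow> real measure \<Rightarrow> l2fun \<Rightarrow> fock_vec \<Rightarrow> fock_vec" where
  "annihilation q \<nu> z = lin_ext (\<lambda>xs. \<Sum>k<length xs.
     fscale (complex_of_real (q ^ k) * l2_inner \<nu> z (xs ! k)) (tensor (omit k xs)))"

definition gauge :: "real \<Rightarrow> (l2fun \<Rightarrow> l2fun) \<Rightarrow> fock_vec \<Rightarrow> fock_vec" where
  "gauge q T = lin_ext (\<lambda>xs. \<Sum>k<length xs.
     fscale (complex_of_real (q ^ k)) (tensor (T (xs ! k) # omit k xs)))"

section \<open>The \<open>q\<close>-Fock space and the process\<close>

definition is_q_fock :: "real \<Rightarrow> real measure \<Rightarrow> (fock_vec \<Rightarrow> 'f::chilbert_space) \<Rightarrow> bool" where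
  "is_q_fock q \<nu> \<iota> \<longleftrightarrow> is_completion (fock_alg \<nu>) (+) fscale (innerq q \<nu>) \<iota>"

definition vacuum :: "(fock_vec \<Rightarrow> 'f::chilbert_space) \<Rightarrow> 'f" where
  "vacuum \<iota> = \<iota> (tensor [])"

text \<open>The bounded operator on the completion extending an operator on the algebraic Fock space.\<close>

definition op_ext ::
  "real measure \<Rightarrow> (fock_vec \<Rightarrow> 'f::chilbert_space) \<Rightarrow> (fock_vec \<Rightarrow> fock_vec) \<Rightarrow> 'f \<Rightarrow> 'f" where
  "op_ext \<nu> \<iota> A = (THE B. bounded_clinear B \<and> (\<forall>v\<in>fock_alg \<nu>. B (\<iota> v) = \<iota> (A v)))"

definition field_op ::
  "real \<Rightarrow> real measure \<Rightarrow> (fock_vec \<Rightarrow> 'f::chilbert_space) \<Rightarrow> l2fun \<Rightarrow> (l2fun \<Rightarrow> l2fun) \<Rightarrow> 'f \<Rightarrow> 'f" where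
  "field_op q \<nu> \<iota> z T = (\<lambda>\<xi>. op_ext \<nu> \<iota> (annihilation q \<nu> z) \<xi> +
     op_ext \<nu> \<iota> (creation z) \<xi> + op_ext \<nu> \<iota> (gauge q T) \<xi>)"

text \<open>\<open>Y\<^sub>k([a,b))\<close>, for \<open>k \<ge> 1\<close>\<close>

definition Y_op ::
  "real \<Rightarrow> real measure \<Rightarrow> (fock_vec \<Rightarrow> 'f::chilbert_space) \<Rightarrow> nat \<Rightarrow> real \<Rightarrow> real \<Rightarrow> 'f \<Rightarrow> 'f" where
  "Y_op q \<nu> \<iota> k a b = field_op q \<nu> \<iota> (ind_pow a b (k - 1)) (mult_op (ind_pow a b k))"

text \<open>\<open>T\<^sub>f\<close>, multiplication by \<open>x f(t,x)\<close>, and \<open>X(f)\<close>\<close>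

definition T_op :: "l2fun \<Rightarrow> l2fun \<Rightarrow> l2fun" where
  "T_op f = mult_op (\<lambda>(t, x). complex_of_real x * f (t, x))"

definition X_fun ::
  "real \<Rightarrow> real measure \<Rightarrow> (fock_vec \<Rightarrow> 'f::chilbert_space) \<Rightarrow> l2fun \<Rightarrow> 'f \<Rightarrow> 'f" where
  "X_fun q \<nu> \<iota> f = field_op q \<nu> \<iota> f (T_op f)"

inductive_set alg_generated :: "('f::complex_inner \<Rightarrow> 'f) set \<Rightarrow> ('f \<Rightarrow> 'f) set"
  for G :: "('f \<Rightarrow> 'f) set" where
  one: "(\<lambda>\<xi>. \<xi>) \<in> alg_generated G"
| gen: "A \<in> G \<Longrightarrow> A \<in> alg_generated G"
| add: "A \<in> alg_generated G \<Longrightarrow> B \<in> alg_generated G \<Longrightarrow> (\<lambda>\<xi>. A \<xi> + B \<xi>) \<in> alg_generated G"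
| scale: "A \<in> alg_generated G \<Longrightarrow> (\<lambda>\<xi>. c *\<^sub>C A \<xi>) \<in> alg_generated G"
| mult: "A \<in> alg_generated G \<Longrightarrow> B \<in> alg_generated G \<Longrightarrow> (\<lambda>\<xi>. A (B \<xi>)) \<in> alg_generated G"

definition alg_X ::
  "real \<Rightarrow> real measure \<Rightarrow> (fock_vec \<Rightarrow> 'f::chilbert_space) \<Rightarrow> ('f \<Rightarrow> 'f) set" where
  "alg_X q \<nu> \<iota> = alg_generated {Y_op q \<nu> \<iota> 1 0 t | t. 0 \<le> t}"

definition alg_X_Delta ::
  "real \<Rightarrow> real measure \<Rightarrow> (fock_vec \<Rightarrow> 'f::chilbert_space) \<Rightarrow> ('f \<Rightarrow> 'f) set" where
  "alg_X_Delta q \<nu> \<iota> = alg_generated {Y_op q \<nu> \<iota> k 0 t | k t. 1 \<le> k \<and> 0 \<le> t}"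

definition state :: "'f::complex_inner \<Rightarrow> ('f \<Rightarrow> 'f) \<Rightarrow> complex" where
  "state \<Omega> A = cinner \<Omega> (A \<Omega>)"

text \<open>\<open>L\<^sup>2(\<A>, \<phi>)\<close> for the vector state \<open>\<phi>\<close> of \<open>\<Omega>\<close>\<close>

definition is_L2_alg ::
  "('f::complex_inner \<Rightarrow> 'f) set \<Rightarrow> 'f \<Rightarrow> (('f \<Rightarrow> 'f) \<Rightarrow> 'g::chilbert_space) \<Rightarrow> bool" where
  "is_L2_alg \<A> \<Omega> \<kappa> \<longleftrightarrow> is_completion \<A> (\<lambda>A B \<xi>. A \<xi> + B \<xi>) (\<lambda>c A \<xi>. c *\<^sub>C A \<xi>)
     (\<lambda>A B. state \<Omega> (cadjoint A \<circ> B)) \<kappa>"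

section \<open>The Wick map\<close>

lemma length_omit_less: "k < length xs \<Longrightarrow> length (omit k xs) < length xs"
  by (simp add: omit_def)

function wick ::
  "real \<Rightarrow> real measure \<Rightarrow> (fock_vec \<Rightarrow> 'f::chilbert_space) \<Rightarrow> l2fun list \<Rightarrow> 'f \<Rightarrow> 'f" where
  "wick q \<nu> \<iota> [] = (\<lambda>\<xi>. \<xi>)"
| "wick q \<nu> \<iota> (f # fs) = (\<lambda>\<xi>. X_fun q \<nu> \<iota> f (wick q \<nu> \<iota> fs \<xi>)
     - (\<Sum>i<length fs. (complex_of_real (q ^ i) * l2_inner \<nu> f (fs ! i)) *\<^sub>C
          wick q \<nu> \<iota> (omit i fs) \<xi>)
     - (\<Sum>i<length fs. complex_of_real (q ^ i) *\<^sub>C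
          wick q \<nu> \<iota> (T_op f (fs ! i) # omit i fs) \<xi>))"
  by pat_completeness auto
termination
  by (relation "Wellfounded.measure (\<lambda>(q, \<nu>, \<iota>, fs). length fs)") (auto dest: length_omit_less)

definition wick_map ::
  "real \<Rightarrow> real measure \<Rightarrow> (fock_vec \<Rightarrow> 'f::chilbert_space) \<Rightarrow> fock_vec \<Rightarrow> 'f \<Rightarrow> 'f" where
  "wick_map q \<nu> \<iota> v = (\<lambda>\<xi>. \<Sum>fs\<in>Poly_Mapping.keys v.
     Poly_Mapping.lookup v fs *\<^sub>C wick q \<nu> \<iota> fs \<xi>)"

end

theory Submission
  imports Defs
begin

text \<open>
  The relation \<open>a(f) a\<^sup>*(g) = \<langle>f, g\<rangle> + q a\<^sup>*(g) a(f)\<close> yields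
  \<open>\<parallel>\<Sum>\<^sub>j e\<^sub>j \<otimes> \<psi>\<^sub>j\<parallel>\<^sup>2 \<le> (1 - \<bar>q\<bar>)\<^bsup>-1\<^esup> \<Sum>\<^sub>j \<parallel>\<psi>\<^sub>j\<parallel>\<^sup>2\<close> for orthonormal \<open>e\<^sub>j\<close>; this bounds creation, annihilation and, by
  \<open>p(T) = \<Sum>\<^sub>j a\<^sup>*(T e\<^sub>j) a(e\<^sub>j)\<close>, the gauge operators.  The vacuum is cyclic because
  \<open>\<Sum>\<^sub>i X(I\<^sub>i) (\<one>\<^bsub>I\<^sub>i\<^esub> x\<^sup>k \<otimes> \<eta>)\<close> converges to \<open>\<one>\<^sub>I x\<^bsup>k+1\<^esup> \<otimes> \<eta>\<close> modulo vectors with fewer particles when the partition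
  \<open>(I\<^sub>i)\<close> of \<open>I\<close> is refined.  It is separating because every element of the algebra is
  \<open>A = W(v)\<close> with \<open>v = A\<Omega>\<close>, and the \<open>q\<close>-inner product is strictly positive, so that \<open>A\<Omega> = 0\<close> forces
  \<open>v = 0\<close> as a tensor.
\<close>

section \<open>Complex inner product spaces\<close>

text \<open>The recursion for W produces \<open>T_op f g\<close>, and multiplication by x leads out
  of the span of the indicators, so an element of the small algebra is a Wick word only inside
  \<open>alg_X_Delta\<close>. Separation is therefore proved for the large algebra, and cyclicity
  for the small one, whose dense orbit identifies both L2 spaces with the Fock space. Words are
  formal: "v = 0 as a tensor" can only mean that the coefficients of v over an orthonormal alphabet
  vanish, and W must be shown to respect such expansions. Since a(f) is conjugate linear in f while
  the creation and gauge parts are linear, X(f) is only real linear in f; hence the alphabet has to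
  be built inside \<open>D0\<close> with real coefficients. The gauge bound has an obstacle of its
  own: a general multiplier does not keep an orthonormal family orthonormal, which is why unimodular
  functions come first. For cyclicity only generators with exponent 0 are at hand; the missing
  powers of x come from the gauge term of X(I) meeting a letter supported on the same small
  interval.\<close>

lemma scaleC_zero_left [simp]: "0 *\<^sub>C (x::'a::complex_inner) = 0"
  using scaleC_of_real[of 0 x] by simp

lemma scaleC_one [simp]: "1 *\<^sub>C (x::'a::complex_inner) = x"
  using scaleC_of_real[of 1 x] by simp

lemma scaleC_zero_right [simp]: "c *\<^sub>C (0::'a::complex_inner) = 0"
  using scaleC_add_right[of c "0::'a" 0] by simp

lemma scaleC_minus_one: "(-1) *\<^sub>C (x::'a::complex_inner) = - x"
  using scaleC_of_real[of "-1" x] by simp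

lemma scaleC_minus_right: "c *\<^sub>C (- x) = - (c *\<^sub>C (x::'a::complex_inner))"
  using scaleC_add_right[of c "- x" x] by (simp add: eq_neg_iff_add_eq_0)

lemma scaleC_diff_right: "c *\<^sub>C (x - y) = c *\<^sub>C x - c *\<^sub>C (y::'a::complex_inner)"
  using scaleC_add_right[of c x "- y"] by (simp add: scaleC_minus_right)

lemma scaleC_sum_right: "c *\<^sub>C (\<Sum>i\<in>I. f i) = (\<Sum>i\<in>I. c *\<^sub>C (f i :: 'a::complex_inner))"
  by (induction I rule: infinite_finite_induct) (auto simp: scaleC_add_right)

lemma scaleC_sum_left: "(\<Sum>i\<in>I. c i) *\<^sub>C x = (\<Sum>i\<in>I. c i *\<^sub>C (x :: 'a::complex_inner))"
  by (induction I rule: infinite_finite_induct) (auto simp: scaleC_add_left)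

lemma scaleR_eq_scaleC: "r *\<^sub>R x = complex_of_real r *\<^sub>C (x::'a::complex_inner)"
  by (simp add: scaleC_of_real)

lemma cinner_add_left: "cinner (x + y) z = cinner x z + cinner y (z::'a::complex_inner)"
  by (metis cinner_commute cinner_add_right complex_cnj_add)

lemma cinner_scaleC_left: "cinner (c *\<^sub>C x) y = cnj c * cinner x (y::'a::complex_inner)"
  by (metis cinner_commute cinner_scaleC_right complex_cnj_mult)

lemma cinner_zero_right [simp]: "cinner x (0::'a::complex_inner) = 0"
  using cinner_scaleC_right[of x 0 0] by simp

lemma cinner_zero_left [simp]: "cinner (0::'a::complex_inner) x = 0"
  using cinner_scaleC_left[of 0 0 x] by simp

lemma cinner_minus_right: "cinner x (- y) = - cinner x (y::'a::complex_inner)"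
  using cinner_scaleC_right[of x "-1" y] by (simp add: scaleC_minus_one)

lemma cinner_diff_right: "cinner x (y - z) = cinner x y - cinner x (z::'a::complex_inner)"
  using cinner_add_right[of x y "- z"] by (simp add: cinner_minus_right)

lemma cinner_sum_right: "cinner x (\<Sum>i\<in>I. f i) = (\<Sum>i\<in>I. cinner x (f i :: 'a::complex_inner))"
  by (induction I rule: infinite_finite_induct) (auto simp: cinner_add_right)

lemma cinner_sum_left: "cinner (\<Sum>i\<in>I. f i) x = (\<Sum>i\<in>I. cinner (f i :: 'a::complex_inner) x)"
  by (induction I rule: infinite_finite_induct) (auto simp: cinner_add_left)

lemma cinner_self: "cinner x x = complex_of_real ((norm (x::'a::complex_inner))\<^sup>2)"
proof -
  have "Im (cinner x x) = 0" using cinner_commute[of x x] by (metis cnj.sel(2) equation_minus_iff neg_equal_zero)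
  then show ?thesis by (simp add: complex_eq_iff Re_cinner power2_norm_eq_inner)
qed

lemma cmod_cinner_le: "cmod (cinner x y) \<le> norm x * norm (y::'a::complex_inner)"
proof (cases "cinner x y = 0")
  case False
  \<comment> \<open>The phase that turns \<open>cinner x y\<close> into its modulus, after which the
    real Cauchy-Schwarz inequality applies.\<close>
  define c where "c = cnj (sgn (cinner x y))"
  have c: "cmod c = 1" using False by (simp add: c_def norm_sgn)
  have "cinner x (c *\<^sub>C y) = cmod (cinner x y)"
    using False by (simp add: c_def cinner_scaleC_right sgn_eq complex_norm_square[symmetric] power2_eq_square
        field_simps)
  then have "cmod (cinner x y) = inner x (c *\<^sub>C y)"
    using Re_cinner by (metis Re_complex_of_real)
  also have "\<dots> \<le> norm x * norm (c *\<^sub>C y)" by (rule norm_cauchy_schwarz)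
  also have "norm (c *\<^sub>C y) = norm y"
  proof -
    have "complex_of_real ((norm (c *\<^sub>C y))\<^sup>2) = cnj c * c * complex_of_real ((norm y)\<^sup>2)"
      unfolding cinner_self[symmetric] by (simp add: cinner_scaleC_left cinner_scaleC_right)
    also have "cnj c * c = 1" using c complex_norm_square[of c] by (simp add: mult.commute)
    finally show ?thesis by (simp flip: of_real_power)
  qed
  finally show ?thesis .
qed auto

lemma norm_scaleC: "norm (c *\<^sub>C x) = cmod c * norm (x::'a::complex_inner)"
proof -
  have "complex_of_real ((norm (c *\<^sub>C x))\<^sup>2) = (cnj c * c) * complex_of_real ((norm x)\<^sup>2)"
    unfolding cinner_self[symmetric] by (simp add: cinner_scaleC_left cinner_scaleC_right)
  also have "cnj c * c = complex_of_real ((cmod c)\<^sup>2)"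
    using complex_norm_square[of c] by (simp add: mult.commute)
  finally have "(norm (c *\<^sub>C x))\<^sup>2 = (cmod c)\<^sup>2 * (norm x)\<^sup>2" by (metis of_real_eq_iff of_real_mult)
  then have "(norm (c *\<^sub>C x))\<^sup>2 = (cmod c * norm x)\<^sup>2" by (simp add: power_mult_distrib)
  then show ?thesis by (simp add: power2_eq_iff_nonneg)
qed

lemma bounded_linear_cinner_right: "bounded_linear (cinner (x::'a::complex_inner))"
proof (rule bounded_linear_intro[where K="norm x"])
  show "cinner x (r *\<^sub>R y) = r *\<^sub>R cinner x y" for r y
    by (simp add: scaleR_eq_scaleC cinner_scaleC_right scaleR_conv_of_real)
qed (auto simp: cinner_add_right mult.commute[of _ "norm x"] intro: cmod_cinner_le)

lemma bounded_linear_scaleC: "bounded_linear (\<lambda>x::'a::complex_inner. c *\<^sub>C x)"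
  by (rule bounded_linear_intro[where K="cmod c"])
     (auto simp: scaleC_add_right norm_scaleC mult.commute scaleR_eq_scaleC scaleC_scaleC)

section \<open>Density arguments and extension by continuity\<close>

lemma cinner_eq_dense:
  fixes x y :: "'a::complex_inner"
  assumes "closure S = UNIV" "\<And>s. s \<in> S \<Longrightarrow> cinner s x = cinner s y"
  shows "x = y"
proof -
  have "closed {s. cinner s (x - y) = 0}"
  proof -
    have "{s. cinner s (x - y) = 0} = {s. cinner (x - y) s = 0}"
      by (metis cinner_commute complex_cnj_zero_iff)
    moreover have "closed {s. cinner (x - y) s = 0}"
      using bounded_linear_cinner_right[of "x - y"]
      by (intro closed_Collect_eq continuous_intros linear_continuous_on)
    ultimately show ?thesis by simp
  qed
  moreover have "S \<subseteq> {s. cinner s (x - y) = 0}" using assms(2) by (auto simp: cinner_diff_right)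
  ultimately have "closure S \<subseteq> {s. cinner s (x - y) = 0}" by (rule closure_minimal[rotated])
  then have "cinner (x - y) (x - y) = 0" using assms(1) by auto
  then show ?thesis by (simp add: cinner_self)
qed

lemma bounded_clinearI:
  assumes "\<And>x y. B (x + y) = B x + B y" "\<And>c x. B (c *\<^sub>C x) = c *\<^sub>C B x" "\<And>x. norm (B x) \<le> norm x * K"
  shows "bounded_clinear B"
  unfolding bounded_clinear_def using assms
  by (auto intro!: bounded_linear_intro[where K=K] simp: scaleR_eq_scaleC)

lemma bounded_clinear_add_image: "bounded_clinear B \<Longrightarrow> B (x + y) = B x + B y"
  by (simp add: bounded_clinear_def bounded_linear.axioms(1) linear_add bounded_linear.linear)

lemma bounded_clinear_scaleC: "bounded_clinear B \<Longrightarrow> B (c *\<^sub>C x) = c *\<^sub>C B x"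
  by (simp add: bounded_clinear_def)

lemma bounded_clinear_sum: "bounded_clinear B \<Longrightarrow> B (\<Sum>i\<in>I. f i) = (\<Sum>i\<in>I. B (f i))"
  by (simp add: bounded_clinear_def linear_sum bounded_linear.linear)

lemma bounded_clinear_zero: "bounded_clinear B \<Longrightarrow> B 0 = 0"
  by (simp add: bounded_clinear_def linear_0 bounded_linear.linear)

lemma bounded_clinear_id: "bounded_clinear (\<lambda>x. x)"
  by (rule bounded_clinearI[where K=1]) auto

lemma bounded_clinear_plus: "bounded_clinear A \<Longrightarrow> bounded_clinear B \<Longrightarrow> bounded_clinear (\<lambda>x. A x + B x)"
  by (auto simp: bounded_clinear_def bounded_linear_add scaleC_add_right)

lemma bounded_clinear_scale: "bounded_clinear A \<Longrightarrow> bounded_clinear (\<lambda>x. c *\<^sub>C A x)"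
  unfolding bounded_clinear_def using bounded_linear_compose[OF bounded_linear_scaleC, of A c]
  by (auto simp: scaleC_scaleC mult.commute)

lemma bounded_clinear_compose: "bounded_clinear A \<Longrightarrow> bounded_clinear B \<Longrightarrow> bounded_clinear (\<lambda>x. A (B x))"
  by (auto simp: bounded_clinear_def bounded_linear_compose)

lemma bounded_clinear_eq_dense:
  assumes "bounded_clinear A" "bounded_clinear B" "closure S = UNIV" "\<And>s. s \<in> S \<Longrightarrow> A s = B s"
  shows "A = B"
proof -
  have "closed {s. A s = B s}"
    using assms(1,2) unfolding bounded_clinear_def
    by (intro closed_Collect_eq linear_continuous_on) auto
  moreover have "S \<subseteq> {s. A s = B s}" using assms(4) by auto
  ultimately have "closure S \<subseteq> {s. A s = B s}" by (rule closure_minimal[rotated])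
  then show ?thesis using assms(3) by auto
qed

text \<open>\<open>j\<close> need not be injective: the bound alone forces \<open>k u = k v\<close>
  whenever \<open>j u = j v\<close>, so \<open>k\<close> descends to the image of \<open>j\<close>.
  The operations on \<open>V\<close> are parameters because the lemma serves both formal Fock
  vectors and sets of operators.\<close>

lemma bounded_clinear_extension:
  fixes j :: "'v \<Rightarrow> 'a::complex_inner" and k :: "'v \<Rightarrow> 'b::chilbert_space"
  assumes dense: "closure (j ` V) = UNIV"
    and add: "\<And>u v. u \<in> V \<Longrightarrow> v \<in> V \<Longrightarrow> add u v \<in> V"
      "\<And>u v. u \<in> V \<Longrightarrow> v \<in> V \<Longrightarrow> j (add u v) = j u + j v"
      "\<And>u v. u \<in> V \<Longrightarrow> v \<in> V \<Longrightarrow> k (add u v) = k u + k v"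
    and scl: "\<And>c u. u \<in> V \<Longrightarrow> scl c u \<in> V"
      "\<And>c u. u \<in> V \<Longrightarrow> j (scl c u) = c *\<^sub>C j u"
      "\<And>c u. u \<in> V \<Longrightarrow> k (scl c u) = c *\<^sub>C k u"
    and bound: "\<And>v. v \<in> V \<Longrightarrow> norm (k v) \<le> K * norm (j v)"
  obtains B where "bounded_clinear B" "\<And>v. v \<in> V \<Longrightarrow> B (j v) = k v" "\<And>x. norm (B x) \<le> K * norm x"
proof -
  \<comment> \<open>\<open>V\<close> carries no subtraction, so differences are formed as
    \<open>add u (scl (-1) v)\<close>.\<close>
  have dif: "norm (k u - k v) \<le> K * norm (j u - j v)" if "u \<in> V" "v \<in> V" for u v
  proof -
    have 1: "add u (scl (-1) v) \<in> V" using that by (intro add scl)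
    have "k (add u (scl (-1) v)) = k u - k v" "j (add u (scl (-1) v)) = j u - j v"
      using that by (simp_all add: add scl scaleC_minus_one)
    then show ?thesis using bound[OF 1] by simp
  qed
  \<comment> \<open>Any preimage may be chosen; \<open>dif\<close> makes the value independent of
    the choice.\<close>
  define b where "b x = k (SOME v. v \<in> V \<and> j v = x)" for x
  have b: "b (j v) = k v" if "v \<in> V" for v
  proof -
    have "\<exists>w. w \<in> V \<and> j w = j v" using that by auto
    then have *: "(SOME w. w \<in> V \<and> j w = j v) \<in> V" "j (SOME w. w \<in> V \<and> j w = j v) = j v"
      using someI_ex[of "\<lambda>w. w \<in> V \<and> j w = j v"] by auto
    have "norm (b (j v) - k v) \<le> 0" unfolding b_def using dif[OF *(1) that] *(2) by simp
    then show ?thesis by simp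
  qed
  \<comment> \<open>Dividing by \<open>\<bar>K\<bar> + 1\<close> instead of \<open>K\<close>, whose
    sign is unknown, keeps the modulus of continuity positive.\<close>
  have K0: "uniformly_continuous_on (j ` V) b"
    unfolding uniformly_continuous_on_def
  proof (intro allI impI)
    fix e :: real assume e: "e > 0"
    have "dist (b x') (b x) < e" if x: "x \<in> j ` V" "x' \<in> j ` V" and d: "dist x' x < e / (\<bar>K\<bar> + 1)" for x x'
    proof -
      obtain u v where uv: "u \<in> V" "v \<in> V" "x = j u" "x' = j v" using x by auto
      have "dist (b x') (b x) \<le> K * norm (x' - x)" using dif uv by (simp add: b dist_norm)
      also have "\<dots> \<le> (\<bar>K\<bar> + 1) * norm (x' - x)" by (intro mult_right_mono) auto
      also have "\<dots> < e" using d by (simp add: dist_norm pos_less_divide_eq mult.commute)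
      finally show ?thesis .
    qed
    then show "\<exists>d>0. \<forall>x\<in>j ` V. \<forall>x'\<in>j ` V. dist x' x < d \<longrightarrow> dist (b x') (b x) < e"
      using e by (intro exI[of _ "e / (\<bar>K\<bar> + 1)"]) auto
  qed
  obtain B where B: "uniformly_continuous_on (closure (j ` V)) B" "\<And>x. x \<in> j ` V \<Longrightarrow> b x = B x"
    using uniformly_continuous_on_extension_on_closure[OF K0] by metis
  have cB: "continuous_on UNIV B" using B(1) dense by (simp add: uniformly_continuous_imp_continuous)
  have Bj: "B (j v) = k v" if "v \<in> V" for v using B(2)[of "j v"] b[OF that] that by auto
  have lim: "\<exists>s. (\<forall>n. s n \<in> V) \<and> (\<lambda>n. j (s n)) \<longlonglongrightarrow> x" for x
  proof -
    have "x \<in> closure (j ` V)" using dense by simp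
    then obtain f where f: "\<forall>n. f n \<in> j ` V" "f \<longlonglongrightarrow> x" unfolding closure_sequential by auto
    then have "\<forall>n. \<exists>v. v \<in> V \<and> f n = j v" by auto
    then obtain s where "\<forall>n. s n \<in> V \<and> f n = j (s n)" by metis
    then show ?thesis using f(2) by (intro exI[of _ s]) (auto simp: LIMSEQ_iff)
  qed
  have BL: "(\<lambda>n. B (f n)) \<longlonglongrightarrow> B x" if "f \<longlonglongrightarrow> x" for f x
    using cB that continuous_on_tendsto_compose[OF cB, of f x] by auto
  have nB: "norm (B x) \<le> K * norm x" for x
  proof -
    obtain s where s: "\<And>n. s n \<in> V" "(\<lambda>n. j (s n)) \<longlonglongrightarrow> x" using lim by metis
    have "(\<lambda>n. norm (B (j (s n)))) \<longlonglongrightarrow> norm (B x)" "(\<lambda>n. K * norm (j (s n))) \<longlonglongrightarrow> K * norm x"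
      using BL[OF s(2)] s(2) by (auto intro!: tendsto_intros)
    then show ?thesis by (rule LIMSEQ_le) (auto simp: Bj s bound)
  qed
  have Badd: "B (x + y) = B x + B y" for x y
  proof -
    obtain s where s: "\<And>n. s n \<in> V" "(\<lambda>n. j (s n)) \<longlonglongrightarrow> x" using lim by metis
    obtain t where t: "\<And>n. t n \<in> V" "(\<lambda>n. j (t n)) \<longlonglongrightarrow> y" using lim by metis
    have "(\<lambda>n. B (j (add (s n) (t n)))) \<longlonglongrightarrow> B (x + y)"
      by (rule BL) (use s t in \<open>auto simp: add intro!: tendsto_intros\<close>)
    moreover have "(\<lambda>n. B (j (add (s n) (t n)))) = (\<lambda>n. B (j (s n)) + B (j (t n)))"
      by (simp add: Bj s t add(1) add(3))
    moreover have "(\<lambda>n. B (j (s n)) + B (j (t n))) \<longlonglongrightarrow> B x + B y"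
      using BL[OF s(2)] BL[OF t(2)] by (rule tendsto_add)
    ultimately show ?thesis using LIMSEQ_unique by metis
  qed
  have cont: "(\<lambda>n. c *\<^sub>C f n) \<longlonglongrightarrow> c *\<^sub>C x" if "f \<longlonglongrightarrow> x" for c and f :: "nat \<Rightarrow> 'c::complex_inner" and x
    using bounded_linear.tendsto[OF bounded_linear_scaleC that] .
  have Bscl: "B (c *\<^sub>C x) = c *\<^sub>C B x" for c x
  proof -
    obtain s where s: "\<And>n. s n \<in> V" "(\<lambda>n. j (s n)) \<longlonglongrightarrow> x" using lim by metis
    have "(\<lambda>n. B (j (scl c (s n)))) \<longlonglongrightarrow> B (c *\<^sub>C x)"
      by (rule BL) (use s in \<open>auto simp: scl intro!: cont\<close>)
    moreover have "(\<lambda>n. B (j (scl c (s n)))) = (\<lambda>n. c *\<^sub>C B (j (s n)))"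
      by (simp add: Bj s scl(1) scl(3))
    moreover have "(\<lambda>n. c *\<^sub>C B (j (s n))) \<longlonglongrightarrow> c *\<^sub>C B x" using BL[OF s(2)] by (rule cont)
    ultimately show ?thesis using LIMSEQ_unique by metis
  qed
  have "bounded_clinear B" using Badd Bscl nB by (intro bounded_clinearI[where K=K]) (auto simp: mult.commute)
  then show ?thesis using that Bj nB by blast
qed

text \<open>Both directions extend with constant 1, and the extensions are mutually inverse on dense
  sets. Only the diagonals of the two forms are assumed equal; polarization recovers the
  rest.\<close>

lemma hilbert_iso_completions:
  fixes j :: "'v \<Rightarrow> 'a::chilbert_space" and k :: "'v \<Rightarrow> 'b::chilbert_space"
  assumes "closure (j ` V) = UNIV" "closure (k ` V) = UNIV"
    and add: "\<And>u v. u \<in> V \<Longrightarrow> v \<in> V \<Longrightarrow> add u v \<in> V"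
      "\<And>u v. u \<in> V \<Longrightarrow> v \<in> V \<Longrightarrow> j (add u v) = j u + j v"
      "\<And>u v. u \<in> V \<Longrightarrow> v \<in> V \<Longrightarrow> k (add u v) = k u + k v"
    and scl: "\<And>c u. u \<in> V \<Longrightarrow> scl c u \<in> V"
      "\<And>c u. u \<in> V \<Longrightarrow> j (scl c u) = c *\<^sub>C j u"
      "\<And>c u. u \<in> V \<Longrightarrow> k (scl c u) = c *\<^sub>C k u"
    and form: "\<And>u. u \<in> V \<Longrightarrow> cinner (j u) (j u) = cinner (k u) (k u)"
  obtains U where "hilbert_iso U" "\<And>v. v \<in> V \<Longrightarrow> U (j v) = k v"
proof -
  have nrm: "norm (j u) = norm (k u)" if "u \<in> V" for u
  proof -
    have "(norm (j u))\<^sup>2 = (norm (k u))\<^sup>2" using form[OF that] unfolding cinner_self of_real_eq_iff .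
    then show ?thesis by simp
  qed
  obtain U where U: "bounded_clinear U" "\<And>v. v \<in> V \<Longrightarrow> U (j v) = k v" "\<And>x. norm (U x) \<le> 1 * norm x"
    using bounded_clinear_extension[of j V add k scl 1] assms nrm by auto
  obtain W where W: "bounded_clinear W" "\<And>v. v \<in> V \<Longrightarrow> W (k v) = j v" "\<And>x. norm (W x) \<le> 1 * norm x"
    using bounded_clinear_extension[of k V add j scl 1] assms nrm by auto
  have WU: "(\<lambda>x. W (U x)) = (\<lambda>x. x)"
    by (rule bounded_clinear_eq_dense[OF _ _ assms(1)]) (auto simp: U W bounded_clinear_compose bounded_clinear_id)
  have UW: "(\<lambda>x. U (W x)) = (\<lambda>x. x)"
    by (rule bounded_clinear_eq_dense[OF _ _ assms(2)]) (auto simp: U W bounded_clinear_compose bounded_clinear_id)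
  have bij: "bij U" using WU UW by (intro o_bij[of W]) (auto simp: fun_eq_iff)
  have nU: "norm (U x) = norm x" for x
    using U(3)[of x] W(3)[of "U x"] fun_cong[OF WU, of x] by simp
  have in_eq: "inner (U x) (U y) = inner x y" for x y
  proof -
    have "(norm (U (x + y)))\<^sup>2 = (norm (x + y))\<^sup>2" using nU by simp
    then show ?thesis using nU[of x] nU[of y]
      by (simp add: bounded_clinear_add_image[OF U(1)] dot_norm)
  qed
  have "cinner (U x) (U y) = cinner x y" for x y
  proof -
    have "Re (cinner (U x) (U y)) = Re (cinner x y)" for x y by (simp add: Re_cinner in_eq)
    \<comment> \<open>The imaginary part is, up to sign, the real part taken against
      \<open>\<i> *\<^sub>C y\<close>.\<close>
    from this[of x y] this[of x "\<i> *\<^sub>C y"] show ?thesis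
      by (simp add: bounded_clinear_scaleC[OF U(1)] cinner_scaleC_right complex_eq_iff)
  qed
  then show ?thesis using that[of U] U bij
    by (auto simp: hilbert_iso_def bounded_clinear_add_image bounded_clinear_scaleC)
qed

section \<open>Permutations and inversions\<close>

text \<open>The increasing enumeration of all indices except \<open>k\<close>; it converts positions
  in \<open>omit k xs\<close> into positions in \<open>xs\<close>, see
  \<open>nth_omit\<close>.\<close>

definition skip :: "nat \<Rightarrow> nat \<Rightarrow> nat" where
  "skip k j = (if j < k then j else Suc j)"

lemma skip_less_iff: "skip k i < skip k j \<longleftrightarrow> i < j"
  by (auto simp: skip_def)

lemma skip_neq: "skip k j \<noteq> k"
  by (auto simp: skip_def)

lemma skip_less: "k \<le> n \<Longrightarrow> skip k j < Suc n \<longleftrightarrow> j < n"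
  by (auto simp: skip_def)

lemma skip_eq_iff [simp]: "skip k i = skip k j \<longleftrightarrow> i = j"
  by (auto simp: skip_def)

lemma length_omit [simp]: "k < length xs \<Longrightarrow> length (omit k xs) = length xs - 1"
  by (simp add: omit_def)

lemma nth_omit: "k < length xs \<Longrightarrow> j < length xs - 1 \<Longrightarrow> omit k xs ! j = xs ! skip k j"
  by (auto simp: omit_def skip_def nth_append min_def)

lemma omit_Cons_0 [simp]: "omit 0 (x # xs) = xs"
  by (simp add: omit_def)

lemma omit_Cons_Suc [simp]: "omit (Suc k) (x # xs) = x # omit k xs"
  by (simp add: omit_def)

lemma set_omit: "set (omit k xs) \<subseteq> set xs"
  by (auto simp: omit_def dest: in_set_takeD in_set_dropD)

text \<open>The permutation of \<open>{..n}\<close> that sends 0 to \<open>k\<close> and acts on the rest by \<open>\<tau>\<close>.\<close>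

definition perm_Cons :: "nat \<Rightarrow> nat \<Rightarrow> (nat \<Rightarrow> nat) \<Rightarrow> nat \<Rightarrow> nat" where
  "perm_Cons n k \<tau> i = (if i = 0 then k else if i \<le> n then skip k (\<tau> (i - 1)) else i)"

lemma perm_Cons_permutes:
  assumes "k \<le> n" "\<tau> permutes {..<n}"
  shows "perm_Cons n k \<tau> permutes {..<Suc n}"
proof (rule bij_imp_permutes)
  have t: "\<tau> i < n \<longleftrightarrow> i < n" for i using permutes_in_image[OF assms(2), of i] by simp
  have inj: "inj_on (perm_Cons n k \<tau>) {..<Suc n}"
  proof (rule inj_onI)
    fix x y assume xy: "x \<in> {..<Suc n}" "y \<in> {..<Suc n}" and e: "perm_Cons n k \<tau> x = perm_Cons n k \<tau> y"
    show "x = y"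
    proof (cases "x = 0 \<or> y = 0")
      case True
      then show ?thesis using xy e skip_neq[of k "\<tau> (x - 1)"] skip_neq[of k "\<tau> (y - 1)"]
        by (auto simp: perm_Cons_def less_Suc_eq_le split: if_splits)
    next
      case False
      then have "\<tau> (x - 1) = \<tau> (y - 1)" using xy e by (simp add: perm_Cons_def)
      then have "x - 1 = y - 1" using permutes_inj[OF assms(2)] by (simp add: inj_eq)
      then show ?thesis using False by arith
    qed
  qed
  moreover have "perm_Cons n k \<tau> ` {..<Suc n} \<subseteq> {..<Suc n}"
  proof (intro image_subsetI)
    fix i assume "i \<in> {..<Suc n}"
    then show "perm_Cons n k \<tau> i \<in> {..<Suc n}"
      using assms(1) t[of "i - 1"] skip_less[OF assms(1), of "\<tau> (i - 1)"]
      by (cases "i = 0") (simp_all add: perm_Cons_def less_Suc_eq_le)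
  qed
  ultimately show "bij_betw (perm_Cons n k \<tau>) {..<Suc n} {..<Suc n}"
    by (simp add: bij_betw_def endo_inj_surj)
qed (auto simp: perm_Cons_def)

lemma bij_betw_perm_Cons:
  "bij_betw (\<lambda>(k, \<tau>). perm_Cons n k \<tau>) ({..<Suc n} \<times> {\<tau>. \<tau> permutes {..<n}}) {\<sigma>. \<sigma> permutes {..<Suc n}}"
proof -
  have inj: "inj_on (\<lambda>(k, \<tau>). perm_Cons n k \<tau>) ({..<Suc n} \<times> {\<tau>. \<tau> permutes {..<n}})"
  proof (rule inj_onI, clarify)
    fix k \<tau> k' \<tau>' assume t: "\<tau> permutes {..<n}" "\<tau>' permutes {..<n}"
      and e: "perm_Cons n k \<tau> = perm_Cons n k' \<tau>'"
    have k: "k = k'" using fun_cong[OF e, of 0] by (simp add: perm_Cons_def)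
    have "\<tau> i = \<tau>' i" for i
    proof (cases "i < n")
      case True
      then show ?thesis using fun_cong[OF e, of "Suc i"] k by (simp add: perm_Cons_def)
    next
      case False
      then show ?thesis using permutes_not_in[OF t(1), of i] permutes_not_in[OF t(2), of i] by simp
    qed
    then show "k = k' \<and> \<tau> = \<tau>'" using k by auto
  qed
  \<comment> \<open>Surjectivity by counting: there are (n + 1) n! pairs and (n + 1)! permutations,
    so no inverse has to be constructed.\<close>
  have "(\<lambda>(k, \<tau>). perm_Cons n k \<tau>) ` ({..<Suc n} \<times> {\<tau>. \<tau> permutes {..<n}}) = {\<sigma>. \<sigma> permutes {..<Suc n}}"
  proof (rule card_subset_eq)
    show "finite {\<sigma>. \<sigma> permutes {..<Suc n}}" by (simp add: finite_permutations)
    show "(\<lambda>(k, \<tau>). perm_Cons n k \<tau>) ` ({..<Suc n} \<times> {\<tau>. \<tau> permutes {..<n}}) \<subseteq> {\<sigma>. \<sigma> permutes {..<Suc n}}"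
      using perm_Cons_permutes by (auto simp: less_Suc_eq_le)
    have c: "card {\<sigma>. \<sigma> permutes {..<m}} = fact m" for m :: nat
      by (rule card_permutations) auto
    have "card ({..<Suc n} \<times> {\<tau>. \<tau> permutes {..<n}}) = card {\<sigma>. \<sigma> permutes {..<Suc n}}"
      by (simp add: card_cartesian_product c)
    then show "card ((\<lambda>(k, \<tau>). perm_Cons n k \<tau>) ` ({..<Suc n} \<times> {\<tau>. \<tau> permutes {..<n}})) = card {\<sigma>. \<sigma> permutes {..<Suc n}}"
      using card_image[OF inj] by simp
  qed
  then show ?thesis using inj by (simp add: bij_betw_def)
qed

text \<open>Position 0 is inverted with exactly the \<open>k\<close> positions that carry smaller
  values; the remaining inverted pairs are those of \<tau>, because \<open>skip k\<close> is
  increasing.\<close>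

lemma inversions_perm_Cons:
  assumes "k \<le> n" "\<tau> permutes {..<n}"
  shows "inversions (Suc n) (perm_Cons n k \<tau>) = k + inversions n \<tau>"
proof -
  let ?s = "perm_Cons n k \<tau>"
  have t: "\<tau> i < n \<longleftrightarrow> i < n" for i using permutes_in_image[OF assms(2), of i] by simp
  define A where "A = {j. j < n \<and> skip k (\<tau> j) < k}"
  define B where "B = {(i, j). i < j \<and> j < n \<and> \<tau> j < \<tau> i}"
  have split: "{(i, j). i < j \<and> j < Suc n \<and> ?s j < ?s i} =
      (\<lambda>j. (0, Suc j)) ` A \<union> (\<lambda>(i, j). (Suc i, Suc j)) ` B"
  proof (rule set_eqI, clarify)
    fix i j
    show "(i, j) \<in> {(i, j). i < j \<and> j < Suc n \<and> ?s j < ?s i} \<longleftrightarrow>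
        (i, j) \<in> (\<lambda>j. (0, Suc j)) ` A \<union> (\<lambda>(i, j). (Suc i, Suc j)) ` B"
    proof (cases j)
      case 0
      then show ?thesis by auto
    next
      case (Suc j')
      show ?thesis
      proof (cases i)
        case 0
        then show ?thesis using Suc by (auto simp add: A_def perm_Cons_def image_iff Suc_le_eq)
      next
        case (Suc i')
        then show ?thesis using \<open>j = Suc j'\<close>
          by (auto simp add: B_def perm_Cons_def image_iff Suc_le_eq skip_less_iff)
      qed
    qed
  qed
  have finB: "finite B" by (rule finite_subset[of _ "{..<n} \<times> {..<n}"]) (auto simp: B_def)
  have finA: "finite A" by (auto simp: A_def)
  have "A = {j. j < n \<and> \<tau> j < k}" by (auto simp: A_def skip_def split: if_splits)
  moreover have "bij_betw \<tau> {j. j < n \<and> \<tau> j < k} {..<k}"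
  proof -
    have "\<tau> ` {j. j < n \<and> \<tau> j < k} = {..<k}"
    proof (intro equalityI subsetI)
      fix y assume "y \<in> {..<k}"
      then have "y < n" "y < k" using assms(1) by simp_all
      then have "y \<in> \<tau> ` {..<n}" using permutes_image[OF assms(2)] by simp
      then show "y \<in> \<tau> ` {j. j < n \<and> \<tau> j < k}" using \<open>y < k\<close> by auto
    qed auto
    then show ?thesis using inj_on_subset[OF permutes_inj[OF assms(2)] subset_UNIV] by (simp add: bij_betw_def)
  qed
  ultimately have cA: "card A = k" using bij_betw_same_card[of \<tau> A "{..<k}"] by simp
  have "inversions (Suc n) ?s = card ((\<lambda>j. (0::nat, Suc j)) ` A \<union> (\<lambda>(i, j). (Suc i, Suc j)) ` B)"
    unfolding inversions_def split ..
  also have "\<dots> = card ((\<lambda>j. (0::nat, Suc j)) ` A) + card ((\<lambda>(i, j). (Suc i, Suc j)) ` B)"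
    by (rule card_Un_disjoint) (use finA finB in auto)
  also have "card ((\<lambda>j. (0::nat, Suc j)) ` A) = k" using cA by (simp add: card_image inj_on_def)
  also have "card ((\<lambda>(i, j). (Suc i, Suc j)) ` B) = inversions n \<tau>"
    by (subst card_image) (auto simp: inj_on_def inversions_def B_def)
  finally show ?thesis .
qed

abbreviation keys :: "('a \<Rightarrow>\<^sub>0 'b::zero) \<Rightarrow> 'a set" where "keys \<equiv> Poly_Mapping.keys"
abbreviation lookup :: "('a \<Rightarrow>\<^sub>0 'b::zero) \<Rightarrow> 'a \<Rightarrow> 'b" where "lookup \<equiv> Poly_Mapping.lookup"

section \<open>Linear maps on formal combinations\<close>

lemma lookup_fscale [simp]: "lookup (fscale c v) xs = c * lookup v xs"
  by (simp add: fscale_def map.rep_eq when_def)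

lemma keys_fscale: "keys (fscale c v) \<subseteq> keys v"
  by (auto simp: in_keys_iff)

lemma fscale_simps [simp]: "fscale 0 v = 0" "fscale 1 v = v" "fscale c 0 = 0" "fscale c (fscale d v) = fscale (c * d) v"
  by (auto intro!: poly_mapping_eqI)

lemma fscale_add: "fscale c (v + w) = fscale c v + fscale c w" "fscale (c + d) v = fscale c v + fscale d v"
  by (auto intro!: poly_mapping_eqI simp: lookup_add algebra_simps)

lemma fscale_sum: "fscale c (\<Sum>i\<in>I. v i) = (\<Sum>i\<in>I. fscale c (v i))"
  by (induction I rule: infinite_finite_induct) (auto simp: fscale_add)

lemma lookup_tensor: "lookup (tensor xs) ys = (if xs = ys then 1 else 0)"
  by (simp add: tensor_def lookup_single when_def)

lemma keys_tensor [simp]: "keys (tensor xs) = {xs}"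
  by (simp add: tensor_def)

lemma fock_vec_expand: "v = (\<Sum>xs\<in>keys v. fscale (lookup v xs) (tensor xs))"
  by (rule poly_mapping_eqI)
     (auto simp: lookup_sum lookup_tensor if_distrib sum.delta in_keys_iff cong: if_cong)

definition flinear :: "(fock_vec \<Rightarrow> fock_vec) \<Rightarrow> bool" where
  "flinear A \<longleftrightarrow> (\<forall>v w. A (v + w) = A v + A w) \<and> (\<forall>c v. A (fscale c v) = fscale c (A v))"

lemma flinear_add: "flinear A \<Longrightarrow> A (v + w) = A v + A w"
  by (simp add: flinear_def)

lemma flinear_scale: "flinear A \<Longrightarrow> A (fscale c v) = fscale c (A v)"
  by (simp add: flinear_def)

lemma flinear_sum: "flinear A \<Longrightarrow> A (\<Sum>i\<in>I. v i) = (\<Sum>i\<in>I. A (v i))"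
  using flinear_scale[of A 0 0] by (induction I rule: infinite_finite_induct) (auto simp: flinear_add)

text \<open>Cancellation can shrink the support of a sum. Summing over a fixed finite superset turns
  linearity into a termwise identity.\<close>

lemma lin_ext_superset:
  assumes "finite S" "keys v \<subseteq> S"
  shows "lin_ext f v = (\<Sum>xs\<in>S. fscale (lookup v xs) (f xs))"
  unfolding lin_ext_def using assms by (intro sum.mono_neutral_left) (auto simp: in_keys_iff)

lemma flinear_lin_ext: "flinear (lin_ext f)"
  unfolding flinear_def
proof (intro conjI allI)
  fix v w :: fock_vec
  let ?S = "keys v \<union> keys w"
  show "lin_ext f (v + w) = lin_ext f v + lin_ext f w"
    using keys_add[of v w]
    by (subst (1 2 3) lin_ext_superset[where S="?S"]) (auto simp: lookup_add fscale_add sum.distrib)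
next
  fix c and v :: fock_vec
  show "lin_ext f (fscale c v) = fscale c (lin_ext f v)"
    using keys_fscale[of c v]
    by (subst (1 2) lin_ext_superset[where S="keys v"]) (auto simp: fscale_sum)
qed

lemma lin_ext_tensor [simp]: "lin_ext f (tensor xs) = f xs"
  by (simp add: lin_ext_def lookup_tensor)

lemma flinear_eqI:
  assumes "flinear A" "flinear B" "\<And>xs. xs \<in> keys v \<Longrightarrow> A (tensor xs) = B (tensor xs)"
  shows "A v = B v"
  by (subst (1 2) fock_vec_expand) (simp add: flinear_sum flinear_scale assms)

lemma flinear_creation: "flinear (creation z)"
  and flinear_annihilation: "flinear (annihilation q \<nu> z)"
  and flinear_gauge: "flinear (gauge q T)"
  by (simp_all add: creation_def annihilation_def gauge_def flinear_lin_ext)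

lemma flinear_comp: "flinear A \<Longrightarrow> flinear B \<Longrightarrow> flinear (\<lambda>v. A (B v))"
  by (simp add: flinear_def)

lemma flinear_plus: "flinear A \<Longrightarrow> flinear B \<Longrightarrow> flinear (\<lambda>v. A v + B v)"
  by (simp add: flinear_def fscale_add algebra_simps)

lemma flinear_fscale: "flinear A \<Longrightarrow> flinear (\<lambda>v. fscale c (A v))"
  by (simp add: flinear_def fscale_add mult.commute)

lemma flinear_id: "flinear (\<lambda>v. v)"
  by (simp add: flinear_def)

lemma creation_tensor [simp]: "creation z (tensor xs) = tensor (z # xs)"
  by (simp add: creation_def)

lemma annihilation_tensor: "annihilation q \<nu> z (tensor xs) = (\<Sum>k<length xs.
     fscale (complex_of_real (q ^ k) * l2_inner \<nu> z (xs ! k)) (tensor (omit k xs)))"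
  by (simp add: annihilation_def)

lemma gauge_tensor: "gauge q T (tensor xs) = (\<Sum>k<length xs.
     fscale (complex_of_real (q ^ k)) (tensor (T (xs ! k) # omit k xs)))"
  by (simp add: gauge_def)

text \<open>The q-commutation relation: the new first letter contributes the inner product, and
  every old letter has moved one place to the right, which costs one factor
  \<open>q\<close>.\<close>

lemma annihilation_creation:
  "annihilation q \<nu> f (creation g v) = fscale (l2_inner \<nu> f g) v + fscale (complex_of_real q) (creation g (annihilation q \<nu> f v))"
proof (rule flinear_eqI[where v=v and A="\<lambda>v. annihilation q \<nu> f (creation g v)"])
  fix xs
  show "annihilation q \<nu> f (creation g (tensor xs)) = fscale (l2_inner \<nu> f g) (tensor xs) +
     fscale (complex_of_real q) (creation g (annihilation q \<nu> f (tensor xs)))"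
    by (simp add: annihilation_tensor sum.lessThan_Suc_shift flinear_sum[OF flinear_creation]
        flinear_scale[OF flinear_creation] fscale_sum mult.assoc del: sum.lessThan_Suc)
next
  show "flinear (\<lambda>v. annihilation q \<nu> f (creation g v))"
    by (rule flinear_comp[OF flinear_annihilation flinear_creation])
  show "flinear (\<lambda>v. fscale (l2_inner \<nu> f g) v + fscale (complex_of_real q) (creation g (annihilation q \<nu> f v)))"
    by (rule flinear_plus[OF flinear_fscale[OF flinear_id]
          flinear_fscale[OF flinear_comp[OF flinear_creation flinear_annihilation]]])
qed

section \<open>The q-inner product of words\<close>

lemma inner0_superset:
  assumes "finite S" "keys v \<subseteq> S" "finite T" "keys w \<subseteq> T"
  shows "inner0 \<nu> v w = (\<Sum>xs\<in>S. \<Sum>ys\<in>T.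
     cnj (lookup v xs) * lookup w ys *
     (if length xs = length ys then (\<Prod>i<length xs. l2_inner \<nu> (xs ! i) (ys ! i)) else 0))"
proof -
  have "inner0 \<nu> v w = (\<Sum>xs\<in>keys v. \<Sum>ys\<in>T.
     cnj (lookup v xs) * lookup w ys *
     (if length xs = length ys then (\<Prod>i<length xs. l2_inner \<nu> (xs ! i) (ys ! i)) else 0))"
    unfolding inner0_def
    by (intro sum.cong refl sum.mono_neutral_left) (use assms in \<open>auto simp: in_keys_iff\<close>)
  also have "\<dots> = (\<Sum>xs\<in>S. \<Sum>ys\<in>T. cnj (lookup v xs) * lookup w ys *
     (if length xs = length ys then (\<Prod>i<length xs. l2_inner \<nu> (xs ! i) (ys ! i)) else 0))"
    by (intro sum.mono_neutral_left) (use assms in \<open>auto simp: in_keys_iff\<close>)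
  finally show ?thesis .
qed

lemma inner0_add_right: "inner0 \<nu> v (w + w') = inner0 \<nu> v w + inner0 \<nu> v w'"
proof -
  let ?T = "keys w \<union> keys w'"
  show ?thesis using keys_add[of w w']
    by (subst (1 2 3) inner0_superset[where S="keys v" and T="?T"])
       (auto simp: lookup_add algebra_simps sum.distrib)
qed

lemma inner0_scale_right: "inner0 \<nu> v (fscale c w) = c * inner0 \<nu> v w"
  using keys_fscale[of c w]
  by (subst (1 2) inner0_superset[where S="keys v" and T="keys w"])
     (auto simp: sum_distrib_left mult_ac intro!: sum.cong)

lemma inner0_sum_right: "inner0 \<nu> v (\<Sum>i\<in>I. w i) = (\<Sum>i\<in>I. inner0 \<nu> v (w i))"
  using inner0_scale_right[of \<nu> v 0 0]
  by (induction I rule: infinite_finite_induct) (auto simp: inner0_add_right)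

lemma inner0_tensor: "inner0 \<nu> (tensor xs) (tensor ys) =
    (if length xs = length ys then (\<Prod>i<length xs. l2_inner \<nu> (xs ! i) (ys ! i)) else 0)"
  by (simp add: inner0_def lookup_tensor)

lemma innerq_tensor: "innerq q \<nu> (tensor xs) (tensor ys) =
  (if length xs = length ys then \<Sum>\<sigma> | \<sigma> permutes {..<length xs}.
     complex_of_real (q ^ inversions (length xs) \<sigma>) * (\<Prod>i<length xs. l2_inner \<nu> (xs ! i) (ys ! \<sigma> i)) else 0)"
proof -
  have "innerq q \<nu> (tensor xs) (tensor ys) = (\<Sum>\<sigma> | \<sigma> permutes {..<length ys}.
     complex_of_real (q ^ inversions (length ys) \<sigma>) * inner0 \<nu> (tensor xs) (tensor (permute_list \<sigma> ys)))"
    by (simp add: innerq_def P_op_def inner0_sum_right inner0_scale_right)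
  also have "\<dots> = (if length xs = length ys then \<Sum>\<sigma> | \<sigma> permutes {..<length xs}.
     complex_of_real (q ^ inversions (length xs) \<sigma>) * (\<Prod>i<length xs. l2_inner \<nu> (xs ! i) (ys ! \<sigma> i)) else 0)"
    by (auto simp: inner0_tensor permute_list_nth intro!: sum.cong prod.cong)
  finally show ?thesis .
qed

text \<open>Permutations are sorted by the position \<open>k\<close> matched with the first letter,
  which accounts for \<open>k\<close> inversions. This is the adjointness of creation and
  annihilation on words; together with \<open>innerq_tensor_Nil\<close> it replaces the sum over
  permutations in everything that follows.\<close>

lemma innerq_tensor_Cons: "innerq q \<nu> (tensor (z # xs)) (tensor ys) =
  (\<Sum>k<length ys. complex_of_real (q ^ k) * l2_inner \<nu> z (ys ! k) * innerq q \<nu> (tensor xs) (tensor (omit k ys)))"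
proof (cases "length ys = Suc (length xs)")
  case False
  then show ?thesis by (cases "ys = []") (auto simp: innerq_tensor intro!: sum.neutral)
next
  case True
  define n where "n = length xs"
  have l: "length ys = Suc n" "length xs = n" using True by (auto simp: n_def)
  have "innerq q \<nu> (tensor (z # xs)) (tensor ys) = (\<Sum>\<sigma> | \<sigma> permutes {..<Suc n}.
     complex_of_real (q ^ inversions (Suc n) \<sigma>) * (\<Prod>i<Suc n. l2_inner \<nu> ((z # xs) ! i) (ys ! \<sigma> i)))"
    by (simp add: innerq_tensor l)
  also have "\<dots> = (\<Sum>(k, \<tau>)\<in>{..<Suc n} \<times> {\<tau>. \<tau> permutes {..<n}}.
     complex_of_real (q ^ inversions (Suc n) (perm_Cons n k \<tau>)) *
     (\<Prod>i<Suc n. l2_inner \<nu> ((z # xs) ! i) (ys ! perm_Cons n k \<tau> i)))"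
    by (subst sum.reindex_bij_betw[OF bij_betw_perm_Cons[of n], symmetric]) (simp add: case_prod_beta)
  also have "\<dots> = (\<Sum>(k, \<tau>)\<in>{..<Suc n} \<times> {\<tau>. \<tau> permutes {..<n}}.
     complex_of_real (q ^ k) * l2_inner \<nu> z (ys ! k) * (complex_of_real (q ^ inversions n \<tau>) *
     (\<Prod>i<n. l2_inner \<nu> (xs ! i) (omit k ys ! \<tau> i))))"
  proof (intro sum.cong refl)
    fix p assume "p \<in> {..<Suc n} \<times> {\<tau>. \<tau> permutes {..<n}}"
    then obtain k \<tau> where p: "p = (k, \<tau>)" and k: "k \<in> {..<Suc n}" and t: "\<tau> permutes {..<n}" by blast
    have "(\<Prod>i<Suc n. l2_inner \<nu> ((z # xs) ! i) (ys ! perm_Cons n k \<tau> i)) =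
        l2_inner \<nu> z (ys ! k) * (\<Prod>i<n. l2_inner \<nu> (xs ! i) (ys ! perm_Cons n k \<tau> (Suc i)))"
      by (simp add: prod.lessThan_Suc_shift perm_Cons_def del: prod.lessThan_Suc)
    also have "(\<Prod>i<n. l2_inner \<nu> (xs ! i) (ys ! perm_Cons n k \<tau> (Suc i))) =
        (\<Prod>i<n. l2_inner \<nu> (xs ! i) (omit k ys ! \<tau> i))"
    proof (intro prod.cong refl)
      fix i assume "i \<in> {..<n}"
      then have "\<tau> i < n" "i < n" using permutes_in_image[OF t, of i] by auto
      then show "l2_inner \<nu> (xs ! i) (ys ! perm_Cons n k \<tau> (Suc i)) = l2_inner \<nu> (xs ! i) (omit k ys ! \<tau> i)"
        using k l by (simp add: perm_Cons_def nth_omit)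
    qed
    finally show "(case p of (k, \<tau>) \<Rightarrow> complex_of_real (q ^ inversions (Suc n) (perm_Cons n k \<tau>)) *
       (\<Prod>i<Suc n. l2_inner \<nu> ((z # xs) ! i) (ys ! perm_Cons n k \<tau> i))) =
       (case p of (k, \<tau>) \<Rightarrow> complex_of_real (q ^ k) * l2_inner \<nu> z (ys ! k) * (complex_of_real (q ^ inversions n \<tau>) *
       (\<Prod>i<n. l2_inner \<nu> (xs ! i) (omit k ys ! \<tau> i))))"
      using k t by (simp add: p inversions_perm_Cons power_add mult_ac)
  qed
  also have "\<dots> = (\<Sum>k<Suc n. complex_of_real (q ^ k) * l2_inner \<nu> z (ys ! k) * (\<Sum>\<tau> | \<tau> permutes {..<n}. complex_of_real (q ^ inversions n \<tau>) *
     (\<Prod>i<n. l2_inner \<nu> (xs ! i) (omit k ys ! \<tau> i))))"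
    by (simp only: sum_distrib_left sum.cartesian_product)
  also have "\<dots> = (\<Sum>k<length ys. complex_of_real (q ^ k) * l2_inner \<nu> z (ys ! k) * innerq q \<nu> (tensor xs) (tensor (omit k ys)))"
    by (intro sum.cong) (auto simp: innerq_tensor l)
  finally show ?thesis .
qed

lemma innerq_tensor_Nil: "innerq q \<nu> (tensor []) (tensor ys) = (if ys = [] then 1 else 0)"
proof -
  have "{\<sigma>. \<sigma> permutes {..<0::nat}} = {id}" by (auto simp: id_def)
  moreover have "inversions 0 id = 0" by (simp add: inversions_def)
  ultimately show ?thesis by (auto simp: innerq_tensor)
qed

section \<open>Square integrable functions\<close>

definition nsq :: "real measure \<Rightarrow> l2fun \<Rightarrow> real" where
  "nsq \<nu> f = (LINT z|base_measure \<nu>. (cmod (f z))\<^sup>2)"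

lemma sq_integrable_measurable: "f \<in> sq_integrable \<nu> \<Longrightarrow> f \<in> borel_measurable (base_measure \<nu>)"
  by (simp add: sq_integrable_def)

lemma sq_integrable_bound:
  assumes "f \<in> borel_measurable (base_measure \<nu>)" "g \<in> sq_integrable \<nu>"
    "AE z in base_measure \<nu>. cmod (f z) \<le> B * cmod (g z)"
  shows "f \<in> sq_integrable \<nu>"
  unfolding sq_integrable_def
proof (intro CollectI conjI assms(1))
  show "integrable (base_measure \<nu>) (\<lambda>z. (cmod (f z))\<^sup>2)"
  proof (rule Bochner_Integration.integrable_bound)
    show "integrable (base_measure \<nu>) (\<lambda>z. B\<^sup>2 * (cmod (g z))\<^sup>2)"
      using assms(2) by (simp add: sq_integrable_def)
    show "(\<lambda>z. (cmod (f z))\<^sup>2) \<in> borel_measurable (base_measure \<nu>)" using assms(1) by measurable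
    show "AE z in base_measure \<nu>. norm ((cmod (f z))\<^sup>2) \<le> norm (B\<^sup>2 * (cmod (g z))\<^sup>2)"
      using assms(3)
    proof eventually_elim
      case (elim z)
      then have "(cmod (f z))\<^sup>2 \<le> (B * cmod (g z))\<^sup>2" by (intro power_mono) auto
      then show ?case by (simp add: power_mult_distrib)
    qed
  qed
qed

lemma sq_sum_le: "(cmod (x + y))\<^sup>2 \<le> 2 * (cmod x)\<^sup>2 + 2 * (cmod y)\<^sup>2"
proof -
  have "(cmod (x + y))\<^sup>2 \<le> (cmod x + cmod y)\<^sup>2" by (intro power_mono norm_triangle_ineq) auto
  also have "\<dots> \<le> 2 * (cmod x)\<^sup>2 + 2 * (cmod y)\<^sup>2"
    using zero_le_power2[of "cmod x - cmod y"] by (simp add: power2_eq_square algebra_simps)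
  finally show ?thesis .
qed

lemma sq_integrable_add:
  assumes "f \<in> sq_integrable \<nu>" "g \<in> sq_integrable \<nu>"
  shows "(\<lambda>z. f z + g z) \<in> sq_integrable \<nu>"
  unfolding sq_integrable_def
proof (intro CollectI conjI)
  note [measurable] = assms[THEN sq_integrable_measurable]
  show "(\<lambda>z. f z + g z) \<in> borel_measurable (base_measure \<nu>)" by measurable
  show "integrable (base_measure \<nu>) (\<lambda>z. (cmod (f z + g z))\<^sup>2)"
  proof (rule Bochner_Integration.integrable_bound)
    show "integrable (base_measure \<nu>) (\<lambda>z. 2 * (cmod (f z))\<^sup>2 + 2 * (cmod (g z))\<^sup>2)"
      using assms by (simp add: sq_integrable_def)
    show "AE z in base_measure \<nu>. norm ((cmod (f z + g z))\<^sup>2) \<le> norm (2 * (cmod (f z))\<^sup>2 + 2 * (cmod (g z))\<^sup>2)"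
      using sq_sum_le by auto
  qed measurable
qed

lemma sq_integrable_scale:
  assumes "f \<in> sq_integrable \<nu>"
  shows "(\<lambda>z. c * f z) \<in> sq_integrable \<nu>"
  using sq_integrable_measurable[OF assms]
  by (intro sq_integrable_bound[OF _ assms, where B="cmod c"]) (auto simp: norm_mult)

lemma sq_integrable_zero: "(\<lambda>z. 0) \<in> sq_integrable \<nu>"
  by (simp add: sq_integrable_def)

lemma sq_integrable_sum:
  "(\<And>i. i \<in> I \<Longrightarrow> f i \<in> sq_integrable \<nu>) \<Longrightarrow> (\<lambda>z. \<Sum>i\<in>I. c i * f i z) \<in> sq_integrable \<nu>"
  by (induction I rule: infinite_finite_induct)
     (auto intro!: sq_integrable_add sq_integrable_scale sq_integrable_zero)

lemma sq_integrable_diff: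
  assumes "f \<in> sq_integrable \<nu>" "g \<in> sq_integrable \<nu>"
  shows "(\<lambda>z. f z - g z) \<in> sq_integrable \<nu>"
  using sq_integrable_add[OF assms(1) sq_integrable_scale[OF assms(2), of "-1"]] by simp

lemma borel_measurable_cnj [measurable]: "cnj \<in> borel_measurable borel"
  by (intro borel_measurable_continuous_onI continuous_intros)

lemma integrable_l2:
  assumes "f \<in> sq_integrable \<nu>" "g \<in> sq_integrable \<nu>"
  shows "integrable (base_measure \<nu>) (\<lambda>z. cnj (f z) * g z)"
proof (rule Bochner_Integration.integrable_bound)
  note [measurable] = assms[THEN sq_integrable_measurable]
  show "integrable (base_measure \<nu>) (\<lambda>z. (cmod (f z))\<^sup>2 + (cmod (g z))\<^sup>2)"
    using assms by (simp add: sq_integrable_def)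
  show "(\<lambda>z. cnj (f z) * g z) \<in> borel_measurable (base_measure \<nu>)" 
    by measurable
  have "cmod x * cmod y \<le> (cmod x)\<^sup>2 + (cmod y)\<^sup>2" for x y
    using sum_squares_bound[of "cmod x" "cmod y"] mult_nonneg_nonneg[OF norm_ge_zero[of x] norm_ge_zero[of y]]
    by linarith
  then show "AE z in base_measure \<nu>. norm (cnj (f z) * g z) \<le> norm ((cmod (f z))\<^sup>2 + (cmod (g z))\<^sup>2)"
    by (simp add: norm_mult)
qed

lemma l2_inner_cnj: "l2_inner \<nu> f g = cnj (l2_inner \<nu> g f)"
proof -
  have "cnj (l2_inner \<nu> g f) = (LINT z|base_measure \<nu>. cnj (cnj (g z) * f z))"
    unfolding l2_inner_def by (rule Bochner_Integration.integral_cnj[symmetric])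
  then show ?thesis by (simp add: l2_inner_def mult.commute)
qed

lemma l2_inner_sum_right:
  assumes "h \<in> sq_integrable \<nu>" "\<And>i. i \<in> I \<Longrightarrow> g i \<in> sq_integrable \<nu>"
  shows "l2_inner \<nu> h (\<lambda>z. \<Sum>i\<in>I. c i * g i z) = (\<Sum>i\<in>I. c i * l2_inner \<nu> h (g i))"
proof -
  have "l2_inner \<nu> h (\<lambda>z. \<Sum>i\<in>I. c i * g i z) = (LINT z|base_measure \<nu>. (\<Sum>i\<in>I. c i * (cnj (h z) * g i z)))"
    unfolding l2_inner_def by (simp add: sum_distrib_left mult_ac)
  also have "\<dots> = (\<Sum>i\<in>I. (LINT z|base_measure \<nu>. c i * (cnj (h z) * g i z)))"
    by (rule Bochner_Integration.integral_sum) (use integrable_l2 assms in auto)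
  also have "\<dots> = (\<Sum>i\<in>I. c i * l2_inner \<nu> h (g i))" unfolding l2_inner_def by simp
  finally show ?thesis .
qed

lemma l2_inner_scale_right: "l2_inner \<nu> h (\<lambda>z. c * g z) = c * l2_inner \<nu> h g"
proof -
  have "l2_inner \<nu> h (\<lambda>z. c * g z) = (LINT z|base_measure \<nu>. c * (cnj (h z) * g z))"
    unfolding l2_inner_def by (simp add: mult_ac)
  then show ?thesis by (simp add: l2_inner_def)
qed

lemma l2_inner_add_right:
  assumes "h \<in> sq_integrable \<nu>" "f \<in> sq_integrable \<nu>" "g \<in> sq_integrable \<nu>"
  shows "l2_inner \<nu> h (\<lambda>z. f z + g z) = l2_inner \<nu> h f + l2_inner \<nu> h g"
  unfolding l2_inner_def
  using assms integrable_l2 by (simp add: distrib_left Bochner_Integration.integral_add)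

lemma l2_inner_cong_AE:
  assumes "AE z in base_measure \<nu>. f z = f' z" "AE z in base_measure \<nu>. g z = g' z"
    "f \<in> sq_integrable \<nu>" "g \<in> sq_integrable \<nu>" "f' \<in> sq_integrable \<nu>" "g' \<in> sq_integrable \<nu>"
  shows "l2_inner \<nu> f g = l2_inner \<nu> f' g'"
  unfolding l2_inner_def
proof (rule integral_cong_AE)
  show "AE z in base_measure \<nu>. cnj (f z) * g z = cnj (f' z) * g' z" using assms(1,2) by eventually_elim simp
qed (use integrable_l2 assms in \<open>auto intro: borel_measurable_integrable\<close>)

lemma l2_inner_self: "l2_inner \<nu> f f = complex_of_real (nsq \<nu> f)"
proof -
  have "cnj (f z) * f z = complex_of_real ((cmod (f z))\<^sup>2)" for z
    using complex_norm_square[of "f z"] by (simp add: mult.commute)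
  then show ?thesis unfolding l2_inner_def nsq_def by (simp only: integral_complex_of_real)
qed

lemma nsq_nonneg: "nsq \<nu> f \<ge> 0"
  unfolding nsq_def by (intro integral_nonneg_AE) auto

lemma nsq_scale: "nsq \<nu> (\<lambda>z. c * f z) = (cmod c)\<^sup>2 * nsq \<nu> f"
  unfolding nsq_def by (simp add: norm_mult power_mult_distrib)

lemma nsq_eq_0_AE:
  assumes "f \<in> sq_integrable \<nu>" "nsq \<nu> f = 0"
  shows "AE z in base_measure \<nu>. f z = 0"
proof -
  have "AE z in base_measure \<nu>. (cmod (f z))\<^sup>2 = 0"
    using assms integral_nonneg_eq_0_iff_AE[of "base_measure \<nu>" "\<lambda>z. (cmod (f z))\<^sup>2"]
    by (auto simp: nsq_def sq_integrable_def)
  then show ?thesis by eventually_elim simp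
qed

lemma nsq_mono:
  assumes "g \<in> sq_integrable \<nu>" "AE z in base_measure \<nu>. cmod (f z) \<le> cmod (g z)"
    "f \<in> borel_measurable (base_measure \<nu>)"
  shows "nsq \<nu> f \<le> nsq \<nu> g"
  unfolding nsq_def
proof (rule integral_mono_AE)
  have "f \<in> sq_integrable \<nu>" using sq_integrable_bound[OF assms(3,1), of 1] assms(2) by simp
  then show "integrable (base_measure \<nu>) (\<lambda>z. (cmod (f z))\<^sup>2)" by (simp add: sq_integrable_def)
  show "AE z in base_measure \<nu>. (cmod (f z))\<^sup>2 \<le> (cmod (g z))\<^sup>2"
    using assms(2) by eventually_elim (simp add: power_mono)
qed (use assms in \<open>simp add: sq_integrable_def\<close>)

lemma nsq_add_le:
  assumes "f \<in> sq_integrable \<nu>" "g \<in> sq_integrable \<nu>"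
  shows "nsq \<nu> (\<lambda>z. f z + g z) \<le> 2 * nsq \<nu> f + 2 * nsq \<nu> g"
proof -
  have i: "integrable (base_measure \<nu>) (\<lambda>z. (cmod (f z))\<^sup>2)" "integrable (base_measure \<nu>) (\<lambda>z. (cmod (g z))\<^sup>2)"
    "integrable (base_measure \<nu>) (\<lambda>z. (cmod (f z + g z))\<^sup>2)"
    using assms sq_integrable_add[OF assms] by (auto simp: sq_integrable_def)
  have "nsq \<nu> (\<lambda>z. f z + g z) \<le> (LINT z|base_measure \<nu>. 2 * (cmod (f z))\<^sup>2 + 2 * (cmod (g z))\<^sup>2)"
    unfolding nsq_def using i by (intro integral_mono) (auto intro: sq_sum_le)
  also have "\<dots> = 2 * nsq \<nu> f + 2 * nsq \<nu> g" unfolding nsq_def using i by simp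
  finally show ?thesis .
qed

text \<open>The class \<open>\<C>\<close> lets the basis stay inside \<open>D0\<close>, where the Wick map is defined.\<close>

lemma gram_schmidt:
  assumes "finite F" "F \<subseteq> \<C>" and sub: "\<C> \<subseteq> sq_integrable \<nu>"
    and diff: "\<And>f (n::nat) e. f \<in> \<C> \<Longrightarrow> (\<And>j. j < n \<Longrightarrow> e j \<in> \<C>) \<Longrightarrow>
      (\<lambda>z. f z - (\<Sum>j<n. l2_inner \<nu> (e j) f * e j z)) \<in> \<C>"
    and scl: "\<And>f r. f \<in> \<C> \<Longrightarrow> (\<lambda>z. complex_of_real r * f z) \<in> \<C>"
  shows "\<exists>(n::nat) e. (\<forall>j<n. e j \<in> \<C>) \<and>
    (\<forall>i<n. \<forall>j<n. l2_inner \<nu> (e i) (e j) = (if i = j then 1 else 0)) \<and>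
    (\<forall>f\<in>F. AE z in base_measure \<nu>. f z = (\<Sum>j<n. l2_inner \<nu> (e j) f * e j z))"
  using assms(1,2)
proof (induction F rule: finite_induct)
  case empty
  then show ?case by (intro exI[of _ 0]) auto
next
  case (insert f F)
  have "F \<subseteq> \<C>" using insert.prems by simp
  from insert.IH[OF this] obtain n :: nat and e where IH: "\<forall>j<n. e j \<in> \<C>"
    "\<forall>i<n. \<forall>j<n. l2_inner \<nu> (e i) (e j) = (if i = j then 1 else 0)"
    "\<forall>f\<in>F. AE z in base_measure \<nu>. f z = (\<Sum>j<n. l2_inner \<nu> (e j) f * e j z)"
    by (elim exE conjE) (rule that)
  note e = IH(1)[rule_format] and orth = IH(2)[rule_format] and ex = IH(3)[rule_format]
  have f: "f \<in> \<C>" using insert.prems by simp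
  have e2: "e j \<in> sq_integrable \<nu>" if "j < n" for j using e[OF that] sub by blast
  have f2: "f \<in> sq_integrable \<nu>" using f sub by blast
  define s where "s z = (\<Sum>j<n. l2_inner \<nu> (e j) f * e j z)" for z
  define r where "r z = f z - s z" for z
  have r: "r \<in> \<C>" unfolding r_def s_def by (rule diff[OF f]) (rule e)
  then have r2: "r \<in> sq_integrable \<nu>" using sub by blast
  have s2: "s \<in> sq_integrable \<nu>" unfolding s_def by (rule sq_integrable_sum) (use e2 in auto)
  have f_eq: "f = (\<lambda>z. r z + s z)" by (simp add: r_def fun_eq_iff)
  have er: "l2_inner \<nu> (e i) r = 0" if "i < n" for i
  proof -
    have "l2_inner \<nu> (e i) s = (\<Sum>j<n. l2_inner \<nu> (e j) f * l2_inner \<nu> (e i) (e j))"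
      unfolding s_def using e2 that by (intro l2_inner_sum_right) auto
    also have "\<dots> = l2_inner \<nu> (e i) f" using that by (simp add: orth if_distrib sum.delta cong: if_cong)
    finally have 1: "l2_inner \<nu> (e i) s = l2_inner \<nu> (e i) f" .
    have "l2_inner \<nu> (e i) f = l2_inner \<nu> (e i) r + l2_inner \<nu> (e i) s"
      unfolding l2_inner_add_right[OF e2[OF that] r2 s2, symmetric] f_eq[symmetric] ..
    then show ?thesis using 1 by simp
  qed
  have re: "l2_inner \<nu> r (e i) = 0" if "i < n" for i
    using er[OF that] l2_inner_cnj[of \<nu> r "e i"] by simp
  show ?case
  proof (cases "nsq \<nu> r = 0")
    \<comment> \<open>A remainder of norm 0 adds no basis vector; this is why the expansion holds
      only almost everywhere.\<close>
    case True
    then have "AE z in base_measure \<nu>. r z = 0" using r2 nsq_eq_0_AE by blast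
    then have "AE z in base_measure \<nu>. f z = (\<Sum>j<n. l2_inner \<nu> (e j) f * e j z)"
      by eventually_elim (simp add: r_def s_def)
    then show ?thesis using e orth ex by (intro exI[of _ n] exI[of _ e]) auto
  next
    case False
    then have N: "nsq \<nu> r > 0" using nsq_nonneg[of \<nu> r] by simp
    define d where "d z = complex_of_real (1 / sqrt (nsq \<nu> r)) * r z" for z
    define e' where "e' = e(n := d)"
    have d: "d \<in> \<C>" unfolding d_def by (rule scl[OF r])
    then have d2: "d \<in> sq_integrable \<nu>" using sub by blast
    have hd: "l2_inner \<nu> h d = complex_of_real (1 / sqrt (nsq \<nu> r)) * l2_inner \<nu> h r" for h
      unfolding d_def by (rule l2_inner_scale_right)
    have dh: "l2_inner \<nu> d h = complex_of_real (1 / sqrt (nsq \<nu> r)) * l2_inner \<nu> r h" for h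
      using hd[of h] l2_inner_cnj[of \<nu> d h] l2_inner_cnj[of \<nu> r h] by simp
    have dd: "l2_inner \<nu> d d = 1"
      unfolding l2_inner_self d_def nsq_scale using N by (simp add: norm_divide power_divide)
    have dr: "l2_inner \<nu> d r = complex_of_real (sqrt (nsq \<nu> r))"
      unfolding dh l2_inner_self using N by (simp add: real_div_sqrt flip: of_real_mult of_real_divide)
    have ds: "l2_inner \<nu> d s = 0"
    proof -
      have "l2_inner \<nu> d s = (\<Sum>j<n. l2_inner \<nu> (e j) f * l2_inner \<nu> d (e j))"
        unfolding s_def using e2 d2 by (intro l2_inner_sum_right) auto
      then show ?thesis by (simp add: dh re)
    qed
    have df: "l2_inner \<nu> d f = complex_of_real (sqrt (nsq \<nu> r))"
    proof -
      have "l2_inner \<nu> d f = l2_inner \<nu> d r + l2_inner \<nu> d s"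
        unfolding l2_inner_add_right[OF d2 r2 s2, symmetric] f_eq[symmetric] ..
      then show ?thesis using dr ds by simp
    qed
    have e'C: "e' j \<in> \<C>" if "j < Suc n" for j using e d that by (auto simp: e'_def less_Suc_eq)
    have orth': "l2_inner \<nu> (e' i) (e' j) = (if i = j then 1 else 0)" if "i < Suc n" "j < Suc n" for i j
      using that orth dd by (auto simp: e'_def less_Suc_eq hd dh er re)
    have ex': "AE z in base_measure \<nu>. g z = (\<Sum>j<Suc n. l2_inner \<nu> (e' j) g * e' j z)"
      if "g \<in> insert f F" for g
    proof (cases "g = f")
      case True
      have "f z = (\<Sum>j<Suc n. l2_inner \<nu> (e' j) f * e' j z)" for z
      proof -
        have "(\<Sum>j<Suc n. l2_inner \<nu> (e' j) f * e' j z) = s z + complex_of_real (sqrt (nsq \<nu> r)) * d z"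
          by (simp add: e'_def s_def df)
        also have "complex_of_real (sqrt (nsq \<nu> r)) * d z = r z"
          using N by (simp add: d_def)
        finally show ?thesis by (simp add: r_def)
      qed
      then show ?thesis using True by simp
    next
      case False
      then have g: "g \<in> F" "g \<in> sq_integrable \<nu>" using that insert.prems sub by auto
      \<comment> \<open>An earlier function lies almost everywhere in the span of the old basis, to
        which \<open>d\<close> is orthogonal, so its new coefficient is 0.\<close>
      have "l2_inner \<nu> d g = l2_inner \<nu> d (\<lambda>z. \<Sum>j<n. l2_inner \<nu> (e j) g * e j z)"
        using ex[OF g(1)] g d2 e2
        by (intro l2_inner_cong_AE) (auto intro!: sq_integrable_sum)
      also have "\<dots> = (\<Sum>j<n. l2_inner \<nu> (e j) g * l2_inner \<nu> d (e j))"
        using e2 d2 by (intro l2_inner_sum_right) auto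
      also have "\<dots> = 0" by (simp add: dh re)
      finally show ?thesis using ex[OF g(1)] by (simp add: e'_def)
    qed
    show ?thesis using e'C orth' ex' by (intro exI[of _ "Suc n"] exI[of _ e']) blast
  qed
qed

section \<open>Density of the functions \<open>\<one>\<^bsub>I\<^esub> \<otimes> x\<^sup>k\<close>\<close>

locale compact_prob =
  fixes \<nu> :: "real measure"
  assumes prob: "prob_space \<nu>" and sets_nu: "sets \<nu> = sets borel"
    and compact_support: "\<exists>K. compact K \<and> emeasure \<nu> (UNIV - K) = 0"
begin

sublocale prob_space \<nu> by (rule prob)

abbreviation M where "M \<equiv> base_measure \<nu>"
abbreviation L2 where "L2 \<equiv> sq_integrable \<nu>"
abbreviation ip where "ip \<equiv> l2_inner \<nu>"

lemma space_nu: "space \<nu> = UNIV"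
  using sets_eq_imp_space_eq[OF sets_nu] by simp

lemma space_M: "space M = {0..} \<times> UNIV"
  by (simp add: base_measure_def space_pair_measure space_restrict_space space_nu)

lemma measurable_fst_snd [measurable]: "fst \<in> borel_measurable M" "snd \<in> borel_measurable M"
proof -
  have 1: "fst \<in> measurable M (restrict_space lborel {0..})" unfolding base_measure_def by measurable
  have 2: "(\<lambda>x. x) \<in> borel_measurable (restrict_space lborel {0..})"
    by (intro measurable_restrict_space1) simp
  show "fst \<in> borel_measurable M" using measurable_compose[OF 1 2] by simp
  have "snd \<in> measurable M \<nu>" unfolding base_measure_def by measurable
  then show "snd \<in> borel_measurable M" by (simp add: measurable_cong_sets[OF refl sets_nu])
qed

lemma measurable_M_borel: "f \<in> borel_measurable (borel :: (real \<times> real) measure) \<Longrightarrow> f \<in> borel_measurable M"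
proof -
  assume f: "f \<in> borel_measurable (borel :: (real \<times> real) measure)"
  have "(\<lambda>z. (fst z, snd z)) \<in> measurable M (borel \<Otimes>\<^sub>M borel)" by measurable
  then have "(\<lambda>z. z) \<in> measurable M (borel :: (real \<times> real) measure)" by (simp add: borel_prod)
  from measurable_compose[OF this f] show ?thesis by simp
qed

lemma emeasure_M_Times:
  assumes "A \<in> sets borel" "A \<subseteq> {0..}" "B \<in> sets borel"
  shows "emeasure M (A \<times> B) = emeasure lborel A * emeasure \<nu> B"
proof -
  have "A \<in> sets (restrict_space lborel {0..})" using assms by (auto simp: sets_restrict_space_iff)
  then show ?thesis unfolding base_measure_def using assms
    by (subst emeasure_pair_measure_Times) (auto simp: sets_nu emeasure_restrict_space)
qed

lemma bounded_support: "\<exists>B\<ge>1. AE z in M. \<bar>snd z\<bar> \<le> B"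
proof -
  obtain K where K: "compact K" "emeasure \<nu> (UNIV - K) = 0" using compact_support by auto
  obtain B where B: "\<And>x. x \<in> K \<Longrightarrow> \<bar>x\<bar> \<le> B" using compact_imp_bounded[OF K(1)] by (auto simp: bounded_iff)
  have "AE z in M. snd z \<in> K"
  proof (rule AE_I)
    show "{z \<in> space M. snd z \<notin> K} \<subseteq> {0..} \<times> (UNIV - K)" by (auto simp: space_M)
    have "UNIV - K \<in> sets borel" using K(1) by (auto intro: borel_closed compact_imp_closed)
    then show "emeasure M ({0..} \<times> (UNIV - K)) = 0" using K(2) by (subst emeasure_M_Times) auto
    have "UNIV - K \<in> sets \<nu>" using \<open>UNIV - K \<in> sets borel\<close> by (simp add: sets_nu)
    moreover have "{0..} \<in> sets (restrict_space lborel {0::real..})" by (auto simp: sets_restrict_space_iff)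
    ultimately show "{0..} \<times> (UNIV - K) \<in> sets M" unfolding base_measure_def by (intro pair_measureI)
  qed
  then have "AE z in M. \<bar>snd z\<bar> \<le> max 1 B" by eventually_elim (use B in force)
  then show ?thesis by (intro exI[of _ "max 1 B"]) auto
qed

text \<open>An essential bound of the coordinate x, from the compact support of \<nu>; all estimates
  for powers of x are expressed by it.\<close>

definition B0 :: real where "B0 = (SOME B. B \<ge> 1 \<and> (AE z in M. \<bar>snd z\<bar> \<le> B))"

lemma B0: "B0 \<ge> 1" "AE z in M. \<bar>snd z\<bar> \<le> B0"
  using someI_ex[OF bounded_support] by (auto simp: B0_def)

definition strip :: "real \<Rightarrow> real \<Rightarrow> l2fun" where
  "strip a b = (\<lambda>(t, x). indicator {a..<b} t)"

lemma measurable_strip [measurable]: "strip a b \<in> borel_measurable M"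
  unfolding strip_def case_prod_beta by measurable

lemma measurable_ind_pow [measurable]: "ind_pow a b k \<in> borel_measurable M"
  unfolding ind_pow_def case_prod_beta by measurable

lemma nsq_strip:
  assumes "0 \<le> a" "a \<le> b"
  shows "integrable M (\<lambda>z. (cmod (strip a b z))\<^sup>2)" "nsq \<nu> (strip a b) = b - a"
proof -
  have eq: "(\<lambda>z. (cmod (strip a b z))\<^sup>2) = indicator ({a..<b} \<times> UNIV)"
    by (auto simp: strip_def fun_eq_iff indicator_def)
  have em: "emeasure M ({a..<b} \<times> UNIV) = ennreal (b - a)"
    using assms emeasure_space_1 by (subst emeasure_M_Times) (auto simp: space_nu)
  have S: "{a..<b} \<times> UNIV \<in> sets M"
  proof -
    have "{a..<b} \<in> sets (restrict_space lborel {0::real..})" using assms by (auto simp: sets_restrict_space_iff)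
    moreover have "UNIV \<in> sets \<nu>" by (simp add: sets_nu)
    ultimately show ?thesis unfolding base_measure_def by (intro pair_measureI)
  qed
  show "integrable M (\<lambda>z. (cmod (strip a b z))\<^sup>2)" unfolding eq
    using S em by (intro integrable_real_indicator) auto
  show "nsq \<nu> (strip a b) = b - a" unfolding nsq_def eq
    using S em assms by (simp add: measure_def)
qed

lemma strip_L2: "0 \<le> a \<Longrightarrow> a \<le> b \<Longrightarrow> strip a b \<in> L2"
  using nsq_strip by (simp add: sq_integrable_def)

lemma strip_bound_L2:
  assumes "0 \<le> a" "a \<le> b" and [measurable]: "f \<in> borel_measurable M"
    and le: "AE z in M. cmod (f z) \<le> B * cmod (strip a b z)"
  shows "f \<in> L2" "nsq \<nu> f \<le> B\<^sup>2 * (b - a)"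
proof -
  show "f \<in> L2" using sq_integrable_bound[OF assms(3) strip_L2[OF assms(1,2)] le] .
  have "AE z in M. cmod (f z) \<le> cmod (complex_of_real B * strip a b z)"
    using le
  proof eventually_elim
    case (elim z)
    then show ?case using mult_right_mono[OF abs_ge_self[of B] norm_ge_zero[of "strip a b z"]]
      by (simp add: norm_mult)
  qed
  then have "nsq \<nu> f \<le> nsq \<nu> (\<lambda>z. complex_of_real B * strip a b z)"
    by (intro nsq_mono sq_integrable_scale strip_L2 assms)
  also have "\<dots> = B\<^sup>2 * (b - a)" by (simp add: nsq_scale nsq_strip assms)
  finally show "nsq \<nu> f \<le> B\<^sup>2 * (b - a)" .
qed

lemma AE_ind_pow_le: "AE z in M. cmod (ind_pow a b k z) \<le> B0 ^ k * cmod (strip a b z)"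
  using B0(2)
proof eventually_elim
  case (elim z)
  then have "\<bar>snd z\<bar> ^ k \<le> B0 ^ k" by (intro power_mono) auto
  then show ?case
    by (auto simp: ind_pow_def strip_def case_prod_beta norm_mult norm_power power_abs indicator_def)
qed

lemma ind_pow_L2: "0 \<le> a \<Longrightarrow> a \<le> b \<Longrightarrow> ind_pow a b k \<in> L2"
  using strip_bound_L2(1)[OF _ _ measurable_ind_pow AE_ind_pow_le] .

text \<open>Linearity in the length \<open>b - a\<close> is the point: it makes the diagonal sums of
  the cyclicity proof vanish when the partition is refined.\<close>

lemma nsq_ind_pow: "0 \<le> a \<Longrightarrow> a \<le> b \<Longrightarrow> nsq \<nu> (ind_pow a b k) \<le> B0 ^ (2 * k) * (b - a)"
  using strip_bound_L2(2)[OF _ _ measurable_ind_pow AE_ind_pow_le, of a b k] by (simp add: power_even_eq)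

section \<open>Approximation by complex combinations of the functions
  \<open>ind_pow a b k\<close>\<close>

inductive_set pow_span :: "l2fun set" where
  zero: "(\<lambda>_. 0) \<in> pow_span"
| step: "s \<in> pow_span \<Longrightarrow> 0 \<le> a \<Longrightarrow> a \<le> b \<Longrightarrow> (\<lambda>z. c * ind_pow a b k z + s z) \<in> pow_span"

lemma pow_span_L2: "s \<in> pow_span \<Longrightarrow> s \<in> L2"
  by (induction rule: pow_span.induct)
     (auto intro!: sq_integrable_zero sq_integrable_add sq_integrable_scale ind_pow_L2)

lemma pow_span_add: "s \<in> pow_span \<Longrightarrow> t \<in> pow_span \<Longrightarrow> (\<lambda>z. s z + t z) \<in> pow_span"
proof (induction rule: pow_span.induct)
  case (step s a b c k)
  then show ?case using pow_span.step[of "\<lambda>z. s z + t z" a b c k] by (simp add: add.assoc)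
qed simp

lemma pow_span_scale: "s \<in> pow_span \<Longrightarrow> (\<lambda>z. d * s z) \<in> pow_span"
proof (induction rule: pow_span.induct)
  case (step s a b c k)
  then show ?case using pow_span.step[of "\<lambda>z. d * s z" a b "d * c" k] by (simp add: algebra_simps)
qed (simp add: pow_span.zero)

text \<open>Membership in the closed span, phrased by representatives because functions are not
  identified almost everywhere.\<close>

definition approximable :: "l2fun \<Rightarrow> bool" where
  "approximable f \<longleftrightarrow> f \<in> L2 \<and> (\<forall>\<epsilon>>0. \<exists>s\<in>pow_span. nsq \<nu> (\<lambda>z. f z - s z) < \<epsilon>)"

lemma approximable_L2: "approximable f \<Longrightarrow> f \<in> L2"
  by (simp add: approximable_def)

lemma approximable_pow_span: "s \<in> pow_span \<Longrightarrow> approximable s"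
  by (auto simp: approximable_def pow_span_L2 nsq_def intro!: bexI[of _ s])

lemma approximable_add:
  assumes "approximable f" "approximable g"
  shows "approximable (\<lambda>z. f z + g z)"
  unfolding approximable_def
proof (intro conjI allI impI)
  show "(\<lambda>z. f z + g z) \<in> L2" using assms by (intro sq_integrable_add approximable_L2)
  fix \<epsilon> :: real assume "\<epsilon> > 0"
  then have e: "\<epsilon> / 4 > 0" by simp
  obtain s t where st: "s \<in> pow_span" "t \<in> pow_span"
    "nsq \<nu> (\<lambda>z. f z - s z) < \<epsilon> / 4" "nsq \<nu> (\<lambda>z. g z - t z) < \<epsilon> / 4"
    using assms e unfolding approximable_def by meson
  have "nsq \<nu> (\<lambda>z. (f z - s z) + (g z - t z)) \<le> 2 * nsq \<nu> (\<lambda>z. f z - s z) + 2 * nsq \<nu> (\<lambda>z. g z - t z)"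
    using assms st by (intro nsq_add_le sq_integrable_diff approximable_L2 pow_span_L2)
  then have "nsq \<nu> (\<lambda>z. (f z + g z) - (s z + t z)) < \<epsilon>" using st by (simp add: algebra_simps)
  then show "\<exists>s\<in>pow_span. nsq \<nu> (\<lambda>z. f z + g z - s z) < \<epsilon>"
    using pow_span_add[OF st(1,2)] by (intro bexI[of _ "\<lambda>z. s z + t z"])
qed

lemma approximable_lim:
  assumes f: "f \<in> L2" and g: "\<And>n. approximable (g n)" and lim: "(\<lambda>n. nsq \<nu> (\<lambda>z. f z - g n z)) \<longlonglongrightarrow> 0"
  shows "approximable f"
  unfolding approximable_def
proof (intro conjI allI impI f)
  fix \<epsilon> :: real assume "\<epsilon> > 0"
  then have e: "\<epsilon> / 4 > 0" by simp
  obtain n where n: "nsq \<nu> (\<lambda>z. f z - g n z) < \<epsilon> / 4"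
    using order_tendstoD(2)[OF lim e] by (auto simp: eventually_sequentially)
  obtain s where s: "s \<in> pow_span" "nsq \<nu> (\<lambda>z. g n z - s z) < \<epsilon> / 4"
    using g[of n] e unfolding approximable_def by meson
  have "nsq \<nu> (\<lambda>z. (f z - g n z) + (g n z - s z)) \<le> 2 * nsq \<nu> (\<lambda>z. f z - g n z) + 2 * nsq \<nu> (\<lambda>z. g n z - s z)"
    using s(1) by (intro nsq_add_le sq_integrable_diff f approximable_L2[OF g] pow_span_L2)
  then show "\<exists>s\<in>pow_span. nsq \<nu> (\<lambda>z. f z - s z) < \<epsilon>" using n s by (intro bexI[of _ s]) auto
qed

text \<open>A whole sequence of approximants is scaled, which avoids dividing a tolerance by
  \<open>c\<close> when \<open>c = 0\<close>.\<close>

lemma approximable_scale: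
  assumes "approximable f"
  shows "approximable (\<lambda>z. c * f z)"
proof -
  have "\<forall>n. \<exists>s\<in>pow_span. nsq \<nu> (\<lambda>z. f z - s z) < 1 / Suc n"
    using assms by (auto simp: approximable_def)
  then obtain s where s: "\<And>n. s n \<in> pow_span" "\<And>n. nsq \<nu> (\<lambda>z. f z - s n z) < 1 / Suc n" by metis
  have "(\<lambda>n. nsq \<nu> (\<lambda>z. f z - s n z)) \<longlonglongrightarrow> 0"
    by (rule tendsto_sandwich[OF _ _ tendsto_const LIMSEQ_inverse_real_of_nat])
       (use s(2) nsq_nonneg in \<open>auto intro!: always_eventually less_imp_le simp: inverse_eq_divide\<close>)
  then have "(\<lambda>n. (cmod c)\<^sup>2 * nsq \<nu> (\<lambda>z. f z - s n z)) \<longlonglongrightarrow> 0" by (rule tendsto_mult_right_zero)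
  moreover have "(cmod c)\<^sup>2 * nsq \<nu> (\<lambda>z. f z - s n z) = nsq \<nu> (\<lambda>z. c * f z - c * s n z)" for n
    unfolding nsq_scale[symmetric] by (simp add: algebra_simps)
  ultimately have lim: "(\<lambda>n. nsq \<nu> (\<lambda>z. c * f z - c * s n z)) \<longlonglongrightarrow> 0" by simp
  show ?thesis
    by (rule approximable_lim[OF sq_integrable_scale[OF approximable_L2[OF assms]] _ lim])
       (intro approximable_pow_span pow_span_scale s)
qed

lemma approximable_sum:
  "(\<And>i. i \<in> I \<Longrightarrow> approximable (f i)) \<Longrightarrow> approximable (\<lambda>z. \<Sum>i\<in>I. f i z)"
  by (induction I rule: infinite_finite_induct)
     (simp_all add: approximable_add approximable_pow_span[OF pow_span.zero])

text \<open>The limit \<open>f\<close> inherits the majorant \<open>w\<close>, so the squared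
  distance is dominated by four times the square of \<open>w\<close>, and pointwise convergence
  becomes L2 convergence.\<close>

lemma approximable_dct:
  assumes g: "\<And>n. approximable (g n)" and [measurable]: "f \<in> borel_measurable M" and w: "w \<in> L2"
    and bnd: "\<And>n z. z \<in> space M \<Longrightarrow> cmod (g n z) \<le> cmod (w z)"
    and lim: "\<And>z. z \<in> space M \<Longrightarrow> (\<lambda>n. g n z) \<longlonglongrightarrow> f z"
  shows "approximable f"
proof (rule approximable_lim[where g=g])
  have fw: "cmod (f z) \<le> cmod (w z)" if "z \<in> space M" for z
    using tendsto_norm[OF lim[OF that]] bnd[OF that] by (intro LIMSEQ_le_const2) auto
  then show "f \<in> L2" using w by (intro sq_integrable_bound[where g=w and B=1, OF assms(2)]) auto
  have [measurable]: "g n \<in> borel_measurable M" "w \<in> borel_measurable M" for n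
    using approximable_L2[OF g] w by (auto intro: sq_integrable_measurable)
  have "(\<lambda>n. LINT z|M. (cmod (f z - g n z))\<^sup>2) \<longlonglongrightarrow> (LINT z|M. 0)"
  proof (rule integral_dominated_convergence)
    show "integrable M (\<lambda>z. 4 * (cmod (w z))\<^sup>2)" using w by (simp add: sq_integrable_def)
    show "AE z in M. (\<lambda>n. (cmod (f z - g n z))\<^sup>2) \<longlonglongrightarrow> 0"
    proof (rule AE_I2)
      fix z assume "z \<in> space M"
      then have "(\<lambda>n. (cmod (f z - g n z))\<^sup>2) \<longlonglongrightarrow> (cmod (f z - f z))\<^sup>2"
        by (intro tendsto_intros lim)
      then show "(\<lambda>n. (cmod (f z - g n z))\<^sup>2) \<longlonglongrightarrow> 0" by simp
    qed
    show "AE z in M. norm ((cmod (f z - g n z))\<^sup>2) \<le> 4 * (cmod (w z))\<^sup>2" for n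
    proof (rule AE_I2)
      fix z assume z: "z \<in> space M"
      have "cmod (f z - g n z) \<le> 2 * cmod (w z)"
        using norm_triangle_ineq4[of "f z" "g n z"] fw[OF z] bnd[OF z, of n] by simp
      then have "(cmod (f z - g n z))\<^sup>2 \<le> (2 * cmod (w z))\<^sup>2" by (intro power_mono) auto
      then show "norm ((cmod (f z - g n z))\<^sup>2) \<le> 4 * (cmod (w z))\<^sup>2" by (simp add: power_mult_distrib)
    qed
  qed measurable
  then show "(\<lambda>n. nsq \<nu> (\<lambda>z. f z - g n z)) \<longlonglongrightarrow> 0" by (simp add: nsq_def)
qed (rule g)

text \<open>On a strip of finite measure uniform approximation in x is L2 approximation, and x stays
  in \<open>{-B0..B0}\<close> almost everywhere. The Weierstrass theorem then supplies polynomials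
  in x, and these are combinations of \<open>ind_pow\<close>.\<close>

lemma approximable_strip_continuous:
  assumes c: "continuous_on UNIV c" and ab: "0 \<le> a" "a \<le> b"
  shows "approximable (\<lambda>z. complex_of_real (indicator {a..<b} (fst z) * c (snd z)))" (is "approximable ?f")
proof -
  have cm [measurable]: "c \<in> borel_measurable borel" using c by (rule borel_measurable_continuous_onI)
  obtain C where C: "\<forall>y\<in>c ` {-B0..B0}. norm y \<le> C"
    using compact_imp_bounded[OF compact_continuous_image[OF continuous_on_subset[OF c subset_UNIV] compact_Icc, of "-B0" B0]]
    unfolding bounded_iff by blast
  have "AE z in M. cmod (?f z) \<le> C * cmod (strip a b z)"
    using B0(2)
  proof eventually_elim
    case (elim z)
    then have "snd z \<in> {-B0..B0}" by auto
    then have "\<bar>c (snd z)\<bar> \<le> C" using C by auto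
    then show ?case by (auto simp: strip_def case_prod_beta indicator_def)
  qed
  then have fL: "?f \<in> L2" using ab by (intro strip_bound_L2(1)[of a b]) auto
  have "\<exists>s\<in>pow_span. nsq \<nu> (\<lambda>z. ?f z - s z) < \<epsilon>" if "\<epsilon> > 0" for \<epsilon>
  proof -
    \<comment> \<open>Chosen to make the final bound \<open>\<delta>\<^sup>2 * (b - a)\<close>
      smaller than \<epsilon>; the summand 1 covers \<open>a = b\<close>.\<close>
    define \<delta> where "\<delta> = sqrt (\<epsilon> / (b - a + 1))"
    have d: "\<delta> > 0" using that ab by (simp add: \<delta>_def)
    have d2: "\<delta>\<^sup>2 * (b - a) < \<epsilon>"
      using that ab by (simp add: \<delta>_def field_simps) 
    obtain p where p: "real_polynomial_function p" "\<And>x. x \<in> {-B0..B0} \<Longrightarrow> \<bar>c x - p x\<bar> < \<delta>"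
      using Stone_Weierstrass_real_polynomial_function[OF compact_Icc continuous_on_subset[OF c subset_UNIV] d] by metis
    obtain d n where dn: "p = (\<lambda>x. \<Sum>i\<le>n. d i * x ^ i)" using p(1) real_polynomial_function_iff_sum by auto
    let ?s = "\<lambda>z. \<Sum>i\<le>n. complex_of_real (d i) * ind_pow a b i z"
    have "(\<lambda>z. \<Sum>i\<in>I. complex_of_real (d i) * ind_pow a b i z) \<in> pow_span" if "finite I" for I
      using that by (induction I rule: finite_induct) (auto intro!: pow_span.intros ab)
    then have s: "?s \<in> pow_span" by simp
    have s_eq: "?s z = complex_of_real (indicator {a..<b} (fst z) * p (snd z))" for z
      by (simp add: ind_pow_def case_prod_beta dn sum_distrib_left mult_ac)
    have "AE z in M. cmod (?f z - ?s z) \<le> \<delta> * cmod (strip a b z)"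
      using B0(2)
    proof eventually_elim
      case (elim z)
      then have "snd z \<in> {-B0..B0}" by auto
      then have pz: "\<bar>c (snd z) - p (snd z)\<bar> \<le> \<delta>" using p(2) by (simp add: less_imp_le)
      have "?f z - ?s z = complex_of_real (indicator {a..<b} (fst z) * (c (snd z) - p (snd z)))"
        unfolding s_eq by (simp add: algebra_simps)
      then have "cmod (?f z - ?s z) = indicator {a..<b} (fst z) * \<bar>c (snd z) - p (snd z)\<bar>"
        by (simp only: norm_of_real abs_mult) (simp add: indicator_def)
      also have "\<dots> \<le> \<delta> * cmod (strip a b z)"
        using pz by (auto simp: strip_def case_prod_beta indicator_def)
      finally show ?case .
    qed
    moreover have "(\<lambda>z. ?f z - ?s z) \<in> borel_measurable M"
      using sq_integrable_measurable[OF sq_integrable_diff[OF fL pow_span_L2[OF s]]] .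
    ultimately have "nsq \<nu> (\<lambda>z. ?f z - ?s z) \<le> \<delta>\<^sup>2 * (b - a)" using ab by (intro strip_bound_L2(2))
    then show ?thesis using s d2 by (intro bexI[OF _ s]) simp
  qed
  then show ?thesis using fL by (auto simp: approximable_def)
qed

text \<open>Closed quadrants form an intersection-stable generator of the Borel sets of the plane.
  The cut-off indicator is a limit of products of a half-open time interval and a continuous ramp in
  x.\<close>

lemma approximable_quadrant:
  assumes m: "0 \<le> m"
  shows "approximable (\<lambda>z. indicator ({..(p, r)} \<inter> {0..<m} \<times> UNIV) z)"
proof (rule approximable_dct)
  \<comment> \<open>The endpoint exceeds \<open>p\<close>, so that \<open>t = p\<close> survives in
    the limit; clamping between 0 and \<open>m\<close> keeps the interval admissible and inside the
    strip.\<close>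
  let ?b = "\<lambda>n::nat. max 0 (min m (p + inverse (real (Suc n))))"
  let ?h = "\<lambda>(n::nat) x. max 0 (min 1 (1 - real n * (x - r)))"
  let ?g = "\<lambda>n z. complex_of_real (indicator {0..<?b n} (fst z) * ?h n (snd z))"
  show "approximable (?g n)" for n
    by (rule approximable_strip_continuous) (auto intro!: continuous_intros)
  show "strip 0 m \<in> L2" using m by (intro strip_L2) auto
  show "cmod (?g n z) \<le> cmod (strip 0 m z)" for n z
    by (auto simp: strip_def case_prod_beta indicator_def norm_mult)
  have quad: "{..(p, r)} = {..p} \<times> {..r}" by auto
  have "{..(p, r)} \<inter> {0..<m} \<times> UNIV \<in> sets (borel :: (real \<times> real) measure)"
    unfolding borel_prod[symmetric]
    unfolding quad by (intro sets.Int pair_measureI) auto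
  then show "(\<lambda>z. indicator ({..(p, r)} \<inter> {0..<m} \<times> UNIV) z :: complex) \<in> borel_measurable M"
    by (intro measurable_M_borel borel_measurable_indicator)
  fix z assume "z \<in> space M"
  then obtain t x where z: "z = (t, x)" "t \<ge> 0" by (auto simp: space_M)
  have 1: "(\<lambda>n. indicator {0..<?b n} t :: real) \<longlonglongrightarrow> indicator {..p} t * indicator {..<m} t"
  proof (cases "t \<le> p")
    case True
    then have "t < p + inverse (real (Suc n))" for n
      using inverse_positive_iff_positive[of "real (Suc n)"] by linarith
    then have "indicator {0..<?b n} t = (indicator {..p} t * indicator {..<m} t :: real)" for n
      using True z(2) by (auto simp: indicator_def)
    then show ?thesis by simp
  next
    case False
    have "(\<lambda>n. p + inverse (real (Suc n))) \<longlonglongrightarrow> p + 0"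
      by (intro tendsto_intros LIMSEQ_inverse_real_of_nat)
    then have "\<forall>\<^sub>F n in sequentially. p + inverse (real (Suc n)) < t" using False by (intro order_tendstoD) auto
    then have "\<forall>\<^sub>F n in sequentially. indicator {0..<?b n} t = (indicator {..p} t * indicator {..<m} t :: real)"
      by eventually_elim (use False z(2) in \<open>auto simp: indicator_def\<close>)
    then show ?thesis by (rule tendsto_eventually)
  qed
  have 2: "(\<lambda>n. ?h n x) \<longlonglongrightarrow> indicator {..r} x"
  proof (cases "x \<le> r")
    case True
    then have "?h n x = 1" for n using mult_nonneg_nonpos[of "real n" "x - r"] by simp
    then show ?thesis using True by simp
  next
    case False
    obtain N where N: "real N * (x - r) > 1" using False reals_Archimedean3[of "x - r"] by auto
    have "?h n x = 0" if "n \<ge> N" for n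
    proof -
      have "real N * (x - r) \<le> real n * (x - r)" using that False by (intro mult_right_mono) auto
      then show ?thesis using N by simp
    qed
    then have "\<forall>\<^sub>F n in sequentially. ?h n x = 0" by (auto simp: eventually_sequentially)
    then show ?thesis using False by (simp add: tendsto_eventually)
  qed
  have "(\<lambda>n. ?g n z) \<longlonglongrightarrow> complex_of_real (indicator {..p} t * indicator {..<m} t * indicator {..r} x)"
    unfolding z fst_conv snd_conv by (intro tendsto_of_real tendsto_mult 1 2)
  also have "complex_of_real (indicator {..p} t * indicator {..<m} t * indicator {..r} x) =
      indicator ({..(p, r)} \<inter> {0..<m} \<times> UNIV) z"
    using z by (auto simp: indicator_def)
  finally show "(\<lambda>n. ?g n z) \<longlonglongrightarrow> indicator ({..(p, r)} \<inter> {0..<m} \<times> UNIV) z" .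
qed

lemma strip_eq_ind_pow: "strip a b = ind_pow a b 0"
  by (auto simp: strip_def ind_pow_def fun_eq_iff indicator_def)

lemma approximable_strip: "0 \<le> a \<Longrightarrow> a \<le> b \<Longrightarrow> approximable (strip a b)"
  using pow_span.step[OF pow_span.zero, of a b 1 0] by (simp add: strip_eq_ind_pow approximable_pow_span)

text \<open>Dynkin's argument. The cut with a strip is what keeps complements square integrable: up
  to the cut, a complement is the strip minus the set.\<close>

lemma approximable_borel_set:
  assumes m: "0 \<le> m" and A: "A \<in> sets (borel :: (real \<times> real) measure)"
  shows "approximable (\<lambda>z. indicator (A \<inter> {0..<m} \<times> UNIV) z)"
proof -
  have gen: "sets (borel :: (real \<times> real) measure) = sigma_sets UNIV (range atMost)"
    using arg_cong[OF borel_eq_atMost, of sets] by simp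
  have Is: "Int_stable (range (atMost :: (real \<times> real) \<Rightarrow> _))"
  proof (rule Int_stableI)
    fix A B :: "(real \<times> real) set" assume "A \<in> range atMost" "B \<in> range atMost"
    then obtain a b where "A = {..a}" "B = {..b}" by auto
    then have "A \<inter> B = {..inf a b}" by auto
    then show "A \<inter> B \<in> range atMost" by blast
  qed
  have box: "{0..<m} \<times> UNIV \<in> sets (borel :: (real \<times> real) measure)"
    unfolding borel_prod[symmetric] by (intro pair_measureI) auto
  have strip_ind: "strip 0 m = indicator ({0..<m} \<times> UNIV)"
    by (auto simp: strip_def fun_eq_iff indicator_def)
  have "A \<in> sigma_sets UNIV (range atMost)" using A gen by simp
  with Is subset_UNIV[of "range atMost", unfolded Pow_UNIV[symmetric]] show ?thesis
  proof (induction rule: sigma_sets_induct_disjoint)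
    case (basic A)
    then obtain p r where "A = {..(p, r)}" by auto
    then show ?case using approximable_quadrant[OF m] by simp
  next
    case empty
    show ?case using approximable_pow_span[OF pow_span.zero] by simp
  next
    case (compl A)
    have "(\<lambda>z. indicator ((UNIV - A) \<inter> {0..<m} \<times> UNIV) z :: complex) =
        (\<lambda>z. strip 0 m z + (-1) * indicator (A \<inter> {0..<m} \<times> UNIV) z)"
      by (auto simp: strip_ind fun_eq_iff indicator_def)
    then show ?case using approximable_add[OF approximable_strip[OF order_refl m] approximable_scale[OF compl(2), of "-1"]]
      by simp
  next
    case (union A)
    let ?A = "\<lambda>i. A i \<inter> {0..<m} \<times> UNIV"
    let ?g = "\<lambda>n z. \<Sum>i<n. indicator (?A i) z :: complex"
    have dj: "disjoint_family ?A" using union(1) by (auto simp: disjoint_family_on_def)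
    have g_eq: "?g n z = indicator (\<Union>i<n. ?A i) z" for n z
      using disjoint_family_on_mono[OF subset_UNIV[of "{..<n}"] dj] by (intro indicator_UN_disjoint[symmetric]) auto
    show ?case
    proof (rule approximable_dct[where g="?g" and w="strip 0 m"])
      show "approximable (?g n)" for n using union(3) by (rule approximable_sum)
      have "A i \<in> sets borel" for i using union(2) unfolding gen by auto
      then have "(\<Union>i. A i) \<inter> {0..<m} \<times> UNIV \<in> sets borel" using box by auto
      then show "(\<lambda>z. indicator ((\<Union>i. A i) \<inter> {0..<m} \<times> UNIV) z :: complex) \<in> borel_measurable M"
        by (intro measurable_M_borel borel_measurable_indicator)
      show "strip 0 m \<in> L2" using m by (intro strip_L2) auto
      show "cmod (?g n z) \<le> cmod (strip 0 m z)" for n z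
        unfolding g_eq by (auto simp: strip_ind indicator_def)
      show "(\<lambda>n. ?g n z) \<longlonglongrightarrow> indicator ((\<Union>i. A i) \<inter> {0..<m} \<times> UNIV) z" for z
      proof (cases "z \<in> (\<Union>i. ?A i)")
        case True
        then obtain N where N: "z \<in> ?A N" by auto
        then have "?g n z = 1" if "n > N" for n unfolding g_eq using that by (auto simp: indicator_def)
        then have "\<forall>\<^sub>F n in sequentially. ?g n z = 1" by (auto simp: eventually_sequentially intro!: exI[of _ "Suc N"])
        then show ?thesis using N by (intro tendsto_eventually) (auto simp: indicator_def elim: eventually_mono)
      next
        case False
        then have 1: "?g n z = 0" for n unfolding g_eq by (auto simp: indicator_def)
        have 2: "indicator ((\<Union>i. A i) \<inter> {0..<m} \<times> UNIV) z = (0::complex)"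
          using False by (auto simp: indicator_def)
        show ?thesis unfolding 1 2 by (rule tendsto_const)
      qed
    qed
  qed
qed

lemma sets_M_borel: "A \<in> sets M \<Longrightarrow> A \<in> sets borel"
proof -
  assume A: "A \<in> sets M"
  have "sets M \<subseteq> sigma_sets (space M) (sets (borel :: (real \<times> real) measure))"
    unfolding base_measure_def sets_pair_measure space_pair_measure
  proof (rule sigma_sets_mono', clarify)
    fix a b assume a: "a \<in> sets (restrict_space lborel {0::real..})" and b: "b \<in> sets \<nu>"
    have "a \<in> sets borel" using a by (auto simp: sets_restrict_space_iff)
    then show "a \<times> b \<in> sets borel" using b
      unfolding borel_prod[symmetric] by (intro pair_measureI) (auto simp: sets_nu)
  qed
  then have "A \<in> sigma_sets (space M) (sets (borel :: (real \<times> real) measure))" using A by auto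
  have spM: "space M \<in> sets borel"
    unfolding space_M borel_prod[symmetric] by (intro pair_measureI) auto
  show ?thesis using \<open>A \<in> sigma_sets (space M) _\<close>
    by (induction rule: sigma_sets.induct) (auto intro: spM sets.Diff)
qed

theorem approximable_all:
  assumes f: "f \<in> L2"
  shows "approximable f"
proof -
  have [measurable]: "f \<in> borel_measurable M" using f by (rule sq_integrable_measurable)
  obtain F where F': "\<forall>i. simple_function M (F i)" "\<forall>x\<in>space M. (\<lambda>i. F i x) \<longlonglongrightarrow> f x"
    "\<forall>i. \<forall>x\<in>space M. dist (F i x) 0 \<le> 2 * dist (f x) 0"
    using borel_measurable_implies_sequence_metric[of f M 0] by auto
  note F = F'[rule_format]
  let ?g = "\<lambda>(i::nat) z. F i z * indicator ({0..<real i} \<times> UNIV) z"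
  \<comment> \<open>The simple function cut off at time \<open>i\<close>, written as a combination
    of indicators of Borel sets inside a strip, so that \<open>approximable_borel_set\<close>
    applies to each term.\<close>
  define g where "g i z = (\<Sum>y\<in>F i ` space M. y * indicator ((F i -` {y} \<inter> space M) \<inter> {0..<real i} \<times> UNIV) z)" for i :: nat and z
  have g_eq: "g i z = ?g i z" if "z \<in> space M" for i z
  proof -
    have 1: "(\<Sum>y\<in>F i ` space M. indicator (F i -` {y} \<inter> space M) z *\<^sub>R y) = F i z"
      by (rule simple_function_indicator_representation_banach[OF F(1) that, symmetric])
    have 2: "g i z = (\<Sum>y\<in>F i ` space M. indicator (F i -` {y} \<inter> space M) z *\<^sub>R y) *
        indicator ({0..<real i} \<times> UNIV) z"
      unfolding g_def sum_distrib_right by (intro sum.cong refl) (auto simp: indicator_def)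
    show ?thesis unfolding 2 1 ..
  qed
  show ?thesis
  proof (rule approximable_dct[where g=g and w="\<lambda>z. 2 * f z"])
    show "approximable (g i)" for i
      unfolding g_def
    proof (intro approximable_sum approximable_scale approximable_borel_set)
      fix y assume "y \<in> F i ` space M"
      then show "F i -` {y} \<inter> space M \<in> sets borel"
        using simple_functionD(2)[OF F(1), of i "{y}"] by (intro sets_M_borel)
    qed simp
    show "(\<lambda>z. 2 * f z) \<in> L2" using f by (rule sq_integrable_scale)
    show "cmod (g n z) \<le> cmod (2 * f z)" if "z \<in> space M" for n z
      using F(3)[OF that, of n] by (auto simp: g_eq[OF that] norm_mult indicator_def)
    show "(\<lambda>n. g n z) \<longlonglongrightarrow> f z" if z: "z \<in> space M" for z
    proof -
      obtain N where N: "fst z < real N" using reals_Archimedean2 by blast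
      have "(\<lambda>n. indicator ({0..<real n} \<times> UNIV) z :: complex) \<longlonglongrightarrow> 1"
      proof (rule tendsto_eventually, unfold eventually_sequentially, intro exI allI impI)
        fix n assume "N \<le> n"
        then have "fst z < real n" using N by linarith
        then show "indicator ({0..<real n} \<times> UNIV) z = (1::complex)"
          using z by (cases z) (auto simp: space_M indicator_def)
      qed
      from tendsto_mult[OF F(2)[OF z] this] show ?thesis by (simp add: g_eq[OF z])
    qed
  qed measurable
qed

end

section \<open>The \<open>q\<close>-Fock space\<close>

lemma omit_in_lists: "xs \<in> lists S \<Longrightarrow> omit k xs \<in> lists S"
  using set_omit[of k xs] by (auto simp: in_lists_conv_set)

lemma nth_in_lists: "xs \<in> lists S \<Longrightarrow> k < length xs \<Longrightarrow> xs ! k \<in> S"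
  by (auto simp: in_lists_conv_set)

text \<open>The set of words is arbitrary, so that restrictions on length obey the same closure
  lemmas as restrictions on letters.\<close>

definition vecs :: "l2fun list set \<Rightarrow> fock_vec set" where
  "vecs S = {v. keys v \<subseteq> S}"

lemma vecs_lists: "vecs (lists S) = fock_on S"
  by (simp add: vecs_def fock_on_def)

lemma vecs_add: "v \<in> vecs S \<Longrightarrow> w \<in> vecs S \<Longrightarrow> v + w \<in> vecs S"
  using keys_add[of v w] by (auto simp: vecs_def)

lemma vecs_fscale: "v \<in> vecs S \<Longrightarrow> fscale c v \<in> vecs S"
  using keys_fscale[of c v] by (auto simp: vecs_def)

lemma vecs_zero: "0 \<in> vecs S"
  by (simp add: vecs_def)

lemma vecs_sum: "(\<And>i. i \<in> I \<Longrightarrow> v i \<in> vecs S) \<Longrightarrow> (\<Sum>i\<in>I. v i) \<in> vecs S"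
  by (induction I rule: infinite_finite_induct) (simp_all add: vecs_add vecs_zero)

lemma vecs_tensor: "tensor xs \<in> vecs S \<longleftrightarrow> xs \<in> S"
  by (simp add: vecs_def)

lemma flinear_vecs:
  assumes "flinear A" "\<And>xs. xs \<in> S \<Longrightarrow> A (tensor xs) \<in> vecs T" "v \<in> vecs S"
  shows "A v \<in> vecs T"
proof -
  have "A v = (\<Sum>xs\<in>keys v. fscale (lookup v xs) (A (tensor xs)))"
    by (subst fock_vec_expand) (simp add: flinear_sum flinear_scale assms(1))
  also have "\<dots> \<in> vecs T" using assms(2,3) by (intro vecs_sum vecs_fscale) (auto simp: vecs_def)
  finally show ?thesis .
qed

lemma creation_vecs: "v \<in> fock_on S \<Longrightarrow> f \<in> S \<Longrightarrow> creation f v \<in> fock_on S"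
  unfolding vecs_lists[symmetric]
  by (rule flinear_vecs[OF flinear_creation]) (auto simp: vecs_tensor)

lemma annihilation_vecs:
  assumes "v \<in> fock_on S"
  shows "annihilation q \<nu> f v \<in> fock_on S"
  using assms unfolding vecs_lists[symmetric]
proof (rule flinear_vecs[OF flinear_annihilation, rotated])
  fix xs assume "xs \<in> lists S"
  then show "annihilation q \<nu> f (tensor xs) \<in> vecs (lists S)" unfolding annihilation_tensor
    by (intro vecs_sum vecs_fscale) (simp add: vecs_tensor omit_in_lists)
qed

lemma gauge_vecs:
  assumes "v \<in> fock_on S" "\<And>x. x \<in> S \<Longrightarrow> T x \<in> S"
  shows "gauge q T v \<in> fock_on S"
  using assms(1) unfolding vecs_lists[symmetric]
proof (rule flinear_vecs[OF flinear_gauge, rotated])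
  fix xs assume "xs \<in> lists S"
  then show "gauge q T (tensor xs) \<in> vecs (lists S)" unfolding gauge_tensor
    by (intro vecs_sum vecs_fscale) (simp add: vecs_tensor omit_in_lists nth_in_lists assms(2))
qed

locale q_fock = compact_prob \<nu> for \<nu> +
  fixes q :: real and \<iota> :: "fock_vec \<Rightarrow> 'f::chilbert_space"
  assumes q: "-1 < q" "q < 1" and fock: "is_q_fock q \<nu> \<iota>"
begin

abbreviation FV where "FV \<equiv> fock_alg \<nu>"
abbreviation cre where "cre \<equiv> creation"
abbreviation ann where "ann \<equiv> annihilation q \<nu>"

definition E :: "l2fun list \<Rightarrow> 'f" where "E xs = \<iota> (tensor xs)"

lemma iota_add: "u \<in> FV \<Longrightarrow> v \<in> FV \<Longrightarrow> \<iota> (u + v) = \<iota> u + \<iota> v"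
  and iota_scale: "u \<in> FV \<Longrightarrow> \<iota> (fscale c u) = c *\<^sub>C \<iota> u"
  and iota_inner: "u \<in> FV \<Longrightarrow> v \<in> FV \<Longrightarrow> cinner (\<iota> u) (\<iota> v) = innerq q \<nu> u v"
  and iota_dense: "closure (\<iota> ` FV) = UNIV"
  using fock by (simp_all add: is_q_fock_def is_completion_def)

lemmas FV_add = vecs_add[of _ "lists L2", unfolded vecs_lists]
  and FV_fscale = vecs_fscale[of _ "lists L2", unfolded vecs_lists]
  and FV_sum = vecs_sum[of _ _ "lists L2", unfolded vecs_lists]
  and FV_zero = vecs_zero[of "lists L2", unfolded vecs_lists]
  and FV_tensor = vecs_tensor[of _ "lists L2", unfolded vecs_lists]

lemma iota_zero [simp]: "\<iota> 0 = 0"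
  using iota_scale[OF FV_zero, of 0] by simp

lemma iota_sum: "(\<And>i. i \<in> I \<Longrightarrow> v i \<in> FV) \<Longrightarrow> \<iota> (\<Sum>i\<in>I. v i) = (\<Sum>i\<in>I. \<iota> (v i))"
  by (induction I rule: infinite_finite_induct) (simp_all add: iota_add FV_sum)

lemma keys_FV: "v \<in> FV \<Longrightarrow> xs \<in> keys v \<Longrightarrow> xs \<in> lists L2"
  by (auto simp: fock_on_def)

lemma iota_flinear:
  assumes "flinear A" "\<And>xs. xs \<in> lists L2 \<Longrightarrow> A (tensor xs) \<in> FV" "v \<in> FV"
  shows "\<iota> (A v) = (\<Sum>xs\<in>keys v. lookup v xs *\<^sub>C \<iota> (A (tensor xs)))"
proof -
  have "A v = (\<Sum>xs\<in>keys v. fscale (lookup v xs) (A (tensor xs)))"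
    by (subst fock_vec_expand) (simp add: flinear_sum flinear_scale assms(1))
  also have "\<iota> \<dots> = (\<Sum>xs\<in>keys v. lookup v xs *\<^sub>C \<iota> (A (tensor xs)))"
    using keys_FV[OF assms(3)] assms(2) by (simp add: iota_sum FV_fscale iota_scale)
  finally show ?thesis .
qed

lemma iota_expand: "v \<in> FV \<Longrightarrow> \<iota> v = (\<Sum>xs\<in>keys v. lookup v xs *\<^sub>C E xs)"
  unfolding E_def by (rule iota_flinear[OF flinear_id]) (auto simp: FV_tensor)

lemma E_inner_Cons:
  assumes "f \<in> L2" "xs \<in> lists L2" "ys \<in> lists L2"
  shows "cinner (E (f # xs)) (E ys) =
    (\<Sum>k<length ys. complex_of_real (q ^ k) * ip f (ys ! k) * cinner (E xs) (E (omit k ys)))"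
  using assms by (simp add: E_def iota_inner FV_tensor innerq_tensor_Cons omit_in_lists)

lemma E_inner_Nil: "ys \<in> lists L2 \<Longrightarrow> cinner (E []) (E ys) = (if ys = [] then 1 else 0)"
  by (simp add: E_def iota_inner FV_tensor innerq_tensor_Nil)

lemma E_eqI:
  assumes "\<And>ys. ys \<in> lists L2 \<Longrightarrow> cinner x (E ys) = cinner y (E ys)"
  shows "x = y"
proof (rule cinner_eq_dense[OF iota_dense])
  fix s assume "s \<in> \<iota> ` FV"
  then obtain v where v: "v \<in> FV" "s = \<iota> v" by auto
  have "cinner x s = cinner y s"
    unfolding v(2) iota_expand[OF v(1)]
    using keys_FV[OF v(1)] assms by (simp add: cinner_sum_right cinner_scaleC_right)
  then show "cinner s x = cinner s y" by (metis cinner_commute)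
qed

text \<open>The inner product sees the first letter only through \<open>ip\<close>. This is how
  multilinearity and almost everywhere equality, which formal words ignore, become valid in the
  completion.\<close>

lemma E_Cons_cong:
  assumes "f \<in> L2" "\<And>i. i \<in> I \<Longrightarrow> g i \<in> L2" "xs \<in> lists L2"
    and AE: "AE z in M. f z = (\<Sum>i\<in>I. c i * g i z)"
  shows "E (f # xs) = (\<Sum>i\<in>I. c i *\<^sub>C E (g i # xs))"
proof (rule E_eqI)
  fix ys assume ys: "ys \<in> lists L2"
  have ipf: "ip f y = (\<Sum>i\<in>I. cnj (c i) * ip (g i) y)" if "y \<in> L2" for y
  proof -
    have "ip y f = ip y (\<lambda>z. \<Sum>i\<in>I. c i * g i z)"
      by (rule l2_inner_cong_AE) (use AE that assms in \<open>auto intro!: sq_integrable_sum\<close>)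
    also have "\<dots> = (\<Sum>i\<in>I. c i * ip y (g i))" by (rule l2_inner_sum_right) (use that assms in auto)
    finally have "cnj (ip y f) = (\<Sum>i\<in>I. cnj (c i) * cnj (ip y (g i)))" by simp
    then show ?thesis by (simp flip: l2_inner_cnj)
  qed
  have "cinner (E (f # xs)) (E ys) = (\<Sum>k<length ys. \<Sum>i\<in>I.
      cnj (c i) * (complex_of_real (q ^ k) * ip (g i) (ys ! k) * cinner (E xs) (E (omit k ys))))"
    unfolding E_inner_Cons[OF assms(1,3) ys]
    by (intro sum.cong refl) (simp add: ipf nth_in_lists[OF ys] sum_distrib_left sum_distrib_right mult_ac)
  also have "\<dots> = (\<Sum>i\<in>I. \<Sum>k<length ys.
      cnj (c i) * (complex_of_real (q ^ k) * ip (g i) (ys ! k) * cinner (E xs) (E (omit k ys))))"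
    by (rule sum.swap)
  also have "\<dots> = (\<Sum>i\<in>I. cnj (c i) * cinner (E (g i # xs)) (E ys))"
    using assms ys by (simp add: E_inner_Cons sum_distrib_left)
  also have "\<dots> = cinner (\<Sum>i\<in>I. c i *\<^sub>C E (g i # xs)) (E ys)"
    by (simp add: cinner_sum_left cinner_scaleC_left)
  finally show "cinner (E (f # xs)) (E ys) = cinner (\<Sum>i\<in>I. c i *\<^sub>C E (g i # xs)) (E ys)" .
qed

lemma cre_FV: "f \<in> L2 \<Longrightarrow> v \<in> FV \<Longrightarrow> cre f v \<in> FV"
  by (rule creation_vecs)

lemma ann_FV: "v \<in> FV \<Longrightarrow> ann f v \<in> FV"
  by (rule annihilation_vecs)

lemma iota_cre: "f \<in> L2 \<Longrightarrow> v \<in> FV \<Longrightarrow> \<iota> (cre f v) = (\<Sum>xs\<in>keys v. lookup v xs *\<^sub>C E (f # xs))"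
  unfolding E_def by (subst iota_flinear[OF flinear_creation]) (auto simp: FV_tensor)

lemma iota_cre_cong:
  assumes "f \<in> L2" "\<And>i. i \<in> I \<Longrightarrow> g i \<in> L2" "v \<in> FV"
    and "AE z in M. f z = (\<Sum>i\<in>I. c i * g i z)"
  shows "\<iota> (cre f v) = (\<Sum>i\<in>I. c i *\<^sub>C \<iota> (cre (g i) v))"
proof -
  have "\<iota> (cre f v) = (\<Sum>xs\<in>keys v. \<Sum>i\<in>I. c i *\<^sub>C (lookup v xs *\<^sub>C E (g i # xs)))"
    using keys_FV[OF assms(3)] assms
    by (simp add: iota_cre E_Cons_cong[of f I g _ c] scaleC_sum_right scaleC_scaleC mult.commute)
  also have "\<dots> = (\<Sum>i\<in>I. \<Sum>xs\<in>keys v. c i *\<^sub>C (lookup v xs *\<^sub>C E (g i # xs)))" by (rule sum.swap)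
  also have "\<dots> = (\<Sum>i\<in>I. c i *\<^sub>C \<iota> (cre (g i) v))"
    using assms by (simp add: iota_cre scaleC_sum_right)
  finally show ?thesis .
qed

lemma iota_form_eqI:
  assumes A: "flinear A" "\<And>xs. xs \<in> lists L2 \<Longrightarrow> A (tensor xs) \<in> FV"
    and B: "flinear B" "\<And>xs. xs \<in> lists L2 \<Longrightarrow> B (tensor xs) \<in> FV"
    and eq: "\<And>xs ys. xs \<in> lists L2 \<Longrightarrow> ys \<in> lists L2 \<Longrightarrow>
      cinner (\<iota> (A (tensor xs))) (E ys) = cinner (E xs) (\<iota> (B (tensor ys)))"
    and uv: "u \<in> FV" "v \<in> FV"
  shows "cinner (\<iota> (A u)) (\<iota> v) = cinner (\<iota> u) (\<iota> (B v))"
proof -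
  have 1: "\<iota> (A u) = (\<Sum>xs\<in>keys u. lookup u xs *\<^sub>C \<iota> (A (tensor xs)))"
    by (rule iota_flinear) (use A uv in auto)
  have 2: "\<iota> (B v) = (\<Sum>xs\<in>keys v. lookup v xs *\<^sub>C \<iota> (B (tensor xs)))"
    by (rule iota_flinear) (use B uv in auto)
  show ?thesis
    unfolding 1 2 iota_expand[OF uv(1)] iota_expand[OF uv(2)] cinner_sum_left
    unfolding cinner_sum_right cinner_scaleC_left cinner_scaleC_right
    by (intro sum.cong refl) (simp add: eq keys_FV[OF uv(1)] keys_FV[OF uv(2)])
qed

section \<open>Creation and annihilation: adjointness and norm bounds\<close>

lemma ann_E: "xs \<in> lists L2 \<Longrightarrow> \<iota> (ann f (tensor xs)) =
    (\<Sum>k<length xs. (complex_of_real (q ^ k) * ip f (xs ! k)) *\<^sub>C E (omit k xs))"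
  by (simp add: annihilation_tensor iota_sum FV_fscale FV_tensor omit_in_lists iota_scale E_def)

lemma cre_ann_adjoint:
  assumes "f \<in> L2" "u \<in> FV" "v \<in> FV"
  shows "cinner (\<iota> (cre f u)) (\<iota> v) = cinner (\<iota> u) (\<iota> (ann f v))"
proof (rule iota_form_eqI[OF flinear_creation _ flinear_annihilation _ _ assms(2,3)])
  fix xs ys assume xs: "xs \<in> lists L2" and ys: "ys \<in> lists L2"
  show "cinner (\<iota> (cre f (tensor xs))) (E ys) = cinner (E xs) (\<iota> (ann f (tensor ys)))"
    using E_inner_Cons[OF assms(1) xs ys] ys
    by (simp add: ann_E cinner_sum_right cinner_scaleC_right mult_ac) (simp add: E_def)
qed (use assms in \<open>auto simp: FV_tensor ann_FV cre_FV simp del: creation_tensor\<close>)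

lemma ann_cre_adjoint:
  assumes "f \<in> L2" "u \<in> FV" "v \<in> FV"
  shows "cinner (\<iota> (ann f u)) (\<iota> v) = cinner (\<iota> u) (\<iota> (cre f v))"
  using cre_ann_adjoint[OF assms(1,3,2)] by (metis cinner_commute)

text \<open>Annihilation lowers the particle number, which makes it the induction parameter of
  \<open>column_bound_below\<close>.\<close>

definition FV_below :: "nat \<Rightarrow> fock_vec set" where
  "FV_below n = vecs {xs \<in> lists L2. length xs < n}"

lemma FV_below_FV: "v \<in> FV_below n \<Longrightarrow> v \<in> FV"
  by (auto simp: FV_below_def vecs_def fock_on_def)

lemma ann_FV_below: "v \<in> FV_below (Suc n) \<Longrightarrow> ann f v \<in> FV_below n"
  unfolding FV_below_def
proof (rule flinear_vecs[OF flinear_annihilation])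
  fix xs assume "xs \<in> {xs \<in> lists L2. length xs < Suc n}"
  then show "ann f (tensor xs) \<in> vecs {xs \<in> lists L2. length xs < n}"
    unfolding annihilation_tensor
    by (intro vecs_sum vecs_fscale) (auto simp: vecs_tensor omit_in_lists simp del: in_lists_conv_set)
qed

lemma FV_below_exists:
  assumes "finite J" "\<And>j. j \<in> J \<Longrightarrow> \<psi> j \<in> FV"
  shows "\<exists>n. \<forall>j\<in>J. \<psi> j \<in> FV_below n"
proof -
  let ?K = "\<Union>j\<in>J. length ` keys (\<psi> j)"
  have fin: "finite ?K" using assms(1) by auto
  have "\<psi> j \<in> FV_below (Suc (Max ?K))" if j: "j \<in> J" for j
  proof -
    have "length xs \<le> Max ?K" if "xs \<in> keys (\<psi> j)" for xs
      using fin j that by (intro Max_ge) auto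
    then show ?thesis using assms(2)[OF j] by (auto simp: FV_below_def vecs_def fock_on_def less_Suc_eq_le)
  qed
  then show ?thesis by blast
qed

text \<open>The solution of \<open>1 + \<bar>q\<bar> * C = C\<close>: in the induction on particle
  number a bound with \<open>C\<close> for fewer particles yields one with
  \<open>1 + \<bar>q\<bar> * C\<close>, so the constant reproduces itself.\<close>

definition C :: real where "C = 1 / (1 - \<bar>q\<bar>)"

lemma C_eq: "1 + \<bar>q\<bar> * C = C" and C_pos: "C > 0"
proof -
  have "\<bar>q\<bar> < 1" using q by auto
  then show "C > 0" "1 + \<bar>q\<bar> * C = C" by (auto simp: C_def field_simps)
qed

definition orthonormal :: "'i set \<Rightarrow> ('i \<Rightarrow> l2fun) \<Rightarrow> bool" where
  "orthonormal J e \<longleftrightarrow> (\<forall>j\<in>J. e j \<in> L2) \<and> (\<forall>i\<in>J. \<forall>j\<in>J. ip (e i) (e j) = (if i = j then 1 else 0))"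

text \<open>Duality of row and column. If S is the left-hand sum and x the column vector in
  \<open>col\<close>, adjointness gives S \<le> ||x|| ||\<eta>||, and the column bound gives ||x||^2
  \<le> C S. The column bound is assumed only for this single family, so that an induction
  hypothesis on fewer particles can supply it.\<close>

lemma row_bound_aux:
  assumes fin: "finite J" and e: "\<And>j. j \<in> J \<Longrightarrow> e j \<in> L2"
    and col: "(norm (\<Sum>j\<in>J. \<iota> (cre (e j) (ann (e j) \<eta>))))\<^sup>2 \<le> C * (\<Sum>j\<in>J. (norm (\<iota> (ann (e j) \<eta>)))\<^sup>2)"
    and eta: "\<eta> \<in> FV"
  shows "(\<Sum>j\<in>J. (norm (\<iota> (ann (e j) \<eta>)))\<^sup>2) \<le> C * (norm (\<iota> \<eta>))\<^sup>2"
proof -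
  define S where "S = (\<Sum>j\<in>J. (norm (\<iota> (ann (e j) \<eta>)))\<^sup>2)"
  define x where "x = (\<Sum>j\<in>J. \<iota> (cre (e j) (ann (e j) \<eta>)))"
  have S0: "S \<ge> 0" unfolding S_def by (intro sum_nonneg) auto
  have "complex_of_real S = (\<Sum>j\<in>J. cinner (\<iota> (ann (e j) \<eta>)) (\<iota> (ann (e j) \<eta>)))"
    unfolding S_def by (simp add: cinner_self)
  also have "\<dots> = (\<Sum>j\<in>J. cinner (\<iota> (cre (e j) (ann (e j) \<eta>))) (\<iota> \<eta>))"
    using e eta by (intro sum.cong refl cre_ann_adjoint[symmetric] ann_FV)
  also have "\<dots> = cinner x (\<iota> \<eta>)" unfolding x_def by (simp add: cinner_sum_left)
  finally have "S \<le> norm x * norm (\<iota> \<eta>)"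
    using cmod_cinner_le[of x "\<iota> \<eta>"] S0 by (metis abs_of_nonneg norm_of_real)
  then have "S\<^sup>2 \<le> (norm x)\<^sup>2 * (norm (\<iota> \<eta>))\<^sup>2"
    using S0 by (metis power_mono power_mult_distrib)
  also have "\<dots> \<le> (C * S) * (norm (\<iota> \<eta>))\<^sup>2"
    using col unfolding x_def S_def by (intro mult_right_mono) auto
  finally have "S * S \<le> S * (C * (norm (\<iota> \<eta>))\<^sup>2)" by (simp add: power2_eq_square mult_ac)
  then show ?thesis using S0 C_pos unfolding S_def[symmetric]
    by (cases "S = 0") (auto simp: mult_le_cancel_left)
qed

text \<open>
  By the relation \<open>a(f) a\<^sup>*(g) = \<langle>f, g\<rangle> + q a\<^sup>*(g) a(f)\<close>, the squared norm on the left is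
  \<open>\<Sum>\<^sub>i \<parallel>\<psi>\<^sub>i\<parallel>\<^sup>2 + q \<Sum>\<^sub>i\<^sub>j \<langle>a(e\<^sub>j)\<psi>\<^sub>i, a(e\<^sub>i)\<psi>\<^sub>j\<rangle>\<close>.  The double sum involves fewer particles and is controlled
  by the adjoint estimate.
\<close>

lemma column_bound_below:
  assumes fin: "finite J" and orth: "orthonormal J e" and psi: "\<And>j. j \<in> J \<Longrightarrow> \<psi> j \<in> FV_below n"
  shows "(norm (\<Sum>j\<in>J. \<iota> (cre (e j) (\<psi> j))))\<^sup>2 \<le> C * (\<Sum>j\<in>J. (norm (\<iota> (\<psi> j)))\<^sup>2)"
  using psi
proof (induction n arbitrary: \<psi>)
  case 0
  then have "\<psi> j = 0" if "j \<in> J" for j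
    using that by (fastforce simp: FV_below_def vecs_def)
  moreover have "cre f 0 = 0" for f using flinear_scale[OF flinear_creation, of f 0 0] by simp
  ultimately show ?case by simp
next
  case (Suc n)
  have e: "e j \<in> L2" if "j \<in> J" for j using orth that by (auto simp: orthonormal_def)
  have psi: "\<psi> j \<in> FV" if "j \<in> J" for j using Suc.prems[OF that] FV_below_FV by blast
  define S where "S = (\<Sum>j\<in>J. (norm (\<iota> (\<psi> j)))\<^sup>2)"
  define a where "a i j = \<iota> (ann (e i) (\<psi> j))" for i j
  define x where "x = (\<Sum>j\<in>J. \<iota> (cre (e j) (\<psi> j)))"
  \<comment> \<open>The induction hypothesis applies because annihilation has removed one particle
    from each \<open>\<psi> j\<close>.\<close>
  have row: "(\<Sum>i\<in>J. (norm (a i j))\<^sup>2) \<le> C * (norm (\<iota> (\<psi> j)))\<^sup>2" if j: "j \<in> J" for j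
    unfolding a_def
  proof (rule row_bound_aux[OF fin e])
    show "(norm (\<Sum>i\<in>J. \<iota> (cre (e i) (ann (e i) (\<psi> j)))))\<^sup>2 \<le> C * (\<Sum>i\<in>J. (norm (\<iota> (ann (e i) (\<psi> j))))\<^sup>2)"
      by (rule Suc.IH) (rule ann_FV_below[OF Suc.prems[OF j]])
  qed (use psi j in auto)
  have entry: "cinner (\<iota> (cre (e i) (\<psi> i))) (\<iota> (cre (e j) (\<psi> j))) =
      (if i = j then complex_of_real ((norm (\<iota> (\<psi> i)))\<^sup>2) else 0) + complex_of_real q * cinner (a j i) (a i j)"
    if ij: "i \<in> J" "j \<in> J" for i j
  proof -
    have "cinner (\<iota> (cre (e i) (\<psi> i))) (\<iota> (cre (e j) (\<psi> j))) = cinner (\<iota> (\<psi> i)) (\<iota> (ann (e i) (cre (e j) (\<psi> j))))"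
      using ij by (intro cre_ann_adjoint e psi cre_FV)
    also have "\<dots> = ip (e i) (e j) * cinner (\<iota> (\<psi> i)) (\<iota> (\<psi> j)) +
        complex_of_real q * cinner (\<iota> (\<psi> i)) (\<iota> (cre (e j) (ann (e i) (\<psi> j))))"
      using ij by (simp add: annihilation_creation iota_add iota_scale FV_fscale psi e cre_FV ann_FV
          cinner_add_right cinner_scaleC_right)
    also have "cinner (\<iota> (\<psi> i)) (\<iota> (cre (e j) (ann (e i) (\<psi> j)))) = cinner (a j i) (a i j)"
      unfolding a_def using ij by (intro ann_cre_adjoint[symmetric] e psi ann_FV)
    also have "ip (e i) (e j) = (if i = j then 1 else 0)" using orth ij by (simp add: orthonormal_def)
    finally show ?thesis by (auto simp: cinner_self)
  qed
  have "complex_of_real ((norm x)\<^sup>2) = (\<Sum>i\<in>J. \<Sum>j\<in>J. cinner (\<iota> (cre (e i) (\<psi> i))) (\<iota> (cre (e j) (\<psi> j))))"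
    unfolding cinner_self[symmetric] x_def cinner_sum_left cinner_sum_right by (rule sum.swap)
  also have "\<dots> = (\<Sum>i\<in>J. \<Sum>j\<in>J. (if i = j then complex_of_real ((norm (\<iota> (\<psi> i)))\<^sup>2) else 0) +
      complex_of_real q * cinner (a j i) (a i j))"
    by (intro sum.cong refl entry)
  also have "\<dots> = complex_of_real S + complex_of_real q * (\<Sum>i\<in>J. \<Sum>j\<in>J. cinner (a j i) (a i j))"
    using fin by (simp add: sum.distrib sum_distrib_left sum.delta S_def)
  finally have x_eq: "complex_of_real ((norm x)\<^sup>2) =
      complex_of_real S + complex_of_real q * (\<Sum>i\<in>J. \<Sum>j\<in>J. cinner (a j i) (a i j))" .
  \<comment> \<open>Each product of norms is replaced by half a sum of squares; exchanging the
    summation indices identifies the two halves, and the row bound applies to each vector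
    separately.\<close>
  have cross: "cmod (\<Sum>i\<in>J. \<Sum>j\<in>J. cinner (a j i) (a i j)) \<le> C * S"
  proof -
    have "cmod (\<Sum>i\<in>J. \<Sum>j\<in>J. cinner (a j i) (a i j)) \<le> (\<Sum>i\<in>J. \<Sum>j\<in>J. cmod (cinner (a j i) (a i j)))"
      by (rule order_trans[OF norm_sum sum_mono[OF norm_sum]])
    also have "\<dots> \<le> (\<Sum>i\<in>J. \<Sum>j\<in>J. ((norm (a j i))\<^sup>2 + (norm (a i j))\<^sup>2) / 2)"
    proof (intro sum_mono)
      fix i j
      show "cmod (cinner (a j i) (a i j)) \<le> ((norm (a j i))\<^sup>2 + (norm (a i j))\<^sup>2) / 2"
        using cmod_cinner_le[of "a j i" "a i j"] sum_squares_bound[of "norm (a j i)" "norm (a i j)"] by simp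
    qed
    also have "\<dots> = ((\<Sum>i\<in>J. \<Sum>j\<in>J. (norm (a j i))\<^sup>2) + (\<Sum>i\<in>J. \<Sum>j\<in>J. (norm (a i j))\<^sup>2)) / 2"
      by (simp add: sum.distrib flip: sum_divide_distrib)
    also have "(\<Sum>i\<in>J. \<Sum>j\<in>J. (norm (a i j))\<^sup>2) = (\<Sum>i\<in>J. \<Sum>j\<in>J. (norm (a j i))\<^sup>2)" by (rule sum.swap)
    also have "((\<Sum>i\<in>J. \<Sum>j\<in>J. (norm (a j i))\<^sup>2) + (\<Sum>i\<in>J. \<Sum>j\<in>J. (norm (a j i))\<^sup>2)) / 2 =
        (\<Sum>i\<in>J. \<Sum>j\<in>J. (norm (a j i))\<^sup>2)" by simp
    also have "\<dots> \<le> (\<Sum>i\<in>J. C * (norm (\<iota> (\<psi> i)))\<^sup>2)" by (intro sum_mono row)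
    finally show ?thesis by (simp add: S_def sum_distrib_left)
  qed
  have "(norm x)\<^sup>2 = cmod (complex_of_real ((norm x)\<^sup>2))" by (simp del: of_real_power)
  also have "\<dots> \<le> cmod (complex_of_real S) + \<bar>q\<bar> * cmod (\<Sum>i\<in>J. \<Sum>j\<in>J. cinner (a j i) (a i j))"
    unfolding x_eq by (rule order_trans[OF norm_triangle_ineq]) (simp add: norm_mult)
  also have "cmod (complex_of_real S) = S" unfolding S_def by (simp add: sum_nonneg del: of_real_sum)
  also have "S + \<bar>q\<bar> * cmod (\<Sum>i\<in>J. \<Sum>j\<in>J. cinner (a j i) (a i j)) \<le> S + \<bar>q\<bar> * (C * S)"
    by (intro add_left_mono mult_left_mono cross) auto
  also have "\<dots> = (1 + \<bar>q\<bar> * C) * S" by (simp add: algebra_simps)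
  finally show ?case by (simp add: C_eq x_def S_def)
qed

lemma column_bound:
  assumes "finite J" "orthonormal J e" "\<And>j. j \<in> J \<Longrightarrow> \<psi> j \<in> FV"
  shows "(norm (\<Sum>j\<in>J. \<iota> (cre (e j) (\<psi> j))))\<^sup>2 \<le> C * (\<Sum>j\<in>J. (norm (\<iota> (\<psi> j)))\<^sup>2)"
proof -
  obtain n where "\<forall>j\<in>J. \<psi> j \<in> FV_below n" using FV_below_exists[of J \<psi>] assms by blast
  then show ?thesis using column_bound_below[OF assms(1,2)] by blast
qed

lemma row_bound:
  assumes "finite J" "orthonormal J e" "\<eta> \<in> FV"
  shows "(\<Sum>j\<in>J. (norm (\<iota> (ann (e j) \<eta>)))\<^sup>2) \<le> C * (norm (\<iota> \<eta>))\<^sup>2"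
  using assms by (intro row_bound_aux column_bound ann_FV) (auto simp: orthonormal_def)

text \<open>Rescaling to an orthonormal family. Letters of norm 0 cannot be rescaled, but they
  contribute the zero vector. The weights \<open>nsq \<nu> (h j)\<close> record how little a short
  interval contributes.\<close>

lemma column_bound_orthogonal:
  assumes fin: "finite J" and h: "\<And>j. j \<in> J \<Longrightarrow> h j \<in> L2"
    and orth: "\<And>i j. i \<in> J \<Longrightarrow> j \<in> J \<Longrightarrow> i \<noteq> j \<Longrightarrow> ip (h i) (h j) = 0"
    and psi: "\<And>j. j \<in> J \<Longrightarrow> \<psi> j \<in> FV"
  shows "(norm (\<Sum>j\<in>J. \<iota> (cre (h j) (\<psi> j))))\<^sup>2 \<le> C * (\<Sum>j\<in>J. nsq \<nu> (h j) * (norm (\<iota> (\<psi> j)))\<^sup>2)"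
proof -
  define J' where "J' = {j \<in> J. nsq \<nu> (h j) \<noteq> 0}"
  define r where "r j = sqrt (nsq \<nu> (h j))" for j
  define e where "e j = (\<lambda>z. complex_of_real (1 / r j) * h j z)" for j
  have r0: "r j \<noteq> 0" if "j \<in> J'" for j using that by (simp add: J'_def r_def)
  have r2: "(r j)\<^sup>2 = nsq \<nu> (h j)" for j by (simp add: r_def nsq_nonneg)
  have e: "e j \<in> L2" if "j \<in> J" for j unfolding e_def using h[OF that] by (rule sq_integrable_scale)
  have ipe: "ip (e i) (e j) = complex_of_real (1 / r i) * (complex_of_real (1 / r j) * ip (h i) (h j))" for i j
  proof -
    have "ip f (e j) = complex_of_real (1 / r j) * ip f (h j)" for f j
      unfolding e_def by (rule l2_inner_scale_right)
    from this[of "e i" j] this[of "h j" i] show ?thesis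
      using l2_inner_cnj[of \<nu> "e i" "h j"] l2_inner_cnj[of \<nu> "h i" "h j"] by simp
  qed
  have on: "orthonormal J' e" unfolding orthonormal_def
  proof (intro conjI ballI)
    fix i j assume ij: "i \<in> J'" "j \<in> J'"
    show "ip (e i) (e j) = (if i = j then 1 else 0)"
    proof (cases "i = j")
      case True
      have "ip (e j) (e j) = complex_of_real (1 / r j * (1 / r j) * (r j)\<^sup>2)"
        unfolding ipe unfolding l2_inner_self r2 by simp
      then show ?thesis using True r0[OF ij(2)] by (simp add: power2_eq_square)
    next
      case False
      then show ?thesis using orth ij by (simp add: ipe J'_def)
    qed
  qed (use e in \<open>auto simp: J'_def\<close>)
  have "(\<Sum>j\<in>J. \<iota> (cre (h j) (\<psi> j))) = (\<Sum>j\<in>J'. \<iota> (cre (h j) (\<psi> j)))"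
  proof (rule sum.mono_neutral_right[OF fin])
    show "\<forall>j\<in>J - J'. \<iota> (cre (h j) (\<psi> j)) = 0"
    proof
      fix j assume j: "j \<in> J - J'"
      then have "AE z in M. h j z = 0" using h by (intro nsq_eq_0_AE) (auto simp: J'_def)
      \<comment> \<open>A letter vanishing almost everywhere is expanded over the empty index set;
        the \<open>undefined\<close> arguments are never evaluated.\<close>
      then show "\<iota> (cre (h j) (\<psi> j)) = 0"
        using iota_cre_cong[of "h j" "{}" undefined "\<psi> j" undefined] j h psi by simp
    qed
  qed (auto simp: J'_def)
  also have "\<dots> = (\<Sum>j\<in>J'. \<iota> (cre (e j) (fscale (complex_of_real (r j)) (\<psi> j))))"
  proof (rule sum.cong[OF refl])
    fix j assume j: "j \<in> J'"
    then have jJ: "j \<in> J" by (simp add: J'_def)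
    have "\<iota> (cre (h j) (\<psi> j)) = (\<Sum>i\<in>{()}. complex_of_real (r j) *\<^sub>C \<iota> (cre (e j) (\<psi> j)))"
      by (rule iota_cre_cong) (use h e psi jJ r0[OF j] in \<open>auto simp: e_def\<close>)
    then show "\<iota> (cre (h j) (\<psi> j)) = \<iota> (cre (e j) (fscale (complex_of_real (r j)) (\<psi> j)))"
      using jJ by (simp add: flinear_scale[OF flinear_creation] iota_scale cre_FV e psi)
  qed
  also have "(norm \<dots>)\<^sup>2 \<le> C * (\<Sum>j\<in>J'. (norm (\<iota> (fscale (complex_of_real (r j)) (\<psi> j))))\<^sup>2)"
    using fin by (intro column_bound on FV_fscale psi) (auto simp: J'_def)
  also have "(\<Sum>j\<in>J'. (norm (\<iota> (fscale (complex_of_real (r j)) (\<psi> j))))\<^sup>2) = (\<Sum>j\<in>J'. nsq \<nu> (h j) * (norm (\<iota> (\<psi> j)))\<^sup>2)"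
    by (intro sum.cong refl) (auto simp: iota_scale psi J'_def norm_scaleC power_mult_distrib r2)
  also have "\<dots> = (\<Sum>j\<in>J. nsq \<nu> (h j) * (norm (\<iota> (\<psi> j)))\<^sup>2)"
    by (rule sum.mono_neutral_left[OF fin]) (auto simp: J'_def)
  finally show ?thesis .
qed

lemma cre_bound:
  assumes "f \<in> L2" "v \<in> FV"
  shows "norm (\<iota> (cre f v)) \<le> sqrt (C * nsq \<nu> f) * norm (\<iota> v)"
proof (rule power2_le_imp_le)
  have "(norm (\<Sum>j\<in>{()}. \<iota> (cre f v)))\<^sup>2 \<le> C * (\<Sum>j\<in>{()}. nsq \<nu> f * (norm (\<iota> v))\<^sup>2)"
    using assms by (intro column_bound_orthogonal) auto
  then show "(norm (\<iota> (cre f v)))\<^sup>2 \<le> (sqrt (C * nsq \<nu> f) * norm (\<iota> v))\<^sup>2"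
    using C_pos nsq_nonneg[of \<nu> f] by (simp add: power_mult_distrib mult.assoc)
qed (use C_pos nsq_nonneg[of \<nu> f] in auto)

text \<open>An operator has the norm of its adjoint: the squared norm of
  \<open>\<iota> (ann f v)\<close> is the inner product of \<open>\<iota> (cre f (ann f v))\<close>
  with \<open>\<iota> v\<close>.\<close>

lemma ann_bound:
  assumes "f \<in> L2" "v \<in> FV"
  shows "norm (\<iota> (ann f v)) \<le> sqrt (C * nsq \<nu> f) * norm (\<iota> v)"
proof -
  let ?a = "norm (\<iota> (ann f v))" and ?K = "sqrt (C * nsq \<nu> f)"
  have "complex_of_real (?a\<^sup>2) = cinner (\<iota> (cre f (ann f v))) (\<iota> v)"
    using assms by (simp add: cre_ann_adjoint ann_FV cinner_self)
  then have "?a\<^sup>2 = cmod (cinner (\<iota> (cre f (ann f v))) (\<iota> v))"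
    by (metis abs_of_nonneg norm_of_real zero_le_power2)
  also have "\<dots> \<le> norm (\<iota> (cre f (ann f v))) * norm (\<iota> v)" by (rule cmod_cinner_le)
  also have "\<dots> \<le> (?K * ?a) * norm (\<iota> v)"
    using assms by (intro mult_right_mono cre_bound ann_FV) auto
  finally have "?a * ?a \<le> ?a * (?K * norm (\<iota> v))" by (simp add: power2_eq_square mult_ac)
  then show ?thesis using C_pos nsq_nonneg[of \<nu> f]
    by (cases "?a = 0") (auto simp: mult_le_cancel_left)
qed

section \<open>Gauge operators: norm bound and symmetry\<close>

definition multiplier :: "l2fun \<Rightarrow> bool" where
  "multiplier g \<longleftrightarrow> g \<in> borel_measurable M \<and> (\<forall>z. g z \<in> \<real>) \<and> (\<exists>B. AE z in M. cmod (g z) \<le> B)"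

lemma mult_op_L2:
  assumes [measurable]: "g \<in> borel_measurable M" and B: "AE z in M. cmod (g z) \<le> B" and f: "f \<in> L2"
  shows "mult_op g f \<in> L2"
proof (rule sq_integrable_bound[OF _ f])
  have [measurable]: "f \<in> borel_measurable M" using f by (rule sq_integrable_measurable)
  show "mult_op g f \<in> borel_measurable M" unfolding mult_op_def by measurable
  show "AE z in M. cmod (mult_op g f z) \<le> B * cmod (f z)"
    using B by eventually_elim (simp add: mult_op_def norm_mult mult_right_mono)
qed

lemma multiplier_L2: "multiplier g \<Longrightarrow> f \<in> L2 \<Longrightarrow> mult_op g f \<in> L2"
  using mult_op_L2 by (auto simp: multiplier_def)

lemma gauge_FV: "multiplier g \<Longrightarrow> v \<in> FV \<Longrightarrow> gauge q (mult_op g) v \<in> FV"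
  by (rule gauge_vecs) (auto intro: multiplier_L2)

lemma gauge_E:
  assumes "\<And>x. x \<in> L2 \<Longrightarrow> T x \<in> L2" "xs \<in> lists L2"
  shows "\<iota> (gauge q T (tensor xs)) = (\<Sum>k<length xs. complex_of_real (q ^ k) *\<^sub>C E (T (xs ! k) # omit k xs))"
proof -
  have m: "tensor (T (xs ! k) # omit k xs) \<in> FV" if "k < length xs" for k
    unfolding FV_tensor using assms that omit_in_lists nth_in_lists by (metis lists.Cons)
  have "\<iota> (gauge q T (tensor xs)) = (\<Sum>k<length xs. \<iota> (fscale (complex_of_real (q ^ k)) (tensor (T (xs ! k) # omit k xs))))"
    unfolding gauge_tensor by (rule iota_sum) (auto intro: FV_fscale m)
  also have "\<dots> = (\<Sum>k<length xs. complex_of_real (q ^ k) *\<^sub>C E (T (xs ! k) # omit k xs))"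
    unfolding E_def by (intro sum.cong refl iota_scale m) auto
  finally show ?thesis .
qed

lemma gram_schmidt_L2:
  assumes "finite F" "F \<subseteq> L2"
  shows "\<exists>(n::nat) e. (\<forall>j<n. e j \<in> L2) \<and>
    (\<forall>i<n. \<forall>j<n. ip (e i) (e j) = (if i = j then 1 else 0)) \<and>
    (\<forall>f\<in>F. AE z in M. f z = (\<Sum>j<n. ip (e j) f * e j z))"
proof (rule gram_schmidt[OF assms order_refl])
  fix f e and n :: nat assume "f \<in> L2" and e: "\<And>j. j < n \<Longrightarrow> e j \<in> L2"
  show "(\<lambda>z. f z - (\<Sum>j<n. ip (e j) f * e j z)) \<in> L2"
    by (intro sq_integrable_diff[OF \<open>f \<in> L2\<close>] sq_integrable_sum) (simp add: e)
qed (rule sq_integrable_scale)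

text \<open>Multiplication by \<open>u\<close> preserves \<open>ip\<close> and hence orthonormality.
  On \<open>v\<close> the operator is a column over \<open>mult_op u (e j)\<close> after a row over
  \<open>e j\<close>, each of norm at most the square root of \<open>C\<close>. The family
  \<open>e\<close> may depend on \<open>v\<close>, since only the finitely many letters of
  \<open>v\<close> must be expanded.\<close>

lemma gauge_unimodular_bound:
  assumes u [measurable]: "u \<in> borel_measurable M" and u1: "\<And>z. cmod (u z) = 1" and v: "v \<in> FV"
  shows "norm (\<iota> (gauge q (mult_op u) v)) \<le> C * norm (\<iota> v)"
proof -
  let ?T = "mult_op u"
  have TL: "?T x \<in> L2" if "x \<in> L2" for x using mult_op_L2[OF u _ that, of 1] u1 by simp
  define F where "F = (\<Union>xs\<in>keys v. set xs)"
  have F: "finite F" "F \<subseteq> L2" using keys_FV[OF v] by (auto simp: F_def)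
  obtain n :: nat and e where e: "\<forall>j<n. e j \<in> L2"
    "\<forall>i<n. \<forall>j<n. ip (e i) (e j) = (if i = j then 1 else 0)"
    "\<forall>f\<in>F. AE z in M. f z = (\<Sum>j<n. ip (e j) f * e j z)"
    using gram_schmidt_L2[OF F] by (elim exE conjE) (rule that)
  have on: "orthonormal {..<n} e" using e by (auto simp: orthonormal_def)
  have onT: "orthonormal {..<n} (\<lambda>j. ?T (e j))"
  proof -
    have "ip (?T f) (?T g) = ip f g" for f g
    proof -
      have "cnj (u z) * u z = 1" for z using complex_norm_square[of "u z"] u1[of z] by (simp add: mult.commute)
      then have w: "cnj (u z * f z) * (u z * g z) = cnj (f z) * g z" for z
        by (metis (no_types, lifting) complex_cnj_mult mult.assoc mult.commute mult.left_neutral)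
      show ?thesis unfolding l2_inner_def mult_op_def w ..
    qed
    then show ?thesis using on TL by (simp add: orthonormal_def)
  qed
  have e2: "e j \<in> L2" if "j < n" for j using e that by blast
  have tens: "\<iota> (gauge q ?T (tensor xs)) = (\<Sum>j<n. \<iota> (cre (?T (e j)) (ann (e j) (tensor xs))))"
    if xs: "xs \<in> lists L2" and "xs \<in> keys v" for xs
  proof -
    have "E (?T (xs ! k) # omit k xs) = (\<Sum>j<n. ip (e j) (xs ! k) *\<^sub>C E (?T (e j) # omit k xs))"
      if k: "k < length xs" for k
    proof (rule E_Cons_cong)
      have "xs ! k \<in> F" using \<open>xs \<in> keys v\<close> nth_mem[OF k] by (auto simp: F_def)
      then have "AE z in M. (xs ! k) z = (\<Sum>j<n. ip (e j) (xs ! k) * e j z)" using e(3) by blast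
      then show "AE z in M. ?T (xs ! k) z = (\<Sum>j<n. ip (e j) (xs ! k) * ?T (e j) z)"
        by eventually_elim (simp add: mult_op_def sum_distrib_left mult_ac)
    qed (use TL e2 nth_in_lists[OF xs k] omit_in_lists[OF xs, of k] in simp_all)
    then have "\<iota> (gauge q ?T (tensor xs)) = (\<Sum>k<length xs. \<Sum>j<n.
        (complex_of_real (q ^ k) * ip (e j) (xs ! k)) *\<^sub>C E (?T (e j) # omit k xs))"
      using xs by (simp add: gauge_E TL scaleC_sum_right scaleC_scaleC)
    also have "\<dots> = (\<Sum>j<n. \<Sum>k<length xs.
        (complex_of_real (q ^ k) * ip (e j) (xs ! k)) *\<^sub>C E (?T (e j) # omit k xs))"
      by (rule sum.swap)
    also have "\<dots> = (\<Sum>j<n. \<iota> (cre (?T (e j)) (ann (e j) (tensor xs))))"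
      using xs e2 TL
      by (simp add: annihilation_tensor flinear_sum[OF flinear_creation] flinear_scale[OF flinear_creation]
          iota_sum iota_scale FV_fscale FV_tensor omit_in_lists E_def)
    finally show ?thesis .
  qed
  have "\<iota> (gauge q ?T v) = (\<Sum>xs\<in>keys v. lookup v xs *\<^sub>C \<iota> (gauge q ?T (tensor xs)))"
    by (rule iota_flinear[OF flinear_gauge _ v]) (auto intro!: gauge_vecs TL simp: FV_tensor)
  also have "\<dots> = (\<Sum>xs\<in>keys v. \<Sum>j<n. lookup v xs *\<^sub>C \<iota> (cre (?T (e j)) (ann (e j) (tensor xs))))"
    using keys_FV[OF v] by (simp add: tens scaleC_sum_right)
  also have "\<dots> = (\<Sum>j<n. \<Sum>xs\<in>keys v. lookup v xs *\<^sub>C \<iota> (cre (?T (e j)) (ann (e j) (tensor xs))))"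
    by (rule sum.swap)
  also have "\<dots> = (\<Sum>j<n. \<iota> (cre (?T (e j)) (ann (e j) v)))"
  proof (rule sum.cong[OF refl])
    fix j assume "j \<in> {..<n}"
    then show "(\<Sum>xs\<in>keys v. lookup v xs *\<^sub>C \<iota> (cre (?T (e j)) (ann (e j) (tensor xs)))) = \<iota> (cre (?T (e j)) (ann (e j) v))"
      using TL e2 by (intro iota_flinear[OF flinear_comp[OF flinear_creation flinear_annihilation] _ v, symmetric])
        (auto intro!: cre_FV ann_FV simp: FV_tensor)
  qed
  finally have "(norm (\<iota> (gauge q ?T v)))\<^sup>2 \<le> C * (\<Sum>j<n. (norm (\<iota> (ann (e j) v)))\<^sup>2)"
    using column_bound[OF finite_lessThan onT, of "\<lambda>j. ann (e j) v"] v by (simp add: ann_FV)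
  also have "\<dots> \<le> C * (C * (norm (\<iota> v))\<^sup>2)"
    using C_pos v by (intro mult_left_mono row_bound on) auto
  finally have "(norm (\<iota> (gauge q ?T v)))\<^sup>2 \<le> (C * norm (\<iota> v))\<^sup>2" by (simp add: power2_eq_square mult_ac)
  then show ?thesis by (rule power2_le_imp_le) (use C_pos in simp)
qed

text \<open>A real function bounded by \<open>B\<close> is \<open>B/2\<close> times the sum of a unimodular function and its conjugate.\<close>

lemma gauge_bound:
  assumes g: "multiplier g"
  shows "\<exists>K. \<forall>v\<in>FV. norm (\<iota> (gauge q (mult_op g) v)) \<le> K * norm (\<iota> v)"
proof -
  have [measurable]: "g \<in> borel_measurable M" using g by (simp add: multiplier_def)
  obtain B' where B': "AE z in M. cmod (g z) \<le> B'" using g by (auto simp: multiplier_def)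
  define B where "B = max 1 B'"
  have B: "B > 0" "AE z in M. cmod (g z) \<le> B" using B' by (auto simp: B_def elim: eventually_mono)
  \<comment> \<open>Set to 0 on the exceptional null set, so that \<open>s\<close> lies in [-1, 1]
    and \<open>u\<close> is unimodular at every point.\<close>
  define s where "s z = (if cmod (g z) \<le> B then Re (g z) / B else 0)" for z
  define u where "u z = complex_of_real (s z) + \<i> * complex_of_real (sqrt (1 - (s z)\<^sup>2))" for z
  have s1: "(s z)\<^sup>2 \<le> 1" for z
  proof -
    have "\<bar>s z\<bar> \<le> 1" using B(1) abs_Re_le_cmod[of "g z"] by (auto simp: s_def)
    then show ?thesis by (simp add: abs_square_le_1)
  qed
  have [measurable]: "s \<in> borel_measurable M" unfolding s_def by measurable
  have um [measurable]: "u \<in> borel_measurable M" unfolding u_def by measurable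
  have u1: "cmod (u z) = 1" for z
    using s1[of z] by (simp add: u_def cmod_def)
  have um': "(\<lambda>z. cnj (u z)) \<in> borel_measurable M" by measurable
  have u1': "cmod (cnj (u z)) = 1" for z using u1 by simp
  have T1: "mult_op u x \<in> L2" "mult_op (\<lambda>z. cnj (u z)) x \<in> L2" if "x \<in> L2" for x
    using mult_op_L2[OF um _ that, of 1] mult_op_L2[OF um' _ that, of 1] u1 by simp_all
  let ?w = "\<lambda>b. if b then u else (\<lambda>z. cnj (u z))"
  have gu: "AE z in M. g z = complex_of_real (B / 2) * u z + complex_of_real (B / 2) * cnj (u z)"
    using B(2)
  proof eventually_elim
    case (elim z)
    have "\<forall>z. g z \<in> \<real>" using g unfolding multiplier_def by blast
    then have "g z \<in> \<real>" by (rule spec)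
    then have "g z = complex_of_real (Re (g z))" by (rule of_real_Re[symmetric])
    moreover have "complex_of_real (B / 2) * u z + complex_of_real (B / 2) * cnj (u z) = complex_of_real (B * s z)"
      by (simp add: u_def complex_eq_iff)
    ultimately show ?case using elim B(1) by (simp add: s_def)
  qed
  have lin: "E (mult_op g x # xs) = complex_of_real (B / 2) *\<^sub>C E (mult_op u x # xs) +
      complex_of_real (B / 2) *\<^sub>C E (mult_op (\<lambda>z. cnj (u z)) x # xs)" if "x \<in> L2" "xs \<in> lists L2" for x xs
  proof -
    have "AE z in M. mult_op g x z = (\<Sum>b\<in>UNIV. complex_of_real (B / 2) * mult_op (?w b) x z)"
      using gu
    proof eventually_elim
      case (elim z)
      show ?case unfolding mult_op_def elim by (simp add: UNIV_bool algebra_simps)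
    qed
    then have "E (mult_op g x # xs) = (\<Sum>b\<in>UNIV. complex_of_real (B / 2) *\<^sub>C E (mult_op (?w b) x # xs))"
      using that T1 multiplier_L2[OF g] by (intro E_Cons_cong) auto
    then show ?thesis by (simp add: UNIV_bool add.commute)
  qed
  have "norm (\<iota> (gauge q (mult_op g) v)) \<le> (B * C) * norm (\<iota> v)" if v: "v \<in> FV" for v
  proof -
    have fl: "\<iota> (gauge q (mult_op h) v) = (\<Sum>xs\<in>keys v. lookup v xs *\<^sub>C \<iota> (gauge q (mult_op h) (tensor xs)))"
      if "\<And>x. x \<in> L2 \<Longrightarrow> mult_op h x \<in> L2" for h
      by (rule iota_flinear[OF flinear_gauge _ v]) (auto intro!: gauge_vecs that simp: FV_tensor)
    have "\<iota> (gauge q (mult_op g) (tensor xs)) = complex_of_real (B / 2) *\<^sub>C \<iota> (gauge q (mult_op u) (tensor xs)) +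
        complex_of_real (B / 2) *\<^sub>C \<iota> (gauge q (mult_op (\<lambda>z. cnj (u z))) (tensor xs))" if xs: "xs \<in> lists L2" for xs
      using xs by (simp add: gauge_E T1 multiplier_L2[OF g] lin nth_in_lists omit_in_lists scaleC_add_right
          scaleC_sum_right scaleC_scaleC sum.distrib mult.commute)
    then have "\<iota> (gauge q (mult_op g) v) = complex_of_real (B / 2) *\<^sub>C \<iota> (gauge q (mult_op u) v) +
        complex_of_real (B / 2) *\<^sub>C \<iota> (gauge q (mult_op (\<lambda>z. cnj (u z))) v)"
      using keys_FV[OF v] by (simp add: fl T1 multiplier_L2[OF g] scaleC_add_right scaleC_sum_right scaleC_scaleC
          sum.distrib mult.commute)
    then have "norm (\<iota> (gauge q (mult_op g) v)) \<le> B / 2 * norm (\<iota> (gauge q (mult_op u) v)) +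
        B / 2 * norm (\<iota> (gauge q (mult_op (\<lambda>z. cnj (u z))) v))"
      using B(1) norm_triangle_ineq[of "complex_of_real (B / 2) *\<^sub>C \<iota> (gauge q (mult_op u) v)"]
      by (metis (no_types, lifting) abs_of_pos half_gt_zero norm_of_real norm_scaleC)
    also have "\<dots> \<le> B / 2 * (C * norm (\<iota> v)) + B / 2 * (C * norm (\<iota> v))"
      using B(1) by (intro add_mono mult_left_mono gauge_unimodular_bound um um' u1 u1' v) auto
    finally show ?thesis by simp
  qed
  then show ?thesis by blast
qed

text \<open>Expanding both words treats them alike: one letter of each is paired across the
  multiplier, and a real multiplier may stand on either side of \<open>ip\<close>.\<close>

lemma gauge_symmetric:
  assumes g: "multiplier g" and uv: "u \<in> FV" "v \<in> FV"
  shows "cinner (\<iota> (gauge q (mult_op g) u)) (\<iota> v) = cinner (\<iota> u) (\<iota> (gauge q (mult_op g) v))"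
proof (rule iota_form_eqI[OF flinear_gauge _ flinear_gauge _ _ uv])
  note TL = multiplier_L2[OF g]
  fix xs ys assume xs: "xs \<in> lists L2" and ys: "ys \<in> lists L2"
  have ipT: "ip (mult_op g x) y = ip x (mult_op g y)" for x y
  proof -
    have "cnj (g z) = g z" for z using g by (metis Reals_cnj_iff multiplier_def)
    then show ?thesis unfolding l2_inner_def mult_op_def by (simp add: mult_ac)
  qed
  have L: "cinner (\<iota> (gauge q (mult_op g) (tensor xs))) (E ys) =
    (\<Sum>k<length xs. \<Sum>l<length ys. complex_of_real (q ^ k) * complex_of_real (q ^ l) *
      ip (mult_op g (xs ! k)) (ys ! l) * cinner (E (omit k xs)) (E (omit l ys)))" if "xs \<in> lists L2" "ys \<in> lists L2" for xs ys
    using that by (simp add: gauge_E TL cinner_sum_left cinner_scaleC_left E_inner_Cons nth_in_lists omit_in_lists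
        sum_distrib_left mult_ac)
  have "cinner (E xs) (\<iota> (gauge q (mult_op g) (tensor ys))) = cnj (cinner (\<iota> (gauge q (mult_op g) (tensor ys))) (E xs))"
    by (rule cinner_commute)
  also have "\<dots> = (\<Sum>l<length ys. \<Sum>k<length xs. complex_of_real (q ^ l) * complex_of_real (q ^ k) *
      ip (xs ! k) (mult_op g (ys ! l)) * cinner (E (omit k xs)) (E (omit l ys)))"
    unfolding L[OF ys xs] by (simp flip: l2_inner_cnj cinner_commute)
  also have "\<dots> = cinner (\<iota> (gauge q (mult_op g) (tensor xs))) (E ys)"
    unfolding L[OF xs ys] ipT by (subst sum.swap) (simp add: mult_ac)
  finally show "cinner (\<iota> (gauge q (mult_op g) (tensor xs))) (E ys) = cinner (E xs) (\<iota> (gauge q (mult_op g) (tensor ys)))"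
    by simp
qed (rule gauge_FV[OF g], simp only: FV_tensor)+

end

section \<open>The field operators and the Wick map\<close>

lemma D0_zero: "(\<lambda>_. 0) \<in> D0"
  unfolding D0_def by (intro CollectI exI[of _ 0]) auto

lemma D0_step:
  assumes "f \<in> D0" "0 \<le> a" "a \<le> b"
  shows "(\<lambda>z. complex_of_real r * ind_pow a b k z + f z) \<in> D0"
proof -
  from assms(1) obtain n :: nat and c aa bb kk where f: "\<forall>j<n. 0 \<le> aa j \<and> aa j \<le> bb j"
    "f = (\<lambda>z. \<Sum>j<n. complex_of_real (c j) * ind_pow (aa j) (bb j) (kk j) z)"
    unfolding D0_def by blast
  show ?thesis unfolding D0_def
    by (intro CollectI exI[of _ "Suc n"] exI[of _ "c(n := r)"] exI[of _ "aa(n := a)"]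
        exI[of _ "bb(n := b)"] exI[of _ "kk(n := k)"])
       (use f assms in \<open>auto simp: less_Suc_eq fun_eq_iff\<close>)
qed

lemma D0_induct [consumes 1, case_names zero step]:
  assumes "f \<in> D0" "P (\<lambda>_. 0)"
    and step: "\<And>f r a b k. f \<in> D0 \<Longrightarrow> P f \<Longrightarrow> 0 \<le> a \<Longrightarrow> a \<le> b \<Longrightarrow> P (\<lambda>z. complex_of_real r * ind_pow a b k z + f z)"
  shows "P f"
proof -
  from assms(1) obtain n :: nat and c a b k where ab: "\<forall>j<n. 0 \<le> a j \<and> a j \<le> b j"
    and f: "f = (\<lambda>z. \<Sum>j<n. complex_of_real (c j) * ind_pow (a j) (b j) (k j) z)"
    unfolding D0_def by blast
  have "(\<lambda>z. \<Sum>j<m. complex_of_real (c j) * ind_pow (a j) (b j) (k j) z) \<in> D0 \<and>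
      P (\<lambda>z. \<Sum>j<m. complex_of_real (c j) * ind_pow (a j) (b j) (k j) z)" if "m \<le> n" for m
    using that
  proof (induction m)
    case 0
    then show ?case using assms(2) D0_zero by simp
  next
    case (Suc m)
    then have IH: "(\<lambda>z. \<Sum>j<m. complex_of_real (c j) * ind_pow (a j) (b j) (k j) z) \<in> D0"
      "P (\<lambda>z. \<Sum>j<m. complex_of_real (c j) * ind_pow (a j) (b j) (k j) z)" "0 \<le> a m" "a m \<le> b m"
      using ab by auto
    show ?case using step[OF IH, of "c m" "k m"] D0_step[OF IH(1,3,4), of "c m" "k m"] by (simp add: add.commute)
  qed
  then show ?thesis using f by blast
qed

lemma D0_add: "f \<in> D0 \<Longrightarrow> g \<in> D0 \<Longrightarrow> (\<lambda>z. f z + g z) \<in> D0"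
proof (induction rule: D0_induct)
  case (step f r a b k)
  then show ?case using D0_step[of "\<lambda>z. f z + g z" a b r k] by (simp add: add.assoc)
qed simp

lemma D0_scale: "f \<in> D0 \<Longrightarrow> (\<lambda>z. complex_of_real s * f z) \<in> D0"
proof (induction rule: D0_induct)
  case (step f r a b k)
  then show ?case using D0_step[of "\<lambda>z. complex_of_real s * f z" a b "s * r" k] by (simp add: algebra_simps)
qed (simp add: D0_zero)

lemma D0_sum: "(\<And>i. i \<in> I \<Longrightarrow> f i \<in> D0) \<Longrightarrow> (\<lambda>z. \<Sum>i\<in>I. complex_of_real (r i) * f i z) \<in> D0"
  by (induction I rule: infinite_finite_induct) (simp_all add: D0_add D0_scale D0_zero)

lemma D0_ind_pow: "0 \<le> a \<Longrightarrow> a \<le> b \<Longrightarrow> ind_pow a b k \<in> D0"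
  using D0_step[OF D0_zero, of a b 1 k] by simp

lemma D0_real: "f \<in> D0 \<Longrightarrow> f z \<in> \<real>"
  by (induction rule: D0_induct) (auto simp: ind_pow_def case_prod_beta)

text \<open>Two half-open intervals meet between \<open>max a c\<close> and \<open>min b d\<close>;
  the outer \<open>max\<close> keeps the endpoints ordered when they are disjoint, as
  \<open>D0\<close> demands. The extra factor x of \<open>T_op\<close> accounts for the
  \<open>Suc\<close>.\<close>

lemma T_op_ind_pow:
  "T_op (ind_pow a b k) (ind_pow c d l) = ind_pow (max a c) (max (max a c) (min b d)) (Suc (k + l))"
  by (auto simp: T_op_def mult_op_def ind_pow_def fun_eq_iff indicator_def power_add)

lemma T_op_eq: "T_op f g z = complex_of_real (snd z) * f z * g z"
  by (simp add: T_op_def mult_op_def case_prod_beta)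

lemma T_op_D0:
  assumes "f \<in> D0" "g \<in> D0"
  shows "T_op f g \<in> D0"
  using assms(1)
proof (induction rule: D0_induct)
  case zero
  have "T_op (\<lambda>_. 0) g = (\<lambda>_. 0)" by (simp add: fun_eq_iff T_op_eq)
  then show ?case using D0_zero by simp
next
  case (step f r a b k)
  have 1: "T_op (ind_pow a b k) g \<in> D0"
    using assms(2)
  proof (induction rule: D0_induct)
    case zero
    have "T_op h (\<lambda>_. 0) = (\<lambda>_. 0)" for h by (simp add: fun_eq_iff T_op_eq)
    then show ?case using D0_zero by simp
  next
    case (step g r c d l)
    have "T_op (ind_pow a b k) (\<lambda>z. complex_of_real r * ind_pow c d l z + g z) =
        (\<lambda>z. complex_of_real r * T_op (ind_pow a b k) (ind_pow c d l) z + T_op (ind_pow a b k) g z)"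
      by (simp add: fun_eq_iff T_op_eq algebra_simps)
    also have "\<dots> \<in> D0" unfolding T_op_ind_pow
      using step \<open>0 \<le> a\<close> by (intro D0_step) auto
    finally show ?case .
  qed
  have "T_op (\<lambda>z. complex_of_real r * ind_pow a b k z + f z) g =
      (\<lambda>z. complex_of_real r * T_op (ind_pow a b k) g z + T_op f g z)"
    by (simp add: fun_eq_iff T_op_eq algebra_simps)
  also have "\<dots> \<in> D0" using 1 step by (intro D0_add D0_scale)
  finally show ?case .
qed

lemma add_diff_diff_cancel: "a + b + c - a - c = (b :: 'a::ab_group_add)"
  by simp

section \<open>Generated algebras and adjoints\<close>

lemma alg_zero: "(\<lambda>_. 0) \<in> alg_generated G"
  using alg_generated.scale[OF alg_generated.one, of 0] by simp

lemma alg_sum: "(\<And>i. i \<in> I \<Longrightarrow> A i \<in> alg_generated G) \<Longrightarrow> (\<lambda>\<xi>. \<Sum>i\<in>I. A i \<xi>) \<in> alg_generated G"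
  by (induction I rule: infinite_finite_induct) (simp_all add: alg_zero alg_generated.add)

lemma alg_diff:
  assumes "A \<in> alg_generated G" "B \<in> alg_generated G"
  shows "(\<lambda>\<xi>. A \<xi> - B \<xi>) \<in> alg_generated G"
  using alg_generated.add[OF assms(1) alg_generated.scale[OF assms(2), of "-1"]] by (simp add: scaleC_minus_one)

lemma alg_mono: "A \<in> alg_generated G \<Longrightarrow> G \<subseteq> H \<Longrightarrow> A \<in> alg_generated H"
  by (induction rule: alg_generated.induct) (auto intro: alg_generated.intros)

text \<open>\<open>cadjoint\<close> is a definite description, determined only once an adjoint is
  known to exist. With symmetric generators one is built along the algebra operations.\<close>

lemma alg_adjoint:
  assumes "A \<in> alg_generated G" "\<And>A x y. A \<in> G \<Longrightarrow> cinner (A x) y = cinner x (A y)"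
  shows "\<exists>B. \<forall>x y. cinner (A x) y = cinner x (B y)"
  using assms(1)
proof (induction rule: alg_generated.induct)
  case one
  show ?case by (intro exI[of _ "\<lambda>x. x"]) simp
next
  case (gen A)
  then show ?case using assms(2) by blast
next
  case (add A B)
  then obtain A' B' where "\<And>x y. cinner (A x) y = cinner x (A' y)" "\<And>x y. cinner (B x) y = cinner x (B' y)" by blast
  then show ?case by (intro exI[of _ "\<lambda>y. A' y + B' y"]) (simp add: cinner_add_left cinner_add_right)
next
  case (scale A c)
  then obtain A' where "\<And>x y. cinner (A x) y = cinner x (A' y)" by blast
  then show ?case by (intro exI[of _ "\<lambda>y. cnj c *\<^sub>C A' y"]) (simp add: cinner_scaleC_left cinner_scaleC_right)
next
  case (mult A B)
  then obtain A' B' where "\<And>x y. cinner (A x) y = cinner x (A' y)" "\<And>x y. cinner (B x) y = cinner x (B' y)" by blast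
  then show ?case by (intro exI[of _ "\<lambda>y. B' (A' y)"]) simp
qed

lemma cadjoint_cinner:
  fixes A :: "'a::complex_inner \<Rightarrow> 'a"
  assumes "\<exists>B. \<forall>x y. cinner (A x) y = cinner x (B y)"
  shows "cinner x (cadjoint A y) = cinner (A x) y"
proof -
  have "\<exists>!B. \<forall>x y. cinner (A x) y = cinner x (B y)"
  proof (rule ex_ex1I[OF assms])
    fix B B' assume B: "\<forall>x y. cinner (A x) y = cinner x (B y)" and B': "\<forall>x y. cinner (A x) y = cinner x (B' y)"
    have "B y = B' y" for y by (rule cinner_eq_dense[of UNIV]) (use B B' in simp_all)
    then show "B = B'" by blast
  qed
  then have "\<forall>x y. cinner (A x) y = cinner x (cadjoint A y)" unfolding cadjoint_def by (rule theI')
  then show ?thesis by (metis (no_types))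
qed

lemma omit_update_same: "k < length xs \<Longrightarrow> omit k (xs[k := y]) = omit k xs"
  by (simp add: omit_def)

lemma omit_update_less: "k < i \<Longrightarrow> i < length xs \<Longrightarrow> omit k (xs[i := y]) = (omit k xs)[i - 1 := y]"
  by (cases i) (auto simp: omit_def list_update_append drop_update_swap min_def)

lemma omit_update_greater: "i < k \<Longrightarrow> k < length xs \<Longrightarrow> omit k (xs[i := y]) = (omit k xs)[i := y]"
  by (simp add: omit_def list_update_append take_update_swap)

lemma update_in_lists: "xs \<in> lists S \<Longrightarrow> y \<in> S \<Longrightarrow> xs[i := y] \<in> lists S"
  using set_update_subset_insert[of xs i y] by (auto simp: in_lists_conv_set)

section \<open>Bounded extensions and the operators X(f)\<close>

context q_fock
begin

text \<open>\<open>op_ext\<close> is a definite description: the norm bound gives existence, the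
  density of the image of \<open>FV\<close> gives uniqueness.\<close>

lemma op_ext_works:
  assumes A: "flinear A" "\<And>v. v \<in> FV \<Longrightarrow> A v \<in> FV"
    and bound: "\<And>v. v \<in> FV \<Longrightarrow> norm (\<iota> (A v)) \<le> K * norm (\<iota> v)"
  shows "bounded_clinear (op_ext \<nu> \<iota> A)" "\<And>v. v \<in> FV \<Longrightarrow> op_ext \<nu> \<iota> A (\<iota> v) = \<iota> (A v)"
proof -
  obtain B where B: "bounded_clinear B" "\<And>v. v \<in> FV \<Longrightarrow> B (\<iota> v) = \<iota> (A v)"
    by (rule bounded_clinear_extension[of \<iota> FV "(+)" "\<lambda>v. \<iota> (A v)" fscale K])
       (use A bound iota_dense in \<open>auto simp: FV_add FV_fscale iota_add iota_scale flinear_add flinear_scale\<close>)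
  have "\<exists>!B. bounded_clinear B \<and> (\<forall>v\<in>FV. B (\<iota> v) = \<iota> (A v))"
  proof (rule ex1I[of _ B])
    fix B' assume "bounded_clinear B' \<and> (\<forall>v\<in>FV. B' (\<iota> v) = \<iota> (A v))"
    then show "B' = B" using B by (intro bounded_clinear_eq_dense[OF _ _ iota_dense]) auto
  qed (use B in simp)
  from theI'[OF this]
  show "bounded_clinear (op_ext \<nu> \<iota> A)" "\<And>v. v \<in> FV \<Longrightarrow> op_ext \<nu> \<iota> A (\<iota> v) = \<iota> (A v)"
    unfolding op_ext_def by auto
qed

abbreviation "Cr f \<equiv> op_ext \<nu> \<iota> (cre f)"
abbreviation "An f \<equiv> op_ext \<nu> \<iota> (ann f)"
abbreviation "Ga g \<equiv> op_ext \<nu> \<iota> (gauge q (mult_op g))"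

lemma Cr_bounded: "f \<in> L2 \<Longrightarrow> bounded_clinear (Cr f)"
  and Cr_iota: "f \<in> L2 \<Longrightarrow> v \<in> FV \<Longrightarrow> Cr f (\<iota> v) = \<iota> (cre f v)"
  using op_ext_works[OF flinear_creation cre_FV cre_bound] by auto

lemma An_bounded: "f \<in> L2 \<Longrightarrow> bounded_clinear (An f)"
  and An_iota: "f \<in> L2 \<Longrightarrow> v \<in> FV \<Longrightarrow> An f (\<iota> v) = \<iota> (ann f v)"
  using op_ext_works[OF flinear_annihilation ann_FV ann_bound] by auto

lemma Ga_bounded: "multiplier g \<Longrightarrow> bounded_clinear (Ga g)"
  and Ga_iota: "multiplier g \<Longrightarrow> v \<in> FV \<Longrightarrow> Ga g (\<iota> v) = \<iota> (gauge q (mult_op g) v)"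
proof -
  assume g: "multiplier g"
  obtain K where K: "\<And>v. v \<in> FV \<Longrightarrow> norm (\<iota> (gauge q (mult_op g) v)) \<le> K * norm (\<iota> v)"
    using gauge_bound[OF g] by blast
  note * = op_ext_works[OF flinear_gauge gauge_FV[OF g] K]
  show "bounded_clinear (Ga g)" by (rule *) 
  show "v \<in> FV \<Longrightarrow> Ga g (\<iota> v) = \<iota> (gauge q (mult_op g) v)" by (rule *)
qed

lemma Cr_E: "f \<in> L2 \<Longrightarrow> xs \<in> lists L2 \<Longrightarrow> Cr f (E xs) = E (f # xs)"
  unfolding E_def by (subst Cr_iota) (auto simp: FV_tensor)

lemma An_E: "f \<in> L2 \<Longrightarrow> xs \<in> lists L2 \<Longrightarrow>
    An f (E xs) = (\<Sum>k<length xs. (complex_of_real (q ^ k) * ip f (xs ! k)) *\<^sub>C E (omit k xs))"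
  using ann_E[of xs f] An_iota[of f "tensor xs"] by (simp add: E_def FV_tensor)

lemma Ga_E: "multiplier g \<Longrightarrow> xs \<in> lists L2 \<Longrightarrow>
    Ga g (E xs) = (\<Sum>k<length xs. complex_of_real (q ^ k) *\<^sub>C E (mult_op g (xs ! k) # omit k xs))"
  using gauge_E[of "mult_op g" xs] multiplier_L2[of g] Ga_iota[of g "tensor xs"] by (simp add: E_def FV_tensor)

lemma E_dense_eq:
  assumes "bounded_clinear A" "bounded_clinear B" "\<And>xs. xs \<in> lists L2 \<Longrightarrow> A (E xs) = B (E xs)"
  shows "A = B"
proof (rule bounded_clinear_eq_dense[OF assms(1,2) iota_dense])
  fix s assume "s \<in> \<iota> ` FV"
  then obtain v where v: "v \<in> FV" "s = \<iota> v" by auto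
  show "A s = B s" unfolding v(2) iota_expand[OF v(1)]
    using keys_FV[OF v(1)] assms by (simp add: bounded_clinear_sum bounded_clinear_scaleC)
qed

lemma symmetric_dense:
  assumes A: "bounded_clinear A"
    and sym: "\<And>u v. u \<in> FV \<Longrightarrow> v \<in> FV \<Longrightarrow> cinner (A (\<iota> u)) (\<iota> v) = cinner (\<iota> u) (A (\<iota> v))"
  shows "cinner (A x) y = cinner x (A y)"
proof -
  have blA: "bounded_linear A" using A by (simp add: bounded_clinear_def)
  \<comment> \<open>Symmetry is extended one variable at a time, each time because the set where it
    holds is closed.\<close>
  have 1: "cinner y (A x) = cinner (A y) x" if y: "y \<in> \<iota> ` FV" for x y
  proof -
    have "closed {x. cinner y (A x) = cinner (A y) x}"
      by (intro closed_Collect_eq linear_continuous_on bounded_linear_cinner_right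
          bounded_linear_compose[OF bounded_linear_cinner_right blA])
    moreover have "\<iota> ` FV \<subseteq> {x. cinner y (A x) = cinner (A y) x}" using y sym by auto
    ultimately have "closure (\<iota> ` FV) \<subseteq> {x. cinner y (A x) = cinner (A y) x}" by (rule closure_minimal[rotated])
    then show ?thesis using iota_dense by auto
  qed
  have "closed {y. cinner (A x) y = cinner x (A y)}"
    by (intro closed_Collect_eq linear_continuous_on bounded_linear_cinner_right
        bounded_linear_compose[OF bounded_linear_cinner_right blA])
  moreover have "\<iota> ` FV \<subseteq> {y. cinner (A x) y = cinner x (A y)}" 
  proof (intro subsetI CollectI)
    fix y assume y: "y \<in> \<iota> ` FV"
    show "cinner (A x) y = cinner x (A y)"
      by (subst (1 2) cinner_commute) (simp add: 1[OF y])
  qed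
  ultimately have "closure (\<iota> ` FV) \<subseteq> {y. cinner (A x) y = cinner x (A y)}" by (rule closure_minimal[rotated])
  then show ?thesis using iota_dense by auto
qed

lemma D0_L2: "f \<in> D0 \<Longrightarrow> f \<in> L2"
  by (induction rule: D0_induct) (simp_all add: sq_integrable_zero sq_integrable_add sq_integrable_scale ind_pow_L2)

lemma D0_lists_L2: "fs \<in> lists D0 \<Longrightarrow> fs \<in> lists L2"
  using D0_L2 by (auto simp: in_lists_conv_set)

abbreviation "xmul f \<equiv> (\<lambda>(t, x). complex_of_real x * f (t, x))"

lemma multiplier_D0: "f \<in> D0 \<Longrightarrow> multiplier (xmul f)"
proof -
  assume f: "f \<in> D0"
  have m: "f \<in> borel_measurable M" using D0_L2[OF f] by (rule sq_integrable_measurable)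
  have "\<exists>B\<ge>0. AE z in M. cmod (f z) \<le> B" using f
  proof (induction rule: D0_induct)
    case zero
    then show ?case by (intro exI[of _ 0]) auto
  next
    case (step f r a b k)
    then obtain B where B: "AE z in M. cmod (f z) \<le> B" "B \<ge> 0" by blast
    have "AE z in M. cmod (complex_of_real r * ind_pow a b k z + f z) \<le> \<bar>r\<bar> * B0 ^ k + B"
      using AE_ind_pow_le[of a b k] B(1)
    proof eventually_elim
      case (elim z)
      have "cmod (strip a b z) \<le> 1" by (auto simp: strip_def case_prod_beta indicator_def)
      then have "B0 ^ k * cmod (strip a b z) \<le> B0 ^ k * 1" using B0(1) by (intro mult_left_mono) auto
      then have "\<bar>r\<bar> * cmod (ind_pow a b k z) \<le> \<bar>r\<bar> * B0 ^ k" using elim(1) by (intro mult_left_mono) auto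
      then show ?case using elim(2) norm_triangle_ineq[of "complex_of_real r * ind_pow a b k z" "f z"]
        by (simp add: norm_mult)
    qed
    then show ?case using B(2) B0(1) by (intro exI[of _ "\<bar>r\<bar> * B0 ^ k + B"]) auto
  qed
  then obtain B where B: "B \<ge> 0" "AE z in M. cmod (f z) \<le> B" by blast
  have "AE z in M. cmod (xmul f z) \<le> B0 * B"
    using B(2) B0(2)
  proof eventually_elim
    case (elim z)
    have "\<bar>snd z\<bar> * cmod (f z) \<le> B0 * B" using elim B0(1) B(1) by (intro mult_mono) auto
    then show ?case by (simp add: case_prod_beta norm_mult)
  qed
  moreover have "xmul f \<in> borel_measurable M" unfolding case_prod_beta using m by simp
  ultimately show ?thesis unfolding multiplier_def using D0_real[OF f] by (auto simp: Reals_mult)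
qed

lemma T_op_mult: "T_op f = mult_op (xmul f)"
  by (simp add: T_op_def)

lemma T_op_L2: "f \<in> D0 \<Longrightarrow> g \<in> L2 \<Longrightarrow> T_op f g \<in> L2"
  unfolding T_op_mult by (intro multiplier_L2 multiplier_D0)

abbreviation "Xf f \<equiv> X_fun q \<nu> \<iota> f"

lemma Xf_def: "Xf f = (\<lambda>\<xi>. An f \<xi> + Cr f \<xi> + Ga (xmul f) \<xi>)"
  by (simp add: X_fun_def field_op_def T_op_mult)

lemma Xf_bounded: "f \<in> D0 \<Longrightarrow> bounded_clinear (Xf f)"
  unfolding Xf_def by (intro bounded_clinear_plus An_bounded Cr_bounded Ga_bounded D0_L2 multiplier_D0)

lemma Xf_E:
  assumes "f \<in> D0" "xs \<in> lists L2"
  shows "Xf f (E xs) = (\<Sum>k<length xs. (complex_of_real (q ^ k) * ip f (xs ! k)) *\<^sub>C E (omit k xs)) +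
    E (f # xs) + (\<Sum>k<length xs. complex_of_real (q ^ k) *\<^sub>C E (T_op f (xs ! k) # omit k xs))"
  using assms by (simp add: Xf_def An_E Cr_E Ga_E D0_L2 multiplier_D0 T_op_mult)

lemma Xf_symmetric:
  assumes f: "f \<in> D0"
  shows "cinner (Xf f x) y = cinner x (Xf f y)"
proof (rule symmetric_dense[OF Xf_bounded[OF f]])
  fix u v assume uv: "u \<in> FV" "v \<in> FV"
  note m = multiplier_D0[OF f] and fL = D0_L2[OF f]
  show "cinner (Xf f (\<iota> u)) (\<iota> v) = cinner (\<iota> u) (Xf f (\<iota> v))"
    using uv by (simp add: Xf_def An_iota[OF fL] Cr_iota[OF fL] Ga_iota[OF m] cinner_add_left cinner_add_right
        cre_ann_adjoint[OF fL] ann_cre_adjoint[OF fL] gauge_symmetric[OF m])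
qed

text \<open>Real coefficients hide the conjugate linearity of the first slot, so both slots obey the
  same rule.\<close>

lemma ip_cong_left:
  assumes "f \<in> L2" "\<And>i. i \<in> I \<Longrightarrow> g i \<in> L2" "h \<in> L2"
    "AE z in M. f z = (\<Sum>i\<in>I. complex_of_real (r i) * g i z)"
  shows "ip f h = (\<Sum>i\<in>I. complex_of_real (r i) * ip (g i) h)"
    "ip h f = (\<Sum>i\<in>I. complex_of_real (r i) * ip h (g i))"
proof -
  have "ip h f = ip h (\<lambda>z. \<Sum>i\<in>I. complex_of_real (r i) * g i z)"
    by (rule l2_inner_cong_AE) (use assms in \<open>auto intro!: sq_integrable_sum\<close>)
  also have "\<dots> = (\<Sum>i\<in>I. complex_of_real (r i) * ip h (g i))"
    by (rule l2_inner_sum_right) (use assms in auto)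
  finally show *: "ip h f = (\<Sum>i\<in>I. complex_of_real (r i) * ip h (g i))" .
  have "cnj (ip h f) = (\<Sum>i\<in>I. complex_of_real (r i) * cnj (ip h (g i)))" unfolding * by simp
  then show "ip f h = (\<Sum>i\<in>I. complex_of_real (r i) * ip (g i) h)" by (simp flip: l2_inner_cnj)
qed

lemma AE_T_op_cong:
  assumes "AE z in M. f z = (\<Sum>i\<in>I. c i * g i z)"
  shows "AE z in M. T_op f h z = (\<Sum>i\<in>I. c i * T_op (g i) h z)"
    and "AE z in M. T_op h f z = (\<Sum>i\<in>I. c i * T_op h (g i) z)"
proof -
  show "AE z in M. T_op f h z = (\<Sum>i\<in>I. c i * T_op (g i) h z)"
    using assms by eventually_elim (simp add: T_op_eq sum_distrib_left sum_distrib_right mult_ac)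
  show "AE z in M. T_op h f z = (\<Sum>i\<in>I. c i * T_op h (g i) z)"
    using assms by eventually_elim (simp add: T_op_eq sum_distrib_left sum_distrib_right mult_ac)
qed

lemma bounded_clinear_setsum:
  "(\<And>i. i \<in> I \<Longrightarrow> bounded_clinear (A i :: 'f \<Rightarrow> 'f)) \<Longrightarrow> bounded_clinear (\<lambda>x. \<Sum>i\<in>I. A i x)"
  by (induction I rule: infinite_finite_induct)
     (simp_all add: bounded_clinear_plus bounded_clinearI[where K=0])

text \<open>The coefficients must be real: the annihilation part is conjugate linear in
  \<open>f\<close>, the other two parts are linear. It suffices to compare the three parts on words,
  where \<open>Xf_E\<close> is explicit.\<close>

lemma Xf_cong:
  assumes f: "f \<in> D0" and g: "\<And>i. i \<in> I \<Longrightarrow> g i \<in> D0"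
    and AE: "AE z in M. f z = (\<Sum>i\<in>I. complex_of_real (r i) * g i z)"
  shows "Xf f x = (\<Sum>i\<in>I. complex_of_real (r i) *\<^sub>C Xf (g i) x)"
proof -
  have "Xf f = (\<lambda>x. \<Sum>i\<in>I. complex_of_real (r i) *\<^sub>C Xf (g i) x)"
  proof (rule E_dense_eq[OF Xf_bounded[OF f]])
    show "bounded_clinear (\<lambda>x. \<Sum>i\<in>I. complex_of_real (r i) *\<^sub>C Xf (g i) x)"
      by (intro bounded_clinear_setsum bounded_clinear_scale Xf_bounded g)
    fix xs assume xs: "xs \<in> lists L2"
    have 1: "(\<Sum>k<length xs. (complex_of_real (q ^ k) * ip f (xs ! k)) *\<^sub>C E (omit k xs)) =
        (\<Sum>i\<in>I. complex_of_real (r i) *\<^sub>C (\<Sum>k<length xs. (complex_of_real (q ^ k) * ip (g i) (xs ! k)) *\<^sub>C E (omit k xs)))"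
    proof -
      have "ip f (xs ! k) = (\<Sum>i\<in>I. complex_of_real (r i) * ip (g i) (xs ! k))" if "k < length xs" for k
        by (rule ip_cong_left(1)) (use D0_L2 f g AE nth_in_lists[OF xs that] in auto)
      then have "(\<Sum>k<length xs. (complex_of_real (q ^ k) * ip f (xs ! k)) *\<^sub>C E (omit k xs)) =
          (\<Sum>k<length xs. \<Sum>i\<in>I. (complex_of_real (r i) * (complex_of_real (q ^ k) * ip (g i) (xs ! k))) *\<^sub>C E (omit k xs))"
        by (intro sum.cong refl) (simp add: sum_distrib_left scaleC_sum_left mult_ac)
      also have "\<dots> = (\<Sum>i\<in>I. \<Sum>k<length xs. (complex_of_real (r i) * (complex_of_real (q ^ k) * ip (g i) (xs ! k))) *\<^sub>C E (omit k xs))"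
        by (rule sum.swap)
      finally show ?thesis by (simp add: scaleC_sum_right scaleC_scaleC)
    qed
    have 2: "E (f # xs) = (\<Sum>i\<in>I. complex_of_real (r i) *\<^sub>C E (g i # xs))"
      by (rule E_Cons_cong) (use D0_L2 f g AE xs in auto)
    have 3: "(\<Sum>k<length xs. complex_of_real (q ^ k) *\<^sub>C E (T_op f (xs ! k) # omit k xs)) =
        (\<Sum>i\<in>I. complex_of_real (r i) *\<^sub>C (\<Sum>k<length xs. complex_of_real (q ^ k) *\<^sub>C E (T_op (g i) (xs ! k) # omit k xs)))"
    proof -
      have "E (T_op f (xs ! k) # omit k xs) = (\<Sum>i\<in>I. complex_of_real (r i) *\<^sub>C E (T_op (g i) (xs ! k) # omit k xs))"
        if "k < length xs" for k
        using AE_T_op_cong(1)[OF AE, of "xs ! k"] nth_in_lists[OF xs that] xs f g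
        by (intro E_Cons_cong T_op_L2 omit_in_lists)
      then have "(\<Sum>k<length xs. complex_of_real (q ^ k) *\<^sub>C E (T_op f (xs ! k) # omit k xs)) =
          (\<Sum>k<length xs. \<Sum>i\<in>I. (complex_of_real (r i) * complex_of_real (q ^ k)) *\<^sub>C E (T_op (g i) (xs ! k) # omit k xs))"
        by (intro sum.cong refl) (simp add: scaleC_sum_right scaleC_scaleC mult.commute)
      also have "\<dots> = (\<Sum>i\<in>I. \<Sum>k<length xs. (complex_of_real (r i) * complex_of_real (q ^ k)) *\<^sub>C E (T_op (g i) (xs ! k) # omit k xs))"
        by (rule sum.swap)
      finally show ?thesis by (simp add: scaleC_sum_right scaleC_scaleC)
    qed
    show "Xf f (E xs) = (\<Sum>i\<in>I. complex_of_real (r i) *\<^sub>C Xf (g i) (E xs))"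
      unfolding Xf_E[OF f xs] 1 2 3 using Xf_E[OF g xs] by (simp add: sum.distrib scaleC_add_right)
  qed
  then show ?thesis by simp
qed

lemma Y_op_eq: "k \<ge> 1 \<Longrightarrow> Y_op q \<nu> \<iota> k a b = Xf (ind_pow a b (k - 1))"
proof -
  assume "k \<ge> 1"
  then have "x * x ^ (k - Suc 0) = x ^ k" for x :: complex by (cases k) auto
  then have "mult_op (ind_pow a b k) = T_op (ind_pow a b (k - 1))"
    by (auto simp: T_op_eq mult_op_def ind_pow_def fun_eq_iff)
  then show ?thesis by (simp add: Y_op_def X_fun_def)
qed

lemma Xf_ind_pow:
  assumes "0 \<le> a" "a \<le> b"
  shows "Xf (ind_pow a b k) x = Xf (ind_pow 0 b k) x - Xf (ind_pow 0 a k) x"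
proof -
  \<comment> \<open>The index type \<open>bool\<close> presents a difference of two terms as a real
    combination, the form that \<open>Xf_cong\<close> accepts.\<close>
  have "Xf (ind_pow a b k) x = (\<Sum>i\<in>UNIV. complex_of_real (if i then 1 else -1) *\<^sub>C Xf (ind_pow 0 (if i then b else a) k) x)"
  proof (rule Xf_cong)
    have "ind_pow a b k z = ind_pow 0 b k z - ind_pow 0 a k z" for z
      using assms by (auto simp: ind_pow_def case_prod_beta indicator_def)
    then show "AE z in M. ind_pow a b k z =
        (\<Sum>i\<in>UNIV. complex_of_real (if i then 1 else -1) * ind_pow 0 (if i then b else a) k z)"
      by (simp add: UNIV_bool)
  qed (use assms in \<open>auto intro!: D0_ind_pow\<close>)
  then show ?thesis by (simp add: UNIV_bool scaleC_minus_one)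
qed

section \<open>The two algebras and their generators\<close>

abbreviation "AX \<equiv> alg_X q \<nu> \<iota>"
abbreviation "AXD \<equiv> alg_X_Delta q \<nu> \<iota>"

lemma AX_generator:
  assumes "0 \<le> a" "a \<le> b"
  shows "Xf (ind_pow a b 0) \<in> AX"
proof -
  have "Xf (ind_pow 0 c 0) \<in> AX" if "0 \<le> c" for c
    unfolding alg_X_def using that Y_op_eq[of 1 0 c] by (intro alg_generated.gen CollectI exI[of _ c]) simp
  then have "(\<lambda>x. Xf (ind_pow 0 b 0) x - Xf (ind_pow 0 a 0) x) \<in> AX"
    using assms unfolding alg_X_def by (intro alg_diff) auto
  moreover have "Xf (ind_pow a b 0) = (\<lambda>x. Xf (ind_pow 0 b 0) x - Xf (ind_pow 0 a 0) x)"
    by (rule ext) (rule Xf_ind_pow[OF assms])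
  ultimately show ?thesis by (simp only:)
qed

lemma Xf_ind_pow_AXD:
  assumes "0 \<le> a" "a \<le> b"
  shows "Xf (ind_pow a b k) \<in> AXD"
proof -
  have "Xf (ind_pow 0 c k) \<in> AXD" if "0 \<le> c" for c
    unfolding alg_X_Delta_def using that Y_op_eq[of "Suc k" 0 c]
    by (intro alg_generated.gen) (auto intro!: exI[of _ "Suc k"] exI[of _ c])
  then have "(\<lambda>x. Xf (ind_pow 0 b k) x - Xf (ind_pow 0 a k) x) \<in> AXD"
    using assms unfolding alg_X_Delta_def by (intro alg_diff) auto
  moreover have "Xf (ind_pow a b k) = (\<lambda>x. Xf (ind_pow 0 b k) x - Xf (ind_pow 0 a k) x)"
    by (rule ext) (rule Xf_ind_pow[OF assms])
  ultimately show ?thesis by (simp only:)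
qed

lemma Xf_AXD: "f \<in> D0 \<Longrightarrow> Xf f \<in> AXD"
proof (induction rule: D0_induct)
  case zero
  have "Xf (\<lambda>_. 0) = (\<lambda>_. 0)" using Xf_cong[OF D0_zero, of "{}" undefined undefined] by auto
  then show ?case by (simp add: alg_X_Delta_def alg_zero)
next
  case (step f r a b k)
  have "Xf (\<lambda>z. complex_of_real r * ind_pow a b k z + f z) x =
     complex_of_real r *\<^sub>C Xf (ind_pow a b k) x + Xf f x" for x
  proof -
    have "Xf (\<lambda>z. complex_of_real r * ind_pow a b k z + f z) x =
      (\<Sum>i\<in>UNIV. complex_of_real (if i then r else 1) *\<^sub>C Xf (if i then ind_pow a b k else f) x)"
      by (rule Xf_cong) (use step in \<open>auto simp: UNIV_bool intro!: D0_ind_pow D0_step\<close>)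
    then show ?thesis by (simp add: UNIV_bool add.commute)
  qed
  then have "Xf (\<lambda>z. complex_of_real r * ind_pow a b k z + f z) =
      (\<lambda>x. complex_of_real r *\<^sub>C Xf (ind_pow a b k) x + Xf f x)" by (rule ext)
  moreover have "(\<lambda>x. complex_of_real r *\<^sub>C Xf (ind_pow a b k) x + Xf f x) \<in> AXD"
    using step(4) Xf_ind_pow_AXD[OF step(2,3), of k] unfolding alg_X_Delta_def
    by (intro alg_generated.add alg_generated.scale)
  ultimately show ?case by simp
qed

lemma AX_AXD: "A \<in> AX \<Longrightarrow> A \<in> AXD"
  unfolding alg_X_def alg_X_Delta_def by (erule alg_mono) (use order_refl[of "1::nat"] in blast)

lemma AXD_generators:
  assumes "A \<in> {Y_op q \<nu> \<iota> k 0 t |k t. 1 \<le> k \<and> 0 \<le> t}"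
  shows "\<exists>f\<in>D0. A = Xf f"
proof -
  obtain k t where "A = Y_op q \<nu> \<iota> k 0 t" "1 \<le> k" "0 \<le> t" using assms by blast
  then show ?thesis by (intro bexI[of _ "ind_pow 0 t (k - 1)"]) (simp_all add: Y_op_eq D0_ind_pow)
qed

lemma AXD_adjoint:
  assumes "A \<in> AXD"
  shows "\<exists>B. \<forall>x y. cinner (A x) y = cinner x (B y)"
proof (rule alg_adjoint[OF assms[unfolded alg_X_Delta_def]])
  fix B x y assume "B \<in> {Y_op q \<nu> \<iota> k 0 t |k t. 1 \<le> k \<and> 0 \<le> t}"
  then obtain f where "f \<in> D0" "B = Xf f" using AXD_generators by blast
  then show "cinner (B x) y = cinner x (B y)" by (simp add: Xf_symmetric)
qed

lemma state_AXD: "A \<in> AXD \<Longrightarrow> state \<Omega> (cadjoint A \<circ> B) = cinner (A \<Omega>) (B \<Omega>)"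
  by (simp add: state_def cadjoint_cinner[OF AXD_adjoint])

section \<open>The Wick map on words\<close>

abbreviation "Wk \<equiv> wick q \<nu> \<iota>"

declare wick.simps(2) [simp del]

text \<open>Induction on the length: the recursion introduces new letters
  \<open>T_op f (gs ! i)\<close>, so its words are not sublists, but they are shorter and, by
  \<open>T_op_D0\<close>, still over \<open>D0\<close>.\<close>

lemma wick_AXD: "fs \<in> lists D0 \<Longrightarrow> Wk fs \<in> AXD"
proof (induction fs rule: length_induct)
  case (1 fs)
  show ?case
  proof (cases fs)
    case Nil
    then show ?thesis by (simp add: alg_X_Delta_def alg_generated.one)
  next
    case (Cons f gs)
    then have f: "f \<in> D0" and gs: "gs \<in> lists D0" using 1(2) by auto
    have 2: "Wk (omit i gs) \<in> AXD" if "i < length gs" for i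
      by (rule 1(1)[rule_format]) (use that Cons omit_in_lists[OF gs, of i] in simp_all)
    have 3: "Wk (T_op f (gs ! i) # omit i gs) \<in> AXD" if "i < length gs" for i
      by (rule 1(1)[rule_format])
        (use that Cons omit_in_lists[OF gs, of i] nth_in_lists[OF gs that] in \<open>simp_all add: T_op_D0 f\<close>)
    have 4: "Wk gs \<in> AXD" by (rule 1(1)[rule_format]) (use Cons gs in simp_all)
    have a: "(\<lambda>\<xi>. Xf f (Wk gs \<xi>)) \<in> AXD"
      using Xf_AXD[OF f] 4 unfolding alg_X_Delta_def by (rule alg_generated.mult)
    have b: "(\<lambda>\<xi>. \<Sum>i<length gs. c i *\<^sub>C w i \<xi>) \<in> AXD" if "\<And>i. i < length gs \<Longrightarrow> w i \<in> AXD" for c w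
      unfolding alg_X_Delta_def
      by (rule alg_sum, rule alg_generated.scale) (use that in \<open>simp add: alg_X_Delta_def\<close>)
    show ?thesis unfolding Cons wick.simps(2)[of q \<nu> \<iota> f gs]
      using a b[OF 2] b[OF 3] unfolding alg_X_Delta_def by (rule alg_diff[OF alg_diff])
  qed
qed

text \<open>The recursion subtracts from X(f) applied to \<open>E gs\<close> exactly the
  annihilation and gauge terms listed in \<open>Xf_E\<close>; only the creation term is
  left.\<close>

lemma wick_vacuum: "fs \<in> lists D0 \<Longrightarrow> Wk fs (E []) = E fs"
proof (induction fs rule: length_induct)
  case (1 fs)
  show ?case
  proof (cases fs)
    case (Cons f gs)
    then have f: "f \<in> D0" and gs: "gs \<in> lists D0" using 1(2) by auto
    have 2: "Wk (omit i gs) (E []) = E (omit i gs)" if "i < length gs" for i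
      by (rule 1(1)[rule_format]) (use that Cons omit_in_lists[OF gs, of i] in simp_all)
    have 3: "Wk (T_op f (gs ! i) # omit i gs) (E []) = E (T_op f (gs ! i) # omit i gs)" if "i < length gs" for i
      by (rule 1(1)[rule_format])
        (use that Cons omit_in_lists[OF gs, of i] nth_in_lists[OF gs that] in \<open>simp_all add: T_op_D0 f\<close>)
    have 4: "Wk gs (E []) = E gs" by (rule 1(1)[rule_format]) (use Cons gs in simp_all)
    have S2: "(\<Sum>i<length gs. c i *\<^sub>C Wk (omit i gs) (E [])) = (\<Sum>i<length gs. c i *\<^sub>C E (omit i gs))" for c
      by (intro sum.cong refl) (simp add: 2)
    have S3: "(\<Sum>i<length gs. c i *\<^sub>C Wk (T_op f (gs ! i) # omit i gs) (E [])) =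
        (\<Sum>i<length gs. c i *\<^sub>C E (T_op f (gs ! i) # omit i gs))" for c
      by (intro sum.cong refl) (simp add: 3)
    show ?thesis unfolding Cons wick.simps(2)[of q \<nu> \<iota> f gs] 4 Xf_E[OF f D0_lists_L2[OF gs]] S2 S3
      by (rule add_diff_diff_cancel)
  qed simp
qed

text \<open>Formal words are not taken modulo multilinearity or null sets, so W must be shown to
  respect both. A letter at the head enters every term of the recursion linearly; a letter further
  back is either contracted with the head or survives in a shorter word. The coefficients are real
  because \<open>Xf_cong\<close> requires it.\<close>

lemma wick_cong:
  assumes "fs \<in> lists D0" "i < length fs" "\<And>j. j \<in> J \<Longrightarrow> g j \<in> D0"
    and "AE z in M. (fs ! i) z = (\<Sum>j\<in>J. complex_of_real (r j) * g j z)"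
  shows "Wk fs \<xi> = (\<Sum>j\<in>J. complex_of_real (r j) *\<^sub>C Wk (fs[i := g j]) \<xi>)"
  using assms
proof (induction "length fs" arbitrary: fs i g rule: less_induct)
  case (less fs i g)
  then obtain f gs where fs: "fs = f # gs" by (cases fs) auto
  have f: "f \<in> D0" and gs: "gs \<in> lists D0" using less.prems(1) fs by auto
  let ?r = "\<lambda>j. complex_of_real (r j)"
  have TD: "T_op f (gs ! k) # omit k gs \<in> lists D0" if "k < length gs" "f \<in> D0" for k f
    using that omit_in_lists[OF gs, of k] nth_in_lists[OF gs that(1)] by (simp add: T_op_D0)
  have swap: "(\<Sum>k\<in>A. c k *\<^sub>C (\<Sum>j\<in>J. ?r j *\<^sub>C w j k)) = (\<Sum>j\<in>J. ?r j *\<^sub>C (\<Sum>k\<in>A. c k *\<^sub>C w j k))"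
    for A :: "nat set" and c and w :: "_ \<Rightarrow> nat \<Rightarrow> 'f"
    by (simp add: scaleC_sum_right scaleC_scaleC mult.commute) (rule sum.swap)
  show ?case
  proof (cases i)
    case 0
    have AE: "AE z in M. f z = (\<Sum>j\<in>J. ?r j * g j z)" using less.prems(4) fs 0 by simp
    have 1: "Xf f (Wk gs \<xi>) = (\<Sum>j\<in>J. ?r j *\<^sub>C Xf (g j) (Wk gs \<xi>))"
      by (rule Xf_cong[OF f less.prems(3) AE])
    have 2: "(\<Sum>k<length gs. (complex_of_real (q ^ k) * ip f (gs ! k)) *\<^sub>C Wk (omit k gs) \<xi>) =
        (\<Sum>j\<in>J. ?r j *\<^sub>C (\<Sum>k<length gs. (complex_of_real (q ^ k) * ip (g j) (gs ! k)) *\<^sub>C Wk (omit k gs) \<xi>))"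
    proof -
      have "ip f (gs ! k) = (\<Sum>j\<in>J. ?r j * ip (g j) (gs ! k))" if "k < length gs" for k
        by (rule ip_cong_left(1)) (use D0_L2 f less.prems(3) AE nth_in_lists[OF gs that] in auto)
      then have "(\<Sum>k<length gs. (complex_of_real (q ^ k) * ip f (gs ! k)) *\<^sub>C Wk (omit k gs) \<xi>) =
         (\<Sum>k<length gs. complex_of_real (q ^ k) *\<^sub>C (\<Sum>j\<in>J. ?r j *\<^sub>C (ip (g j) (gs ! k) *\<^sub>C Wk (omit k gs) \<xi>)))"
        by (intro sum.cong refl) (simp add: sum_distrib_left scaleC_sum_left scaleC_sum_right scaleC_scaleC mult_ac)
      then show ?thesis unfolding swap by (simp add: scaleC_scaleC)
    qed
    have 3: "(\<Sum>k<length gs. complex_of_real (q ^ k) *\<^sub>C Wk (T_op f (gs ! k) # omit k gs) \<xi>) =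
        (\<Sum>j\<in>J. ?r j *\<^sub>C (\<Sum>k<length gs. complex_of_real (q ^ k) *\<^sub>C Wk (T_op (g j) (gs ! k) # omit k gs) \<xi>))"
    proof -
      have "Wk (T_op f (gs ! k) # omit k gs) \<xi> = (\<Sum>j\<in>J. ?r j *\<^sub>C Wk (T_op (g j) (gs ! k) # omit k gs) \<xi>)"
        if k: "k < length gs" for k
      proof -
        \<comment> \<open>The contracted letter heads a word one letter shorter than
          \<open>fs\<close>, so the induction hypothesis applies at position 0.\<close>
        have "Wk (T_op f (gs ! k) # omit k gs) \<xi> =
            (\<Sum>j\<in>J. ?r j *\<^sub>C Wk ((T_op f (gs ! k) # omit k gs)[0 := T_op (g j) (gs ! k)]) \<xi>)"
        proof (rule less.hyps)
          show "AE z in M. ((T_op f (gs ! k) # omit k gs) ! 0) z = (\<Sum>j\<in>J. ?r j * T_op (g j) (gs ! k) z)"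
            using AE_T_op_cong(1)[OF AE] by simp
        qed (use TD[OF k f] k fs less.prems(3) nth_in_lists[OF gs k] in \<open>simp_all add: T_op_D0\<close>)
        then show ?thesis by simp
      qed
      then show ?thesis unfolding swap[symmetric] by simp
    qed
    have R: "Wk (fs[i := g j]) \<xi> = Xf (g j) (Wk gs \<xi>) -
        (\<Sum>k<length gs. (complex_of_real (q ^ k) * ip (g j) (gs ! k)) *\<^sub>C Wk (omit k gs) \<xi>) -
        (\<Sum>k<length gs. complex_of_real (q ^ k) *\<^sub>C Wk (T_op (g j) (gs ! k) # omit k gs) \<xi>)" for j
      by (simp only: fs 0 list_update_code wick.simps(2)[of q \<nu> \<iota> "g j" gs])
    show ?thesis unfolding R unfolding fs wick.simps(2)[of q \<nu> \<iota> f gs] 1 2 3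
      by (simp only: sum_subtractf scaleC_diff_right)
  next
    case (Suc m)
    have m: "m < length gs" using less.prems(2) fs Suc by simp
    have AE: "AE z in M. (gs ! m) z = (\<Sum>j\<in>J. ?r j * g j z)" using less.prems(4) fs Suc by simp
    have gm: "gs ! m \<in> D0" using nth_in_lists[OF gs m] .
    have 1: "Xf f (Wk gs \<xi>) = (\<Sum>j\<in>J. ?r j *\<^sub>C Xf f (Wk (gs[m := g j]) \<xi>))"
    proof -
      have "Wk gs \<xi> = (\<Sum>j\<in>J. ?r j *\<^sub>C Wk (gs[m := g j]) \<xi>)"
        by (rule less.hyps) (use fs gs m AE less.prems(3) in auto)
      then show ?thesis by (simp add: bounded_clinear_sum[OF Xf_bounded[OF f]] bounded_clinear_scaleC[OF Xf_bounded[OF f]])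
    qed
    \<comment> \<open>Deleting position \<open>k\<close> leaves the letter at \<open>m\<close> or
      moves it to \<open>m - 1\<close>; the same position \<open>m'\<close> works for every
      replacement \<open>y\<close>.\<close>
    have om: "\<exists>m'. m' < length gs - 1 \<and> omit k gs ! m' = gs ! m \<and> (\<forall>y. omit k (gs[m := y]) = (omit k gs)[m' := y])"
      if k: "k < length gs" "k \<noteq> m" for k
    proof (cases "m < k")
      case True
      then show ?thesis using k m
        by (intro exI[of _ m]) (auto simp: omit_update_greater nth_omit skip_def)
    next
      case False
      then have "k < m" using k by simp
      then show ?thesis using k m
        by (intro exI[of _ "m - 1"]) (auto simp: omit_update_less nth_omit skip_def)
    qed
    have 2: "(\<Sum>k<length gs. (complex_of_real (q ^ k) * ip f (gs ! k)) *\<^sub>C Wk (omit k gs) \<xi>) =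
        (\<Sum>j\<in>J. ?r j *\<^sub>C (\<Sum>k<length gs. (complex_of_real (q ^ k) * ip f (gs[m := g j] ! k)) *\<^sub>C Wk (omit k (gs[m := g j])) \<xi>))"
    proof -
      have "ip f (gs ! k) *\<^sub>C Wk (omit k gs) \<xi> =
          (\<Sum>j\<in>J. ?r j *\<^sub>C (ip f (gs[m := g j] ! k) *\<^sub>C Wk (omit k (gs[m := g j])) \<xi>))" if k: "k < length gs" for k
      proof (cases "k = m")
        case True
        have "ip f (gs ! m) = (\<Sum>j\<in>J. ?r j * ip f (g j))"
          by (rule ip_cong_left(2)) (use D0_L2 f less.prems(3) AE gm in auto)
        then show ?thesis using m True by (simp add: omit_update_same scaleC_sum_left scaleC_scaleC)
      next
        case False
        obtain m' where m': "m' < length gs - 1" "omit k gs ! m' = gs ! m"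
          "\<And>y. omit k (gs[m := y]) = (omit k gs)[m' := y]" using om[OF k False] by blast
        have "Wk (omit k gs) \<xi> = (\<Sum>j\<in>J. ?r j *\<^sub>C Wk ((omit k gs)[m' := g j]) \<xi>)"
          by (rule less.hyps) (use fs gs m' AE less.prems(3) k omit_in_lists[OF gs, of k] in simp_all)
        then show ?thesis using False m' by (simp add: scaleC_sum_right scaleC_scaleC mult.commute)
      qed
      then have "(\<Sum>k<length gs. (complex_of_real (q ^ k) * ip f (gs ! k)) *\<^sub>C Wk (omit k gs) \<xi>) =
         (\<Sum>k<length gs. complex_of_real (q ^ k) *\<^sub>C (\<Sum>j\<in>J. ?r j *\<^sub>C (ip f (gs[m := g j] ! k) *\<^sub>C Wk (omit k (gs[m := g j])) \<xi>)))"
        by (intro sum.cong refl) (simp flip: scaleC_scaleC)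
      then show ?thesis unfolding swap by (simp add: scaleC_scaleC)
    qed
    have 3: "(\<Sum>k<length gs. complex_of_real (q ^ k) *\<^sub>C Wk (T_op f (gs ! k) # omit k gs) \<xi>) =
        (\<Sum>j\<in>J. ?r j *\<^sub>C (\<Sum>k<length gs. complex_of_real (q ^ k) *\<^sub>C
          Wk (T_op f (gs[m := g j] ! k) # omit k (gs[m := g j])) \<xi>))"
    proof -
      have "Wk (T_op f (gs ! k) # omit k gs) \<xi> = (\<Sum>j\<in>J. ?r j *\<^sub>C Wk (T_op f (gs[m := g j] ! k) # omit k (gs[m := g j])) \<xi>)"
        if k: "k < length gs" for k
      proof (cases "k = m")
        \<comment> \<open>The replaced letter is itself contracted and returns as the head of the
          shorter word, acted on by \<open>T_op f\<close>.\<close>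
        case True
        have "Wk (T_op f (gs ! m) # omit m gs) \<xi> =
            (\<Sum>j\<in>J. ?r j *\<^sub>C Wk ((T_op f (gs ! m) # omit m gs)[0 := T_op f (g j)]) \<xi>)"
        proof (rule less.hyps)
          show "AE z in M. ((T_op f (gs ! m) # omit m gs) ! 0) z = (\<Sum>j\<in>J. ?r j * T_op f (g j) z)"
            using AE_T_op_cong(2)[OF AE] by simp
        qed (use TD[OF m f] m fs less.prems(3) f in \<open>simp_all add: T_op_D0\<close>)
        then show ?thesis using m True by (simp add: omit_update_same)
      next
        case False
        obtain m' where m': "m' < length gs - 1" "omit k gs ! m' = gs ! m"
          "\<And>y. omit k (gs[m := y]) = (omit k gs)[m' := y]" using om[OF k False] by blast
        have "Wk (T_op f (gs ! k) # omit k gs) \<xi> = (\<Sum>j\<in>J. ?r j *\<^sub>C Wk ((T_op f (gs ! k) # omit k gs)[Suc m' := g j]) \<xi>)"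
          by (rule less.hyps) (use fs m' AE less.prems(3) k TD[OF k f] in simp_all)
        then show ?thesis using False m' by simp
      qed
      then show ?thesis unfolding swap[symmetric] by simp
    qed
    have R: "Wk (fs[i := g j]) \<xi> = Xf f (Wk (gs[m := g j]) \<xi>) -
        (\<Sum>k<length gs. (complex_of_real (q ^ k) * ip f (gs[m := g j] ! k)) *\<^sub>C Wk (omit k (gs[m := g j])) \<xi>) -
        (\<Sum>k<length gs. complex_of_real (q ^ k) *\<^sub>C Wk (T_op f (gs[m := g j] ! k) # omit k (gs[m := g j])) \<xi>)" for j
      by (simp only: fs Suc list_update_code wick.simps(2)[of q \<nu> \<iota> f "gs[m := g j]"] length_list_update)
    show ?thesis unfolding R unfolding fs wick.simps(2)[of q \<nu> \<iota> f gs] 1 2 3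
      by (simp only: sum_subtractf scaleC_diff_right)
  qed
qed

text \<open>The counterpart of \<open>wick_cong\<close> for vectors. Positions in the tail are
  reached by applying the bounded operator \<open>Cr f\<close>.\<close>

lemma E_cong:
  assumes "fs \<in> lists L2" "i < length fs" "\<And>j. j \<in> J \<Longrightarrow> g j \<in> L2"
    and "AE z in M. (fs ! i) z = (\<Sum>j\<in>J. c j * g j z)"
  shows "E fs = (\<Sum>j\<in>J. c j *\<^sub>C E (fs[i := g j]))"
  using assms(1,2,4)
proof (induction fs arbitrary: i rule: list.induct)
  case (Cons f fs)
  then have f: "f \<in> L2" and fs: "fs \<in> lists L2" by auto
  show ?case
  proof (cases i)
    case 0
    then show ?thesis using Cons.prems(3) assms(3) f fs by (simp add: E_Cons_cong)
  next
    case (Suc m)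
    have "E fs = (\<Sum>j\<in>J. c j *\<^sub>C E (fs[m := g j]))"
      by (rule Cons.IH) (use Cons.prems Suc fs in auto)
    then have "Cr f (E fs) = (\<Sum>j\<in>J. c j *\<^sub>C Cr f (E (fs[m := g j])))"
      by (simp add: bounded_clinear_sum[OF Cr_bounded[OF f]] bounded_clinear_scaleC[OF Cr_bounded[OF f]])
    then show ?thesis using f fs Suc assms(3) update_in_lists[OF fs, of "g _" m] by (simp add: Cr_E)
  qed
qed simp

abbreviation "WM \<equiv> wick_map q \<nu> \<iota>"

lemma wick_map_superset:
  assumes "finite S" "keys v \<subseteq> S"
  shows "WM v \<xi> = (\<Sum>fs\<in>S. lookup v fs *\<^sub>C Wk fs \<xi>)"
  unfolding wick_map_def using assms by (intro sum.mono_neutral_left) (auto simp: in_keys_iff)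

lemma wick_map_add: "WM (v + w) \<xi> = WM v \<xi> + WM w \<xi>"
  using keys_add[of v w]
  by (subst (1 2 3) wick_map_superset[where S="keys v \<union> keys w"]) (auto simp: lookup_add scaleC_add_left sum.distrib)

lemma wick_map_fscale: "WM (fscale c v) \<xi> = c *\<^sub>C WM v \<xi>"
  using keys_fscale[of c v]
  by (subst (1 2) wick_map_superset[where S="keys v"]) (auto simp: scaleC_sum_right scaleC_scaleC)

lemma wick_map_tensor: "WM (tensor fs) = Wk fs"
  by (simp add: wick_map_def lookup_tensor fun_eq_iff)

lemma keys_fock_D: "v \<in> fock_D \<Longrightarrow> fs \<in> keys v \<Longrightarrow> fs \<in> lists D0"
  by (auto simp: fock_on_def)

lemma fock_D_FV: "v \<in> fock_D \<Longrightarrow> v \<in> FV"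
proof -
  have "lists D0 \<subseteq> lists L2" by (rule lists_mono) (use D0_L2 in blast)
  then show "v \<in> fock_D \<Longrightarrow> v \<in> FV" unfolding fock_on_def by blast
qed

lemma wick_map_AXD: "v \<in> fock_D \<Longrightarrow> WM v \<in> AXD"
  unfolding wick_map_def alg_X_Delta_def
  by (rule alg_sum, rule alg_generated.scale)
     (use keys_fock_D wick_AXD in \<open>auto simp: alg_X_Delta_def simp del: in_lists_conv_set\<close>)

lemma wick_map_vacuum: "v \<in> fock_D \<Longrightarrow> WM v (E []) = \<iota> v"
  using keys_fock_D[of v] by (simp add: wick_map_def iota_expand fock_D_FV wick_vacuum)

text \<open>The operators \<open>W(v)\<close> form a left module over the \<open>X(f)\<close>, by the recursion read backwards.\<close>

lemma Xf_wick:
  assumes f: "f \<in> D0" and fs: "fs \<in> lists D0"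
  shows "\<exists>v\<in>fock_D. (\<lambda>\<xi>. Xf f (Wk fs \<xi>)) = WM v"
proof -
  define v where "v = tensor (f # fs) +
    (\<Sum>i<length fs. fscale (complex_of_real (q ^ i) * ip f (fs ! i)) (tensor (omit i fs))) +
    (\<Sum>i<length fs. fscale (complex_of_real (q ^ i)) (tensor (T_op f (fs ! i) # omit i fs)))"
  have sm: "WM (\<Sum>i\<in>I. u i) \<xi> = (\<Sum>i\<in>I. WM (u i) \<xi>)" for I :: "nat set" and u \<xi>
    using wick_map_fscale[of 0 0 \<xi>] by (induction I rule: infinite_finite_induct) (simp_all add: wick_map_add)
  have "v \<in> fock_D" unfolding v_def vecs_lists[symmetric]
  proof (intro vecs_add vecs_sum vecs_fscale)
    show "tensor (f # fs) \<in> vecs (lists D0)" using assms by (simp add: vecs_tensor)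
    fix i assume "i \<in> {..<length fs}"
    then show "tensor (omit i fs) \<in> vecs (lists D0)" "tensor (T_op f (fs ! i) # omit i fs) \<in> vecs (lists D0)"
      using omit_in_lists[OF fs, of i] nth_in_lists[OF fs, of i] f by (simp_all add: vecs_tensor T_op_D0)
  qed
  moreover have "(\<lambda>\<xi>. Xf f (Wk fs \<xi>)) = WM v"
    by (simp add: fun_eq_iff v_def wick_map_add sm wick_map_fscale wick_map_tensor wick.simps(2)[of q \<nu> \<iota> f fs])
  ultimately show ?thesis by blast
qed

text \<open>With the empty word as \<open>v\<close> this writes every element of the large algebra
  as some \<open>WM w\<close>. The vector \<open>v\<close> is arbitrary because a product is
  absorbed one factor at a time.\<close>

lemma AXD_wick_module:
  assumes "A \<in> AXD" "v \<in> fock_D"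
  shows "\<exists>w\<in>fock_D. (\<lambda>\<xi>. A (WM v \<xi>)) = WM w"
  using assms unfolding alg_X_Delta_def
proof (induction arbitrary: v rule: alg_generated.induct)
  case one
  then show ?case by auto
next
  case (gen A)
  then obtain f where f: "f \<in> D0" "A = Xf f" using AXD_generators by blast
  have "\<forall>fs\<in>keys v. \<exists>u. u \<in> fock_D \<and> (\<forall>\<xi>. Xf f (Wk fs \<xi>) = WM u \<xi>)"
    using Xf_wick[OF f(1)] keys_fock_D[OF gen(2)] by (metis (no_types, lifting))
  then obtain u where u: "\<And>fs. fs \<in> keys v \<Longrightarrow> u fs \<in> fock_D" "\<And>fs \<xi>. fs \<in> keys v \<Longrightarrow> Xf f (Wk fs \<xi>) = WM (u fs) \<xi>"
    by metis
  have sm: "WM (\<Sum>i\<in>I. u i) \<xi> = (\<Sum>i\<in>I. WM (u i) \<xi>)" for I :: "l2fun list set" and u \<xi>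
    using wick_map_fscale[of 0 0 \<xi>] by (induction I rule: infinite_finite_induct) (simp_all add: wick_map_add)
  let ?w = "\<Sum>fs\<in>keys v. fscale (lookup v fs) (u fs)"
  have "?w \<in> fock_D" using u unfolding vecs_lists[symmetric] by (intro vecs_sum vecs_fscale)
  moreover have "A (WM v \<xi>) = WM ?w \<xi>" for \<xi>
    unfolding sm wick_map_fscale f(2)
    by (simp add: wick_map_def[of _ _ _ v] bounded_clinear_sum[OF Xf_bounded[OF f(1)]]
        bounded_clinear_scaleC[OF Xf_bounded[OF f(1)]] u(2))
  ultimately show ?case by auto
next
  case (add A B)
  then obtain u w where "u \<in> fock_D" "w \<in> fock_D" "(\<lambda>\<xi>. A (WM v \<xi>)) = WM u" "(\<lambda>\<xi>. B (WM v \<xi>)) = WM w" by blast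
  then show ?case by (intro bexI[of _ "u + w"])
    (auto simp: wick_map_add fun_eq_iff vecs_lists[symmetric] vecs_add)
next
  case (scale A c)
  then obtain u where "u \<in> fock_D" "(\<lambda>\<xi>. A (WM v \<xi>)) = WM u" by blast
  then show ?case by (intro bexI[of _ "fscale c u"])
    (auto simp: wick_map_fscale fun_eq_iff vecs_lists[symmetric] vecs_fscale)
next
  case (mult A B)
  then obtain u where u: "u \<in> fock_D" "(\<lambda>\<xi>. B (WM v \<xi>)) = WM u" by blast
  then obtain w where "w \<in> fock_D" "(\<lambda>\<xi>. A (WM u \<xi>)) = WM w" using mult by blast
  then show ?case using u by (metis (no_types, lifting) ext)
qed

lemma AXD_eq_wick_map:
  assumes "A \<in> AXD"
  shows "\<exists>v\<in>fock_D. A = WM v"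
proof -
  have "tensor [] \<in> fock_D" unfolding vecs_lists[symmetric] by (simp add: vecs_tensor)
  from AXD_wick_module[OF assms this] show ?thesis by (simp add: wick_map_tensor)
qed

end

section \<open>Strict positivity and faithfulness\<close>

text \<open>Moves the first letter to position \<open>k\<close>. For \<open>k < length w\<close>,
  deleting position \<open>k\<close> of \<open>rot k w\<close> leaves \<open>tl w\<close>; this is
  why the coefficients of all these words meet after one annihilation.\<close>

definition rot :: "nat \<Rightarrow> 'a list \<Rightarrow> 'a list" where
  "rot k w = take k (tl w) @ hd w # drop k (tl w)"

definition rot_sum :: "real \<Rightarrow> nat \<Rightarrow> ('a list \<Rightarrow> complex) \<Rightarrow> 'a list \<Rightarrow> complex" where
  "rot_sum q k c w = (\<Sum>i<k. complex_of_real (q ^ i) * c (rot i w))"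

lemma length_rot [simp]: "w \<noteq> [] \<Longrightarrow> length (rot k w) = length w"
  by (cases w) (auto simp: rot_def)

lemma set_rot [simp]:
  assumes "w \<noteq> []"
  shows "set (rot k w) = set w"
proof -
  have "set (tl w) = set (take k (tl w)) \<union> set (drop k (tl w))" by (metis append_take_drop_id set_append)
  then show ?thesis using assms by (cases w) (auto simp: rot_def)
qed

lemma rot_0: "w \<noteq> [] \<Longrightarrow> rot 0 w = w"
  by (simp add: rot_def)

lemma rot_neq_Nil [simp]: "rot k w \<noteq> []"
  by (simp add: rot_def)

text \<open>The index falls from \<open>Suc i\<close> to \<open>i\<close> while the extra rotation
  acts on the tail alone. This relation between cycles makes the sum in
  \<open>rot_sum_injective\<close> telescope.\<close>

lemma rot_rot:
  assumes "i < k" "k < length w"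
  shows "rot k (rot (Suc i) w) = rot i (hd w # rot (k - 1) (tl w))"
proof -
  obtain x y v where w: "w = x # y # v" using assms by (cases w; cases "tl w") auto
  have "k - 1 \<le> length v" using assms w by simp
  obtain k' where k: "k = Suc k'" using assms by (cases k) auto
  have k': "k' \<le> length v" "i \<le> k'" using assms w k by auto
  have "rot k (rot (Suc i) w) = take k (take i v @ x # drop i v) @ y # drop k (take i v @ x # drop i v)"
    by (simp add: rot_def w)
  also have "\<dots> = take i v @ x # take (k' - i) (drop i v) @ y # drop k' v"
    using k' by (simp add: k min_def Suc_diff_le)
  also have "\<dots> = rot i (x # take k' v @ y # drop k' v)"
    using k' by (simp add: rot_def min_def take_drop)
  also have "\<dots> = rot i (hd w # rot (k - 1) (tl w))" by (simp add: rot_def w k)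
  finally show ?thesis .
qed

text \<open>
  With \<open>c = c' - q\<^sup>k c' \<circ> rot k\<close> the sum telescopes to \<open>d - q\<^bsup>k+1\<^esup> d \<circ> S\<close>, where \<open>d\<close> is the shorter sum
  for \<open>c'\<close> and \<open>S\<close> permutes words.  This is Zagier's factorization of \<open>\<Sum>\<^sub>i q\<^sup>i rot i\<close>; since the
  permutations are isometries for the supremum norm, both factors are injective.
\<close>

lemma rot_sum_injective:
  assumes q: "\<bar>q\<bar> < 1" and k: "1 \<le> k" "k \<le> m"
    and bnd: "\<And>w. length w = m \<Longrightarrow> cmod (c w) \<le> B"
    and zero: "\<And>w. length w = m \<Longrightarrow> rot_sum q k c w = 0" and w: "length w = m"
  shows "c w = 0"
  using k bnd zero w
proof (induction k arbitrary: c B w rule: nat_induct_at_least)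
  case base
  have "w \<noteq> []" using base by auto
  then show ?case using base(3)[OF base(4)] by (simp add: rot_sum_def rot_0)
next
  case (Suc k)
  define a where "a = complex_of_real (q ^ k)"
  have a1: "cmod a < 1" using q Suc.hyps by (simp add: a_def norm_power power_abs power_less_one_iff)
  have ne: "v \<noteq> []" if "length v = m" for v :: "'a list" using that Suc.prems(1) by auto
  have len: "length ((rot k ^^ n) v) = m" if "length v = m" for n and v :: "'a list"
    using that by (induction n) (auto simp: ne)
  \<comment> \<open>Terms of the Neumann series that solves
    \<open>c' v - a * c' (rot k v) = c v\<close>; it converges because \<open>c\<close> is bounded
    and \<open>cmod a < 1\<close>.\<close>
  define t where "t v n = a ^ n * c ((rot k ^^ n) v)" for v n
  define c' where "c' v = suminf (t v)" for v
  have tb: "norm (t v n) \<le> B * cmod a ^ n" if "length v = m" for v n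
    using Suc.prems(2)[OF len[OF that, of n]]
    by (simp add: t_def norm_mult norm_power mult.commute[of B] mult_left_mono)
  have sg: "summable (\<lambda>n. B * cmod a ^ n)" using a1 by (intro summable_mult summable_geometric) simp
  have st: "summable (t v)" if "length v = m" for v
    by (rule summable_comparison_test'[OF sg]) (use tb[OF that] in auto)
  have c'b: "cmod (c' v) \<le> B / (1 - cmod a)" if "length v = m" for v
  proof -
    have "cmod (c' v) \<le> suminf (\<lambda>n. B * cmod a ^ n)"
      unfolding c'_def by (rule norm_suminf_le[OF tb[OF that] sg])
    also have "\<dots> = B * (1 / (1 - cmod a))"
      using a1 by (simp add: suminf_mult suminf_geometric summable_geometric)
    finally show ?thesis by simp
  qed
  have c_eq: "c v = c' v - a * c' (rot k v)" if v: "length v = m" for v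
  proof -
    have rv: "length (rot k v) = m" using v ne by simp
    have "t v (Suc n) = a * t (rot k v) n" for n by (simp add: t_def funpow_swap1)
    then have "suminf (\<lambda>n. t v (Suc n)) = a * c' (rot k v)"
      using st[OF rv] by (simp add: c'_def suminf_mult)
    moreover have "suminf (\<lambda>n. t v (Suc n)) = c' v - t v 0"
      using suminf_split_head[OF st[OF v]] by (simp add: c'_def)
    ultimately show ?thesis by (simp add: t_def algebra_simps)
  qed
  \<comment> \<open>The permutation left over by \<open>rot_rot\<close>: the first letter stays, the
    tail is rotated.\<close>
  define S where "S v = hd v # rot (k - 1) (tl v)" for v :: "'a list"
  have S: "length (S v) = m" if "length v = m" for v
    using that Suc.prems(1) Suc.hyps by (cases v; cases "tl v") (auto simp: S_def)
  define d where "d = rot_sum q k c'"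
  have d_eq: "d v = complex_of_real (q ^ Suc k) * d (S v)" if v: "length v = m" for v
  proof -
    have "0 = rot_sum q (Suc k) c v" using Suc.prems(3)[OF v] by simp
    also have "\<dots> = (\<Sum>i<Suc k. complex_of_real (q ^ i) * c' (rot i v)) -
        (\<Sum>i<Suc k. complex_of_real (q ^ i) * (a * c' (rot k (rot i v))))"
      unfolding rot_sum_def using v ne by (simp add: c_eq right_diff_distrib sum_subtractf del: sum.lessThan_Suc)
    also have "(\<Sum>i<Suc k. complex_of_real (q ^ i) * c' (rot i v)) = d v + a * c' (rot k v)"
      by (simp add: d_def rot_sum_def a_def)
    \<comment> \<open>As \<open>rot 0\<close> is the identity, the term \<open>i = 0\<close> of this
      sum equals the last term of the previous one, and the two cancel.\<close>
    also have "(\<Sum>i<Suc k. complex_of_real (q ^ i) * (a * c' (rot k (rot i v)))) =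
        a * c' (rot k v) + (\<Sum>i<k. complex_of_real (q ^ Suc i) * (a * c' (rot k (rot (Suc i) v))))"
      using ne[OF v] by (simp add: sum.lessThan_Suc_shift rot_0 del: sum.lessThan_Suc)
    also have "(\<Sum>i<k. complex_of_real (q ^ Suc i) * (a * c' (rot k (rot (Suc i) v)))) =
        complex_of_real (q ^ Suc k) * d (S v)"
      unfolding d_def rot_sum_def sum_distrib_left
    proof (intro sum.cong refl)
      fix i assume "i \<in> {..<k}"
      then have "rot k (rot (Suc i) v) = rot i (S v)"
        unfolding S_def using v Suc.prems(1) by (intro rot_rot) auto
      then show "complex_of_real (q ^ Suc i) * (a * c' (rot k (rot (Suc i) v))) =
          complex_of_real (q ^ Suc k) * (complex_of_real (q ^ i) * c' (rot i (S v)))"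
        by (simp add: a_def mult_ac)
    qed
    finally show ?thesis by simp
  qed
  define D where "D = real k * (B / (1 - cmod a))"
  have db: "cmod (d v) \<le> D" if v: "length v = m" for v
  proof -
    have "cmod (d v) \<le> (\<Sum>i<k. cmod (complex_of_real (q ^ i) * c' (rot i v)))"
      unfolding d_def rot_sum_def by (rule norm_sum)
    also have "\<dots> \<le> (\<Sum>i<k. B / (1 - cmod a))"
    proof (rule sum_mono)
      fix i
      have "\<bar>q\<bar> ^ i \<le> 1" using q by (simp add: power_le_one)
      then have "cmod (complex_of_real (q ^ i) * c' (rot i v)) \<le> 1 * cmod (c' (rot i v))"
        unfolding norm_mult by (intro mult_right_mono) (auto simp: norm_power)
      also have "\<dots> \<le> B / (1 - cmod a)" using c'b[of "rot i v"] v ne by simp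
      finally show "cmod (complex_of_real (q ^ i) * c' (rot i v)) \<le> B / (1 - cmod a)" .
    qed
    finally show ?thesis by (simp add: D_def)
  qed
  \<comment> \<open>Iterating \<open>d_eq\<close> gains a factor
    \<open>\<bar>q\<bar> ^ Suc k\<close> each time, while \<open>d\<close> stays bounded by
    \<open>D\<close>; in the limit \<open>d\<close> vanishes.\<close>
  have dn: "cmod (d v) \<le> (\<bar>q\<bar> ^ Suc k) ^ n * D" if "length v = m" for v n
    using that
  proof (induction n arbitrary: v)
    case (Suc n)
    have "cmod (d v) = \<bar>q\<bar> ^ Suc k * cmod (d (S v))"
      by (subst d_eq[OF Suc.prems]) (simp only: norm_mult norm_of_real power_abs)
    also have "\<dots> \<le> \<bar>q\<bar> ^ Suc k * ((\<bar>q\<bar> ^ Suc k) ^ n * D)"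
      by (intro mult_left_mono Suc.IH S Suc.prems) auto
    finally show ?case by (simp add: mult_ac)
  qed (simp add: db)
  have d0: "d v = 0" if v: "length v = m" for v
  proof -
    have "\<bar>q\<bar> ^ Suc k < 1" using q by (simp add: power_less_one_iff del: power_Suc)
    then have "(\<lambda>n. (\<bar>q\<bar> ^ Suc k) ^ n * D) \<longlonglongrightarrow> 0"
      by (intro tendsto_mult_left_zero LIMSEQ_realpow_zero) auto
    then have "cmod (d v) \<le> 0" by (rule LIMSEQ_le_const) (use dn[OF v] in auto)
    then show ?thesis by simp
  qed
  \<comment> \<open>Now \<open>d = 0\<close> says that the shorter sum of \<open>c'\<close>
    vanishes, so the hypothesis for \<open>k\<close> applies, with the bound of the geometric
    series.\<close>
  have c'0: "c' v = 0" if "length v = m" for v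
    by (rule Suc.IH[of c' "B / (1 - cmod a)"]) (use Suc.prems(1) c'b d0 that in \<open>auto simp: d_def\<close>)
  show ?case using c_eq[OF Suc.prems(4)] c'0 Suc.prems(4) ne by simp
qed

section \<open>Independence of words over an orthonormal alphabet\<close>

definition words :: "nat \<Rightarrow> nat \<Rightarrow> nat list set" where
  "words n l = {w. set w \<subseteq> {..<n} \<and> length w = l}"

lemma finite_words [simp]: "finite (words n l)"
  unfolding words_def by (rule finite_lists_length_eq) simp

lemma words_0: "words n 0 = {[]}"
  by (auto simp: words_def)

lemma sum_words_Suc: "(\<Sum>w\<in>words n (Suc l). f w) = (\<Sum>j<n. \<Sum>w\<in>words n l. f (j # w))"
proof -
  have "bij_betw (\<lambda>(j, w). j # w) ({..<n} \<times> words n l) (words n (Suc l))"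
    unfolding bij_betw_def
  proof
    show "(\<lambda>(j, w). j # w) ` ({..<n} \<times> words n l) = words n (Suc l)"
      by (force simp: words_def length_Suc_conv)
  qed (auto simp: inj_on_def)
  from sum.reindex_bij_betw[OF this, of f] show ?thesis
    by (simp add: sum.cartesian_product case_prod_beta)
qed

context q_fock
begin

text \<open>Reindexes the double sum that arises when \<open>e j\<close> annihilates a combination
  of words: a word with a marked letter \<open>j\<close> is a shorter word with a marked place of
  insertion.\<close>

lemma ins_bij:
  "bij_betw (\<lambda>(w, k). (omit k w, k))
     {(w, k). w \<in> (\<Union>l\<in>{..N}. words n l) \<and> k < length w \<and> w ! k = j}
     {(u, k). u \<in> (\<Union>l\<in>{..<N}. words n l) \<and> k \<le> length u}" if "j < n"
proof (rule bij_betw_byWitness[where f' = "\<lambda>(u, k). (take k u @ j # drop k u, k)"])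
  show "\<forall>a\<in>{(w, k). w \<in> (\<Union>l\<in>{..N}. words n l) \<and> k < length w \<and> w ! k = j}.
      (case (case a of (w, k) \<Rightarrow> (omit k w, k)) of (u, k) \<Rightarrow> (take k u @ j # drop k u, k)) = a"
    by (auto simp: omit_def id_take_nth_drop[symmetric])
  show "\<forall>a\<in>{(u, k). u \<in> (\<Union>l\<in>{..<N}. words n l) \<and> k \<le> length u}.
      (case (case a of (u, k) \<Rightarrow> (take k u @ j # drop k u, k)) of (w, k) \<Rightarrow> (omit k w, k)) = a"
    by (auto simp: omit_def)
  show "(\<lambda>(w, k). (omit k w, k)) ` {(w, k). w \<in> (\<Union>l\<in>{..N}. words n l) \<and> k < length w \<and> w ! k = j}
      \<subseteq> {(u, k). u \<in> (\<Union>l\<in>{..<N}. words n l) \<and> k \<le> length u}"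
    using set_omit by (fastforce simp: words_def)
  show "(\<lambda>(u, k). (take k u @ j # drop k u, k)) ` {(u, k). u \<in> (\<Union>l\<in>{..<N}. words n l) \<and> k \<le> length u}
      \<subseteq> {(w, k). w \<in> (\<Union>l\<in>{..N}. words n l) \<and> k < length w \<and> w ! k = j}"
    using that by (auto simp: words_def nth_append) (meson in_set_takeD in_set_dropD lessThan_iff subsetD)+
qed

lemma map_omit: "map f (omit k xs) = omit k (map f xs)"
  by (simp add: omit_def take_map drop_map)

text \<open>Strict positivity in coordinates. Annihilation by \<open>e j\<close> turns the relation
  into one among shorter words, whose coefficients vanish by induction on \<open>N\<close>. They are
  rotation sums of \<open>c\<close> at words starting with \<open>j\<close>, so
  \<open>rot_sum_injective\<close> removes every coefficient except that of the empty word.\<close>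

lemma E_words_independent:
  assumes on: "orthonormal {..<n} e"
    and zero: "(\<Sum>w\<in>(\<Union>l\<in>{..<N}. words n l). c w *\<^sub>C E (map e w)) = 0"
    and w: "w \<in> (\<Union>l\<in>{..<N}. words n l)"
  shows "c w = 0"
  using zero w
proof (induction N arbitrary: c w)
  case (Suc N)
  let ?W = "\<Union>l\<in>{..N}. words n l" and ?W' = "\<Union>l\<in>{..<N}. words n l"
  have e2: "e j \<in> L2" if "j < n" for j using on that by (simp add: orthonormal_def)
  have mapL: "map e w \<in> lists L2" if "set w \<subseteq> {..<n}" for w
  proof -
    have "\<forall>x\<in>set w. e x \<in> L2" using that e2 by (metis lessThan_iff subsetD)
    then show ?thesis by auto
  qed
  have WL: "set w \<subseteq> {..<n}" if "w \<in> ?W" for w using that by (auto simp: words_def)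
  have finW: "finite ?W" "finite ?W'" by auto
  have zero: "(\<Sum>w\<in>?W. c w *\<^sub>C E (map e w)) = 0" using Suc.prems(1) by (simp add: lessThan_Suc_atMost)
  have ins0: "(\<Sum>k\<le>length u. complex_of_real (q ^ k) * c (take k u @ j # drop k u)) = 0"
    if j: "j < n" and u: "u \<in> ?W'" for j u
  proof -
    note An = An_bounded[OF e2[OF j]]
    let ?P = "{(w, k). w \<in> ?W \<and> k < length w \<and> w ! k = j}"
    let ?Q = "{(u, k). u \<in> ?W' \<and> k \<le> length u}"
    have "0 = An (e j) (\<Sum>w\<in>?W. c w *\<^sub>C E (map e w))" using zero bounded_clinear_zero[OF An] by simp
    also have "\<dots> = (\<Sum>w\<in>?W. c w *\<^sub>C An (e j) (E (map e w)))"
      by (simp add: bounded_clinear_sum[OF An] bounded_clinear_scaleC[OF An])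
    also have "\<dots> = (\<Sum>w\<in>?W. \<Sum>k<length w. if w ! k = j then (complex_of_real (q ^ k) * c w) *\<^sub>C E (map e (omit k w)) else 0)"
    proof (rule sum.cong[OF refl])
      fix w assume w: "w \<in> ?W"
      have "ip (e j) (map e w ! k) = (if w ! k = j then 1 else 0)" if "k < length w" for k
      proof -
        have "w ! k < n" using WL[OF w] nth_mem[OF that] by auto
        then show ?thesis using on j that by (auto simp: orthonormal_def)
      qed
      then have "An (e j) (E (map e w)) =
          (\<Sum>k<length w. (complex_of_real (q ^ k) * (if w ! k = j then 1 else 0)) *\<^sub>C E (map e (omit k w)))"
        unfolding An_E[OF e2[OF j] mapL[OF WL[OF w]]] by (intro sum.cong) (auto simp: map_omit)
      then show "c w *\<^sub>C An (e j) (E (map e w)) =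
          (\<Sum>k<length w. if w ! k = j then (complex_of_real (q ^ k) * c w) *\<^sub>C E (map e (omit k w)) else 0)"
        by (auto simp: scaleC_sum_right scaleC_scaleC mult.commute intro!: sum.cong)
    qed
    also have "\<dots> = (\<Sum>(w, k)\<in>Sigma ?W (\<lambda>w. {..<length w}).
        if w ! k = j then (complex_of_real (q ^ k) * c w) *\<^sub>C E (map e (omit k w)) else 0)"
      using finW by (subst sum.Sigma) auto
    also have "\<dots> = (\<Sum>(w, k)\<in>?P. (complex_of_real (q ^ k) * c w) *\<^sub>C E (map e (omit k w)))"
      using finW by (intro sum.mono_neutral_cong_right) (auto split: if_splits)
    also have "\<dots> = (\<Sum>(w, k)\<in>?P. case (omit k w, k) of (u, k) \<Rightarrow>
        (complex_of_real (q ^ k) * c (take k u @ j # drop k u)) *\<^sub>C E (map e u))"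
      by (intro sum.cong refl) (auto simp: omit_def id_take_nth_drop[symmetric])
    also have "\<dots> = (\<Sum>(u, k)\<in>?Q. (complex_of_real (q ^ k) * c (take k u @ j # drop k u)) *\<^sub>C E (map e u))"
      using sum.reindex_bij_betw[OF ins_bij[OF j, of N], of "\<lambda>(u, k). (complex_of_real (q ^ k) * c (take k u @ j # drop k u)) *\<^sub>C E (map e u)"]
      by (simp add: case_prod_beta)
    also have "?Q = Sigma ?W' (\<lambda>u. {..length u})" by auto
    also have "(\<Sum>(u, k)\<in>Sigma ?W' (\<lambda>u. {..length u}). (complex_of_real (q ^ k) * c (take k u @ j # drop k u)) *\<^sub>C E (map e u)) =
        (\<Sum>u\<in>?W'. (\<Sum>k\<le>length u. complex_of_real (q ^ k) * c (take k u @ j # drop k u)) *\<^sub>C E (map e u))"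
      using finW by (subst sum.Sigma[symmetric]) (auto simp: scaleC_sum_left)
    finally show ?thesis using Suc.IH[of "\<lambda>u. \<Sum>k\<le>length u. complex_of_real (q ^ k) * c (take k u @ j # drop k u)"] u
      by simp
  qed
  \<comment> \<open>Extended by 0, since \<open>rot_sum_injective\<close> asks for a bounded
    function on all words of a given length, over any letters.\<close>
  define d where "d w = (if w \<in> ?W then c w else 0)" for w
  define B where "B = (\<Sum>w\<in>?W. cmod (c w))"
  have dB: "cmod (d w) \<le> B" for w
    unfolding d_def B_def using finW by (auto intro: member_le_sum sum_nonneg)
  have d0: "d v = 0" if v: "v \<noteq> []" for v
  proof (rule rot_sum_injective[where q=q and k="length v" and m="length v" and B=B])
    show "\<bar>q\<bar> < 1" using q by auto
    show "1 \<le> length v" using v by (cases v) auto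
    fix w :: "nat list" assume lw: "length w = length v"
    then have "w \<noteq> []" using v by auto
    then obtain j u where w: "w = j # u" by (cases w) auto
    show "rot_sum q (length v) d w = 0"
    proof (cases "w \<in> ?W")
      case False
      have "rot i w \<notin> ?W" for i
        using False \<open>w \<noteq> []\<close> by (auto simp: words_def)
      then show ?thesis by (simp add: rot_sum_def d_def)
    next
      case True
      have "rot i w \<in> ?W" for i using True \<open>w \<noteq> []\<close> by (auto simp: words_def)
      \<comment> \<open>\<open>rot k (j # u)\<close> inserts \<open>j\<close> into \<open>u\<close>
        at place \<open>k\<close>, which makes the rotation sum the coefficient treated in
        \<open>ins0\<close>.\<close>
      then have "rot_sum q (length v) d w = (\<Sum>k\<le>length u. complex_of_real (q ^ k) * c (take k u @ j # drop k u))"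
        unfolding rot_sum_def lw[symmetric] by (simp add: d_def rot_def w lessThan_Suc_atMost)
      also have "\<dots> = 0" using True w by (intro ins0) (auto simp: words_def)
      finally show ?thesis .
    qed
  qed (use dB in auto)
  have cv: "c v = 0" if "v \<in> ?W" "v \<noteq> []" for v using d0[OF that(2)] that(1) by (simp add: d_def)
  show ?case
  proof (cases "w = []")
    case False
    then show ?thesis using cv Suc.prems(2) by (simp add: lessThan_Suc_atMost)
  next
    case True
    \<comment> \<open>All other coefficients are already 0, and the vacuum is a unit vector.\<close>
    have "[] \<in> ?W" using words_0 by auto
    have "(\<Sum>w\<in>?W. c w *\<^sub>C E (map e w)) = (\<Sum>w\<in>{[]}. c w *\<^sub>C E (map e w))"
      using cv finW \<open>[] \<in> ?W\<close> by (intro sum.mono_neutral_right) auto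
    then have "c [] *\<^sub>C E [] = 0" using zero by simp
    moreover have "E [] \<noteq> 0" using E_inner_Nil[of "[]"] by auto
    ultimately have "c [] = 0" by (metis norm_eq_zero norm_scaleC mult_eq_0_iff)
    then show ?thesis using True by simp
  qed
qed simp

text \<open>Letters are expanded from left to right, and \<open>us\<close> holds those already
  replaced. \<Phi> is abstract because words as vectors and Wick words applied to a vector must be
  expanded with the same coefficients.\<close>

lemma multilinear_expand:
  fixes \<Phi> :: "l2fun list \<Rightarrow> 'f"
  assumes ml: "\<And>fs i. fs \<in> lists D0 \<Longrightarrow> i < length fs \<Longrightarrow> fs ! i \<in> F \<Longrightarrow>
      \<Phi> fs = (\<Sum>j<n. r (fs ! i) j *\<^sub>C \<Phi> (fs[i := e j]))"
    and e: "\<And>j. j < n \<Longrightarrow> e j \<in> D0" and us: "us \<in> lists D0" and fs: "set fs \<subseteq> F" "F \<subseteq> D0"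
  shows "\<Phi> (us @ fs) = (\<Sum>w\<in>words n (length fs). (\<Prod>l<length fs. r (fs ! l) (w ! l)) *\<^sub>C \<Phi> (us @ map e w))"
  using us fs(1)
proof (induction fs arbitrary: us rule: list.induct)
  case Nil
  then show ?case by (simp add: words_0)
next
  case (Cons f fs)
  have f: "f \<in> F" "set fs \<subseteq> F" using Cons.prems by auto
  have "set fs \<subseteq> D0" using f(2) fs(2) by simp
  then have "us @ f # fs \<in> lists D0" using Cons.prems(1) f fs(2) by (auto simp: in_lists_conv_set)
  then have "\<Phi> (us @ f # fs) = (\<Sum>j<n. r f j *\<^sub>C \<Phi> ((us @ [e j]) @ fs))"
    using ml[of "us @ f # fs" "length us"] f by (simp add: nth_append list_update_append)
  also have "\<dots> = (\<Sum>j<n. r f j *\<^sub>C (\<Sum>w\<in>words n (length fs). (\<Prod>l<length fs. r (fs ! l) (w ! l)) *\<^sub>C \<Phi> ((us @ [e j]) @ map e w)))"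
  proof (intro sum.cong refl arg_cong2[where f=scaleC])
    fix j assume "j \<in> {..<n}"
    then have "us @ [e j] \<in> lists D0" using Cons.prems(1) e by simp
    then show "\<Phi> ((us @ [e j]) @ fs) =
        (\<Sum>w\<in>words n (length fs). (\<Prod>l<length fs. r (fs ! l) (w ! l)) *\<^sub>C \<Phi> ((us @ [e j]) @ map e w))"
      by (rule Cons.IH[OF _ f(2)])
  qed
  also have "\<dots> = (\<Sum>w\<in>words n (length (f # fs)). (\<Prod>l<length (f # fs). r ((f # fs) ! l) (w ! l)) *\<^sub>C \<Phi> (us @ map e w))"
    by (simp add: sum_words_Suc scaleC_sum_right scaleC_scaleC prod.lessThan_Suc_shift del: prod.lessThan_Suc)
  finally show ?case .
qed

text \<open>Keeps the Gram-Schmidt coefficients real, so that the basis stays in \<open>D0\<close>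
  and \<open>wick_cong\<close>, which allows only real coefficients, can be applied to it.\<close>

lemma D0_ip_real: "f \<in> D0 \<Longrightarrow> g \<in> D0 \<Longrightarrow> complex_of_real (Re (ip f g)) = ip f g"
proof (rule of_real_Re)
  assume f: "f \<in> D0" and g: "g \<in> D0"
  have "cnj (f z) = f z" "cnj (g z) = g z" for z
    using D0_real[OF f, of z] D0_real[OF g, of z] by (simp_all add: Reals_cnj_iff)
  then have "ip f g = ip g f" by (simp add: l2_inner_def mult.commute)
  then have "cnj (ip f g) = ip f g" using l2_inner_cnj[of \<nu> g f] by simp
  then show "ip f g \<in> \<real>" by (simp add: Reals_cnj_iff)
qed

lemma gram_schmidt_D0:
  assumes "finite F" "F \<subseteq> D0"
  shows "\<exists>(n::nat) e. (\<forall>j<n. e j \<in> D0) \<and>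
    (\<forall>i<n. \<forall>j<n. ip (e i) (e j) = (if i = j then 1 else 0)) \<and>
    (\<forall>f\<in>F. AE z in M. f z = (\<Sum>j<n. ip (e j) f * e j z))"
proof (rule gram_schmidt[OF assms])
  show "D0 \<subseteq> L2" using D0_L2 by blast
  fix f e and n :: nat assume f: "f \<in> D0" and e: "\<And>j. j < n \<Longrightarrow> e j \<in> D0"
  have eq: "(\<lambda>z. f z - (\<Sum>j<n. ip (e j) f * e j z)) =
      (\<lambda>z. f z + (\<Sum>j<n. complex_of_real (- Re (ip (e j) f)) * e j z))"
  proof
    fix z
    have "complex_of_real (- Re (ip (e j) f)) * e j z = - (ip (e j) f * e j z)" if "j \<in> {..<n}" for j
      using D0_ip_real[OF e f, of j] that by simp
    then have "(\<Sum>j<n. complex_of_real (- Re (ip (e j) f)) * e j z) = - (\<Sum>j<n. ip (e j) f * e j z)"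
      unfolding sum_negf[symmetric] by (intro sum.cong refl)
    then show "f z - (\<Sum>j<n. ip (e j) f * e j z) = f z + (\<Sum>j<n. complex_of_real (- Re (ip (e j) f)) * e j z)"
      by simp
  qed
  show "(\<lambda>z. f z - (\<Sum>j<n. ip (e j) f * e j z)) \<in> D0"
    unfolding eq using f e by (intro D0_add D0_sum) auto
qed (rule D0_scale)

text \<open>
  On an orthonormal basis of the letters of \<open>v\<close>, both \<open>\<iota> v\<close> and \<open>W(v)\<xi>\<close> expand with the same
  coefficients, which vanish by independence.
\<close>

lemma wick_map_eq_0:
  assumes v: "v \<in> fock_D" and zero: "\<iota> v = 0"
  shows "WM v \<xi> = 0"
proof -
  define F where "F = (\<Union>fs\<in>keys v. set fs)"
  have F: "finite F" "F \<subseteq> D0" using keys_fock_D[OF v] by (auto simp: F_def)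
  obtain n :: nat and e where e: "\<forall>j<n. e j \<in> D0"
    and on: "\<forall>i<n. \<forall>j<n. ip (e i) (e j) = (if i = j then 1 else 0)"
    and ex: "\<forall>f\<in>F. AE z in M. f z = (\<Sum>j<n. ip (e j) f * e j z)"
    using gram_schmidt_D0[OF F] by (elim exE conjE) (rule that)
  \<comment> \<open>Equal to \<open>ip (e j) f\<close> on the letters of \<open>v\<close>, but
    visibly real, as \<open>wick_cong\<close> requires.\<close>
  define r where "r f j = complex_of_real (Re (ip (e j) f))" for f j
  have ex': "AE z in M. f z = (\<Sum>j<n. r f j * e j z)" if "f \<in> F" for f
  proof -
    have "r f j = ip (e j) f" if "j < n" for j
      unfolding r_def using D0_ip_real[of "e j" f] e that \<open>f \<in> F\<close> F by auto
    then have "(\<Sum>j<n. r f j * e j z) = (\<Sum>j<n. ip (e j) f * e j z)" for z by (intro sum.cong) auto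
    then show ?thesis using ex that by simp
  qed
  define cf where "cf fs w = (\<Prod>l<length fs. r (fs ! l) (w ! l))" for fs w
  have exp: "\<Phi> fs = (\<Sum>w\<in>words n (length fs). cf fs w *\<^sub>C \<Phi> (map e w))"
    if "fs \<in> keys v" and ml: "\<And>fs i. fs \<in> lists D0 \<Longrightarrow> i < length fs \<Longrightarrow> fs ! i \<in> F \<Longrightarrow>
      \<Phi> fs = (\<Sum>j<n. r (fs ! i) j *\<^sub>C \<Phi> (fs[i := e j]))" for \<Phi> :: "l2fun list \<Rightarrow> 'f" and fs
  proof -
    have "set fs \<subseteq> F" using that(1) by (auto simp: F_def)
    then show ?thesis using multilinear_expand[where F=F and \<Phi>=\<Phi> and n=n and r=r and e=e and us="[]" and fs=fs, OF ml _ _ _ F(2)] e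
      by (simp add: cf_def)
  qed
  have E_exp: "E fs = (\<Sum>w\<in>words n (length fs). cf fs w *\<^sub>C E (map e w))" if "fs \<in> keys v" for fs
  proof (rule exp[OF that])
    fix gs i assume "gs \<in> lists D0" "i < length gs" "gs ! i \<in> F"
    then show "E gs = (\<Sum>j<n. r (gs ! i) j *\<^sub>C E (gs[i := e j]))"
      using e ex' D0_L2 by (intro E_cong D0_lists_L2) auto
  qed
  have W_exp: "Wk fs \<xi> = (\<Sum>w\<in>words n (length fs). cf fs w *\<^sub>C Wk (map e w) \<xi>)" if "fs \<in> keys v" for fs
  proof (rule exp[OF that, of "\<lambda>fs. Wk fs \<xi>"])
    fix gs i assume "gs \<in> lists D0" "i < length gs" "gs ! i \<in> F"
    then show "Wk gs \<xi> = (\<Sum>j<n. r (gs ! i) j *\<^sub>C Wk (gs[i := e j]) \<xi>)"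
      unfolding r_def using e ex' by (intro wick_cong) (auto simp: r_def)
  qed
  obtain N where N: "\<And>fs. fs \<in> keys v \<Longrightarrow> length fs < N"
  proof -
    have "length fs < Suc (Max (length ` keys v))" if "fs \<in> keys v" for fs
      using that by (simp add: less_Suc_eq_le)
    then show ?thesis using that by blast
  qed
  let ?W = "\<Union>l\<in>{..<N}. words n l"
  \<comment> \<open>The total coefficient of the word \<open>w\<close>; here \<open>C\<close> is a
    function and not the constant of the norm bounds.\<close>
  define C where "C w = (\<Sum>fs\<in>keys v. if length fs = length w then lookup v fs * cf fs w else 0)" for w
  have collect: "(\<Sum>fs\<in>keys v. lookup v fs *\<^sub>C (\<Sum>w\<in>words n (length fs). cf fs w *\<^sub>C \<Psi> w)) = (\<Sum>w\<in>?W. C w *\<^sub>C \<Psi> w)"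
    for \<Psi> :: "nat list \<Rightarrow> 'f"
  proof -
    have "lookup v fs *\<^sub>C (\<Sum>w\<in>words n (length fs). cf fs w *\<^sub>C \<Psi> w) =
        (\<Sum>w\<in>?W. (if length fs = length w then lookup v fs * cf fs w else 0) *\<^sub>C \<Psi> w)" if "fs \<in> keys v" for fs
      unfolding scaleC_sum_right scaleC_scaleC
      by (rule sum.mono_neutral_cong_left) (use N[OF that] in \<open>auto simp: words_def finite_lists_length_eq\<close>)
    then show ?thesis unfolding C_def scaleC_sum_left by (subst sum.swap) (simp cong: sum.cong)
  qed
  have "\<iota> v = (\<Sum>w\<in>?W. C w *\<^sub>C E (map e w))"
    unfolding iota_expand[OF fock_D_FV[OF v]] collect[symmetric] by (intro sum.cong refl) (simp flip: E_exp)
  then have "(\<Sum>w\<in>?W. C w *\<^sub>C E (map e w)) = 0" using zero by simp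
  moreover have "orthonormal {..<n} e" using e on D0_L2 by (auto simp: orthonormal_def)
  ultimately have C0: "C w = 0" if "w \<in> ?W" for w using E_words_independent that by blast
  have "WM v \<xi> = (\<Sum>w\<in>?W. C w *\<^sub>C Wk (map e w) \<xi>)"
    unfolding wick_map_def collect[symmetric] by (intro sum.cong refl) (simp flip: W_exp)
  then show ?thesis using C0 by simp
qed

text \<open>This lets W be regarded as a map on vectors of the Fock space instead of formal
  combinations.\<close>

lemma wick_map_eqI:
  assumes "v \<in> fock_D" "w \<in> fock_D" "\<iota> v = \<iota> w"
  shows "WM v = WM w"
proof
  fix \<xi>
  let ?d = "v + fscale (-1) w"
  have d: "?d \<in> fock_D" using assms unfolding vecs_lists[symmetric] by (intro vecs_add vecs_fscale)
  have "\<iota> ?d = 0" using assms fock_D_FV by (simp add: iota_add iota_scale FV_fscale scaleC_minus_one)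
  from wick_map_eq_0[OF d this] show "WM v \<xi> = WM w \<xi>"
    by (simp add: wick_map_add wick_map_fscale scaleC_minus_one)
qed

lemma AXD_separating:
  assumes "A \<in> AXD" "A (E []) = 0"
  shows "A = (\<lambda>_. 0)"
proof -
  obtain v where v: "v \<in> fock_D" "A = WM v" using AXD_eq_wick_map[OF assms(1)] by blast
  then have "\<iota> v = 0" using wick_map_vacuum[OF v(1)] assms(2) by simp
  then show ?thesis using wick_map_eq_0[OF v(1)] v(2) by auto
qed

end

section \<open>Cyclicity\<close>

definition csubspace :: "'a::complex_inner set \<Rightarrow> bool" where
  "csubspace S \<longleftrightarrow> 0 \<in> S \<and> (\<forall>x\<in>S. \<forall>y\<in>S. x + y \<in> S) \<and> (\<forall>c. \<forall>x\<in>S. c *\<^sub>C x \<in> S)"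

lemma bounded_linear_closure_mono:
  assumes "bounded_linear f" "\<And>x. x \<in> S \<Longrightarrow> f x \<in> closure T" "x \<in> closure S"
  shows "f x \<in> closure T"
proof -
  have "f ` closure S \<subseteq> closure (closure T)"
    using closure_bounded_linear_image_subset[OF assms(1), of S] closure_mono[of "f ` S" "closure T"] assms(2) by blast
  then show ?thesis using assms(3) by auto
qed

lemma csubspace_closure:
  assumes "csubspace S"
  shows "csubspace (closure S)"
  unfolding csubspace_def
proof (intro conjI ballI allI)
  show "0 \<in> closure S" using assms closure_subset by (auto simp: csubspace_def)
next
  fix x y assume "x \<in> closure S" "y \<in> closure S"
  then obtain s t where "\<forall>n. s n \<in> S" "s \<longlonglongrightarrow> x" "\<forall>n. t n \<in> S" "t \<longlonglongrightarrow> y"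
    unfolding closure_sequential by blast
  then show "x + y \<in> closure S" using assms unfolding closure_sequential
    by (intro exI[of _ "\<lambda>n. s n + t n"]) (auto simp: csubspace_def intro: tendsto_add)
next
  fix c x assume "x \<in> closure S"
  then show "c *\<^sub>C x \<in> closure S"
  proof (rule bounded_linear_closure_mono[OF bounded_linear_scaleC, rotated])
    fix x assume "x \<in> S"
    then have "c *\<^sub>C x \<in> S" using assms by (simp add: csubspace_def)
    then show "c *\<^sub>C x \<in> closure S" by (rule subsetD[OF closure_subset])
  qed
qed

lemma csubspace_add: "csubspace S \<Longrightarrow> x \<in> S \<Longrightarrow> y \<in> S \<Longrightarrow> x + y \<in> S"
  and csubspace_scale: "csubspace S \<Longrightarrow> x \<in> S \<Longrightarrow> c *\<^sub>C x \<in> S"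
  and csubspace_zero: "csubspace S \<Longrightarrow> 0 \<in> S"
  by (simp_all add: csubspace_def)

lemma csubspace_diff:
  assumes "csubspace S" "x \<in> S" "y \<in> S"
  shows "x - y \<in> S"
  using csubspace_add[OF assms(1,2) csubspace_scale[OF assms(1,3), of "-1"]] by (simp add: scaleC_minus_one)

lemma csubspace_sum:
  assumes "csubspace S" "\<And>i. i \<in> I \<Longrightarrow> f i \<in> S"
  shows "(\<Sum>i\<in>I. f i) \<in> S"
  using assms(2)
  by (induction I rule: infinite_finite_induct) (simp_all add: csubspace_zero[OF assms(1)] csubspace_add[OF assms(1)])

lemma tendsto_zero_of_square_bound:
  fixes z :: "nat \<Rightarrow> 'a::real_normed_vector"
  assumes "\<And>n. (norm (z n))\<^sup>2 \<le> K / real (Suc n)"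
  shows "z \<longlonglongrightarrow> 0"
proof -
  have "(\<lambda>n. K * inverse (real (Suc n))) \<longlonglongrightarrow> K * 0"
    by (intro tendsto_mult tendsto_const LIMSEQ_inverse_real_of_nat)
  then have "(\<lambda>n. K / real (Suc n)) \<longlonglongrightarrow> 0" by (simp add: divide_inverse)
  then have "(\<lambda>n. (norm (z n))\<^sup>2) \<longlonglongrightarrow> 0"
    by (rule tendsto_sandwich[rotated 2, OF tendsto_const]) (use assms in auto)
  from tendsto_real_sqrt[OF this] show ?thesis by (simp add: tendsto_norm_zero_iff)
qed

text \<open>A set of letters stable under \<open>T_op\<close> without linear combinations, so that
  the induction on words in \<open>E_ind_pows_Mc\<close> never has to expand a letter.\<close>

definition ind_pows :: "l2fun set" where
  "ind_pows = {ind_pow a b k |a b k. 0 \<le> a \<and> a \<le> b}"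

lemma T_op_ind_pows: "f \<in> ind_pows \<Longrightarrow> g \<in> ind_pows \<Longrightarrow> T_op f g \<in> ind_pows"
proof -
  assume "f \<in> ind_pows" "g \<in> ind_pows"
  then obtain a b k c d l where "f = ind_pow a b k" "g = ind_pow c d l" "0 \<le> a" by (auto simp: ind_pows_def)
  then have "T_op f g = ind_pow (max a c) (max (max a c) (min b d)) (Suc (k + l)) \<and> 0 \<le> max a c \<and> max a c \<le> max (max a c) (min b d)"
    by (simp add: T_op_ind_pow)
  then show ?thesis unfolding ind_pows_def by blast
qed

lemma ind_pow_partition:
  assumes "incseq p"
  shows "ind_pow (p 0) (p N) k z = (\<Sum>i<N. ind_pow (p i) (p (Suc i)) k z)"
proof (induction N)
  case 0
  then show ?case by (simp add: ind_pow_def case_prod_beta)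
next
  case (Suc N)
  have "p 0 \<le> p N" "p N \<le> p (Suc N)" using assms by (auto simp: incseq_def)
  then have "ind_pow (p 0) (p (Suc N)) k z = ind_pow (p 0) (p N) k z + ind_pow (p N) (p (Suc N)) k z"
    by (auto simp: ind_pow_def case_prod_beta indicator_def)
  then show ?case using Suc by simp
qed

context q_fock
begin

lemma ind_pows_D0: "f \<in> ind_pows \<Longrightarrow> f \<in> D0"
  by (auto simp: ind_pows_def intro: D0_ind_pow)

lemma ind_pows_lists: "xs \<in> lists ind_pows \<Longrightarrow> xs \<in> lists D0"
  using ind_pows_D0 by (auto simp: in_lists_conv_set)

lemma E_Cons_bound:
  assumes "f \<in> L2" "xs \<in> lists L2"
  shows "norm (E (f # xs)) \<le> sqrt (C * nsq \<nu> f) * norm (E xs)"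
  using cre_bound[OF assms(1), of "tensor xs"] assms by (simp add: E_def FV_tensor)

text \<open>The first letters live on disjoint pieces and are orthogonal, so the column bound adds
  squares: \<open>N\<close> terms of order \<delta>^2. The triangle inequality would only give
  \<open>N\<close> times \<delta>, which does not tend to 0. The intervals from \<open>c i\<close>
  to \<open>d i\<close> may be smaller than the pieces because they also arise as intersections with
  the interval of another letter.\<close>

lemma diagonal_sum_bound:
  assumes p: "incseq p" "0 \<le> p 0" "\<And>i. p (Suc i) - p i \<le> \<delta>"
    and cd: "\<And>i. 0 \<le> c i" "\<And>i. c i \<le> d i" "\<And>i. d i - c i \<le> \<delta>"
    and sub: "\<And>i. {c i..<d i} \<subseteq> {p i..<p (Suc i)}"
    and ys: "ys \<in> lists L2"
  shows "(norm (\<Sum>i<N. E (ind_pow (c i) (d i) m # ind_pow (p i) (p (Suc i)) k # ys)))\<^sup>2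
    \<le> (C * B0 ^ (2 * m) * (C * B0 ^ (2 * k) * (norm (E ys))\<^sup>2)) * (real N * \<delta>\<^sup>2)"
proof -
  have p0: "0 \<le> p i" "p i \<le> p (Suc i)" for i
    using p(1,2) by (auto simp: incseq_def intro: order_trans[of _ "p 0"])
  define h where "h i = ind_pow (c i) (d i) m" for i
  define g where "g i = ind_pow (p i) (p (Suc i)) k" for i
  have d0: "\<delta> \<ge> 0" using p0[of 0] p(3)[of 0] by linarith
  have B0k: "B0 ^ n \<ge> 0" for n using B0(1) by simp
  have h2: "h i \<in> L2" "nsq \<nu> (h i) \<le> B0 ^ (2 * m) * \<delta>" for i
    unfolding h_def using ind_pow_L2[OF cd(1)[of i] cd(2)[of i]] nsq_ind_pow[OF cd(1)[of i] cd(2)[of i], of m]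
      mult_left_mono[OF cd(3)[of i] B0k[of "2 * m"]]
    by auto
  have g2: "g i \<in> L2" "nsq \<nu> (g i) \<le> B0 ^ (2 * k) * \<delta>" for i
    unfolding g_def using ind_pow_L2[OF p0(1)[of i] p0(2)[of i]] nsq_ind_pow[OF p0(1)[of i] p0(2)[of i], of k]
      mult_left_mono[OF p(3)[of i] B0k[of "2 * k"]]
    by auto
  have orth: "ip (h i) (h j) = 0" if "i \<noteq> j" for i j
  proof -
    have disj: "{p i..<p (Suc i)} \<inter> {p j..<p (Suc j)} = {}"
    proof (cases "i < j")
      case True
      then have "p (Suc i) \<le> p j" using p(1) by (auto simp: incseq_def)
      then show ?thesis by auto
    next
      case False
      then have "p (Suc j) \<le> p i" using p(1) that by (auto simp: incseq_def)
      then show ?thesis by auto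
    qed
    have zz: "cnj (h i z) * h j z = 0" for z
    proof -
      have "fst z \<notin> {c i..<d i} \<or> fst z \<notin> {c j..<d j}" using disj sub[of i] sub[of j] by blast
      then show ?thesis by (auto simp: h_def ind_pow_def case_prod_beta indicator_def)
    qed
    show ?thesis unfolding l2_inner_def zz by simp
  qed
  have gy: "(norm (E (g i # ys)))\<^sup>2 \<le> C * B0 ^ (2 * k) * (norm (E ys))\<^sup>2 * \<delta>" for i
  proof -
    have "(norm (E (g i # ys)))\<^sup>2 \<le> (sqrt (C * nsq \<nu> (g i)) * norm (E ys))\<^sup>2"
      by (intro power_mono E_Cons_bound g2 ys) auto
    also have "\<dots> = C * nsq \<nu> (g i) * (norm (E ys))\<^sup>2"
      using C_pos nsq_nonneg[of \<nu> "g i"] by (simp add: power_mult_distrib)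
    also have "\<dots> \<le> C * (B0 ^ (2 * k) * \<delta>) * (norm (E ys))\<^sup>2"
      using C_pos g2(2) by (intro mult_right_mono mult_left_mono) auto
    finally show ?thesis by (simp add: mult_ac)
  qed
  have "(norm (\<Sum>i<N. E (h i # g i # ys)))\<^sup>2 = (norm (\<Sum>i<N. \<iota> (cre (h i) (tensor (g i # ys)))))\<^sup>2"
    by (simp add: E_def)
  also have "\<dots> \<le> C * (\<Sum>i<N. nsq \<nu> (h i) * (norm (\<iota> (tensor (g i # ys))))\<^sup>2)"
    using h2 g2 orth ys by (intro column_bound_orthogonal) (auto simp: FV_tensor)
  also have "\<dots> \<le> C * (\<Sum>i<N. (B0 ^ (2 * m) * \<delta>) * (C * B0 ^ (2 * k) * (norm (E ys))\<^sup>2 * \<delta>))"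
    using C_pos d0 B0k
    by (intro mult_left_mono sum_mono mult_mono h2 gy[unfolded E_def, folded E_def[of ys]]) (auto simp: E_def)
  also have "\<dots> = (C * B0 ^ (2 * m) * (C * B0 ^ (2 * k) * (norm (E ys))\<^sup>2)) * (real N * \<delta>\<^sup>2)"
    by (simp add: power2_eq_square mult_ac)
  finally show ?thesis unfolding h_def g_def .
qed

section \<open>The closed orbit of the vacuum contains all words over
  \<open>ind_pows\<close>\<close>

abbreviation "Mc \<equiv> closure ((\<lambda>A. A (E [])) ` AX)"

lemma csubspace_Mc: "csubspace Mc"
proof (rule csubspace_closure, unfold csubspace_def, intro conjI ballI allI)
  show "0 \<in> (\<lambda>A. A (E [])) ` AX"
    by (intro image_eqI[of _ _ "\<lambda>_. 0"]) (auto simp: alg_X_def alg_zero)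
next
  fix x y assume "x \<in> (\<lambda>A. A (E [])) ` AX" "y \<in> (\<lambda>A. A (E [])) ` AX"
  then obtain A B where "A \<in> AX" "B \<in> AX" "x = A (E [])" "y = B (E [])" by blast
  then show "x + y \<in> (\<lambda>A. A (E [])) ` AX"
    by (intro image_eqI[of _ _ "\<lambda>\<xi>. A \<xi> + B \<xi>"]) (auto simp: alg_X_def alg_generated.add)
next
  fix c x assume "x \<in> (\<lambda>A. A (E [])) ` AX"
  then obtain A where "A \<in> AX" "x = A (E [])" by blast
  then show "c *\<^sub>C x \<in> (\<lambda>A. A (E [])) ` AX"
    by (intro image_eqI[of _ _ "\<lambda>\<xi>. c *\<^sub>C A \<xi>"]) (auto simp: alg_X_def alg_generated.scale)
qed

lemma Xf_Mc:
  assumes "0 \<le> a" "a \<le> b" "x \<in> Mc"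
  shows "Xf (ind_pow a b 0) x \<in> Mc"
proof (rule bounded_linear_closure_mono[OF _ _ assms(3)])
  show "bounded_linear (Xf (ind_pow a b 0))"
    using Xf_bounded[OF D0_ind_pow[OF assms(1,2)]] by (simp add: bounded_clinear_def)
  fix y assume "y \<in> (\<lambda>A. A (E [])) ` AX"
  then obtain A where A: "A \<in> AX" "y = A (E [])" by blast
  have "(\<lambda>\<xi>. Xf (ind_pow a b 0) (A \<xi>)) \<in> AX"
    using AX_generator[OF assms(1,2)] A(1) unfolding alg_X_def by (rule alg_generated.mult)
  then have "Xf (ind_pow a b 0) y \<in> (\<lambda>A. A (E [])) ` AX" unfolding A(2) by (rule rev_image_eqI) simp
  then show "Xf (ind_pow a b 0) y \<in> Mc" by (rule subsetD[OF closure_subset])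
qed

text \<open>
  For a partition into intervals \<open>I\<^sub>i\<close>, the vector \<open>\<Sum>\<^sub>i X(I\<^sub>i) (\<one>\<^bsub>I\<^sub>i\<^esub> x\<^sup>k \<otimes> \<eta>)\<close> equals
  \<open>\<one>\<^sub>I x\<^bsup>k+1\<^esup> \<otimes> \<eta>\<close> up to diagonal sums, which vanish in the limit, and vectors with fewer particles.
\<close>

lemma E_step_Mc:
  assumes ab: "0 \<le> a" "a \<le> b" and xs: "xs \<in> lists ind_pows"
    and low: "\<And>ys. ys \<in> lists ind_pows \<Longrightarrow> length ys \<le> length xs \<Longrightarrow> E ys \<in> Mc"
    and k: "\<And>a b. 0 \<le> a \<Longrightarrow> a \<le> b \<Longrightarrow> E (ind_pow a b k # xs) \<in> Mc"
  shows "E (ind_pow a b (Suc k) # xs) \<in> Mc"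
proof -
  have xsL: "xs \<in> lists L2" using xs by (intro D0_lists_L2 ind_pows_lists)
  \<comment> \<open>\<open>Suc N\<close> equal pieces, so that the partition is nonempty also for
    \<open>N = 0\<close>.\<close>
  define \<delta> where "\<delta> N = (b - a) / real (Suc N)" for N
  define p where "p N i = a + real i * \<delta> N" for N i
  have d0: "\<delta> N \<ge> 0" for N using ab by (simp add: \<delta>_def)
  have p_inc: "incseq (p N)" for N using d0[of N] by (auto simp: incseq_def p_def intro!: mult_right_mono)
  have p0: "p N 0 = a" "p N (Suc N) = b" for N by (auto simp: p_def \<delta>_def)
  have pd: "p N (Suc i) - p N i = \<delta> N" for N i by (simp add: p_def algebra_simps)
  have pp: "0 \<le> p N i" "p N i \<le> p N (Suc i)" for N i using d0[of N] ab by (auto simp: p_def mult_right_mono)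
  define f where "f N i = ind_pow (p N i) (p N (Suc i)) 0" for N i
  define g where "g N i = ind_pow (p N i) (p N (Suc i)) k" for N i
  have fS: "f N i \<in> ind_pows" and gS: "g N i \<in> ind_pows" for N i
    unfolding f_def g_def ind_pows_def using pp by blast+
  define R0 where "R0 N = (\<Sum>i<Suc N. E (f N i # g N i # xs))" for N
  define R where "R N l = (\<Sum>i<Suc N. E (T_op (f N i) (xs ! l) # g N i # omit l xs))" for N l
  \<comment> \<open>The annihilation terms: one letter of \<open>g N i # xs\<close> is removed, and
    the remaining word has \<open>length xs\<close> letters, so the hypothesis on such words covers
    it.\<close>
  define low where "low N i = (\<Sum>l<length (g N i # xs). (complex_of_real (q ^ l) * ip (f N i) ((g N i # xs) ! l)) *\<^sub>C E (omit l (g N i # xs)))" for N i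
  have low_Mc: "low N i \<in> Mc" for N i
    unfolding low_def
  proof (intro csubspace_sum[OF csubspace_Mc] csubspace_scale[OF csubspace_Mc])
    fix l assume "l \<in> {..<length (g N i # xs)}"
    then show "E (omit l (g N i # xs)) \<in> Mc"
      using xs gS omit_in_lists[of "g N i # xs" ind_pows l] by (intro assms(4)) auto
  qed
  \<comment> \<open>The gauge term that joins \<open>f N i\<close> with \<open>g N i\<close> raises
    the exponent to \<open>Suc k\<close> on the piece; those that join \<open>f N i\<close> with a
    letter of \<open>xs\<close> keep \<open>g N i\<close> and are diagonal.\<close>
  have X_eq: "Xf (f N i) (E (g N i # xs)) = low N i + E (f N i # g N i # xs) + E (ind_pow (p N i) (p N (Suc i)) (Suc k) # xs) +
      (\<Sum>l<length xs. complex_of_real (q ^ Suc l) *\<^sub>C E (T_op (f N i) (xs ! l) # g N i # omit l xs))" for N i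
  proof -
    have "T_op (f N i) (g N i) = ind_pow (p N i) (p N (Suc i)) (Suc k)"
      using pp[of N i] by (simp add: f_def g_def T_op_ind_pow)
    moreover have "g N i # xs \<in> lists L2" "f N i \<in> D0"
      using ind_pows_D0[OF fS] ind_pows_D0[OF gS] D0_L2 xsL by auto
    ultimately show ?thesis
      by (simp add: Xf_E low_def sum.lessThan_Suc_shift add.assoc del: sum.lessThan_Suc)
  qed
  \<comment> \<open>These vectors lie in \<open>Mc\<close> for every \<open>N\<close> and converge
    to the desired word.\<close>
  define Z where "Z N = (\<Sum>i<Suc N. Xf (f N i) (E (g N i # xs)) - low N i)" for N
  have Z_Mc: "Z N \<in> Mc" for N
    unfolding Z_def
  proof (intro csubspace_sum[OF csubspace_Mc] csubspace_diff[OF csubspace_Mc] low_Mc)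
    fix i show "Xf (f N i) (E (g N i # xs)) \<in> Mc"
      unfolding f_def g_def by (intro Xf_Mc k pp)
  qed
  have Z_eq: "Z N = E (ind_pow a b (Suc k) # xs) + R0 N + (\<Sum>l<length xs. complex_of_real (q ^ Suc l) *\<^sub>C R N l)" for N
  proof -
    have tot: "(\<Sum>i<Suc N. E (ind_pow (p N i) (p N (Suc i)) (Suc k) # xs)) = E (ind_pow a b (Suc k) # xs)"
    proof -
      have "E (ind_pow a b (Suc k) # xs) = (\<Sum>i<Suc N. 1 *\<^sub>C E (ind_pow (p N i) (p N (Suc i)) (Suc k) # xs))"
      proof (rule E_Cons_cong)
        show "AE z in M. ind_pow a b (Suc k) z = (\<Sum>i<Suc N. 1 * ind_pow (p N i) (p N (Suc i)) (Suc k) z)"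
          using ind_pow_partition[OF p_inc, of N "Suc N" "Suc k"] unfolding p0 by simp
      qed (use ab xsL pp in \<open>auto intro: ind_pow_L2\<close>)
      then show ?thesis by simp
    qed
    have "Z N = (\<Sum>i<Suc N. E (f N i # g N i # xs) + E (ind_pow (p N i) (p N (Suc i)) (Suc k) # xs) +
      (\<Sum>l<length xs. complex_of_real (q ^ Suc l) *\<^sub>C E (T_op (f N i) (xs ! l) # g N i # omit l xs)))"
      unfolding Z_def X_eq by (intro sum.cong refl) simp
    also have "\<dots> = R0 N + E (ind_pow a b (Suc k) # xs) +
      (\<Sum>i<Suc N. \<Sum>l<length xs. complex_of_real (q ^ Suc l) *\<^sub>C E (T_op (f N i) (xs ! l) # g N i # omit l xs))"
      unfolding sum.distrib R0_def tot ..
    also have "(\<Sum>i<Suc N. \<Sum>l<length xs. complex_of_real (q ^ Suc l) *\<^sub>C E (T_op (f N i) (xs ! l) # g N i # omit l xs)) =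
      (\<Sum>l<length xs. complex_of_real (q ^ Suc l) *\<^sub>C R N l)"
      unfolding R_def scaleC_sum_right by (rule sum.swap)
    finally show ?thesis by (simp add: add_ac)
  qed
  have mesh: "real (Suc N) * (\<delta> N)\<^sup>2 = (b - a)\<^sup>2 / real (Suc N)" for N
    by (simp add: \<delta>_def power2_eq_square)
  have R0_lim: "R0 \<longlonglongrightarrow> 0"
  proof (rule tendsto_zero_of_square_bound)
    fix N
    show "(norm (R0 N))\<^sup>2 \<le> (C * B0 ^ (2 * 0) * (C * B0 ^ (2 * k) * (norm (E xs))\<^sup>2)) * (b - a)\<^sup>2 / real (Suc N)"
      unfolding times_divide_eq_right[symmetric] mesh[symmetric] R0_def f_def g_def
      by (rule diagonal_sum_bound[OF p_inc]) (use ab p0 pp pd xsL in simp_all)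
  qed
  have R_lim: "(\<lambda>N. R N l) \<longlonglongrightarrow> 0" if l: "l < length xs" for l
  proof -
    have oL: "omit l xs \<in> lists L2" using xsL by (rule omit_in_lists)
    obtain c d m where cd: "xs ! l = ind_pow c d m" "0 \<le> c" "c \<le> d"
      using nth_in_lists[OF xs l] by (auto simp: ind_pows_def)
    show ?thesis
    proof (rule tendsto_zero_of_square_bound)
      fix N
      show "(norm (R N l))\<^sup>2 \<le> (C * B0 ^ (2 * Suc (0 + m)) * (C * B0 ^ (2 * k) * (norm (E (omit l xs)))\<^sup>2)) * (b - a)\<^sup>2 / real (Suc N)"
        unfolding times_divide_eq_right[symmetric] mesh[symmetric] R_def f_def g_def cd(1) T_op_ind_pow
      proof (rule diagonal_sum_bound[OF p_inc])
        fix i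
        show "max (max (p N i) c) (min (p N (Suc i)) d) - max (p N i) c \<le> \<delta> N"
          using pd[of N i] d0[of N] by (auto simp: max_def min_def)
        show "0 \<le> max (p N i) c" using pp by (simp add: le_max_iff_disj)
        show "{max (p N i) c..<max (max (p N i) c) (min (p N (Suc i)) d)} \<subseteq> {p N i..<p N (Suc i)}"
          by (auto simp: max_def min_def split: if_splits)
      qed (use ab p0 pd oL in simp_all)
    qed
  qed
  have "(\<lambda>N. E (ind_pow a b (Suc k) # xs) + R0 N + (\<Sum>l<length xs. complex_of_real (q ^ Suc l) *\<^sub>C R N l)) \<longlonglongrightarrow>
      E (ind_pow a b (Suc k) # xs) + 0 + (\<Sum>l<length xs. complex_of_real (q ^ Suc l) *\<^sub>C 0)"
    by (intro tendsto_add tendsto_const tendsto_sum R0_lim bounded_linear.tendsto[OF bounded_linear_scaleC] R_lim) simp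
  then have "Z \<longlonglongrightarrow> E (ind_pow a b (Suc k) # xs)" by (simp add: Z_eq[abs_def])
  then show ?thesis using Z_Mc closed_sequentially[OF closed_closure] by blast
qed

text \<open>Induction on the number of letters and, inside it, on the exponent of the first one:
  exponent 0 is read off X(I) applied to \<open>E ys\<close>, higher exponents come from
  \<open>E_step_Mc\<close>.\<close>

lemma E_ind_pows_Mc: "xs \<in> lists ind_pows \<Longrightarrow> length xs \<le> n \<Longrightarrow> E xs \<in> Mc"
proof (induction n arbitrary: xs rule: nat.induct)
  case zero
  have "E [] \<in> (\<lambda>A. A (E [])) ` AX"
    by (intro image_eqI[of _ _ "\<lambda>\<xi>. \<xi>"]) (auto simp: alg_X_def alg_generated.one)
  then have "E [] \<in> Mc" by (rule subsetD[OF closure_subset])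
  then show ?case using zero by simp
next
  case (Suc n)
  show ?case
  proof (cases "length xs \<le> n")
    case True
    then show ?thesis using Suc by blast
  next
    case False
    then obtain x ys where x: "xs = x # ys" by (cases xs) auto
    have ly: "length ys = n" using False Suc.prems x by simp
    have ys: "ys \<in> lists ind_pows" using Suc.prems x by simp
    have "E (ind_pow a b k # ys) \<in> Mc" if "0 \<le> a" "a \<le> b" for a b k
      using that
    proof (induction k arbitrary: a b)
      case 0
      let ?f = "ind_pow a b 0"
      have f: "?f \<in> ind_pows" using 0 by (auto simp: ind_pows_def)
      have "E (?f # ys) = Xf ?f (E ys) - (\<Sum>k<length ys. (complex_of_real (q ^ k) * ip ?f (ys ! k)) *\<^sub>C E (omit k ys)) -
          (\<Sum>k<length ys. complex_of_real (q ^ k) *\<^sub>C E (T_op ?f (ys ! k) # omit k ys))"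
        using Xf_E[OF ind_pows_D0[OF f] D0_lists_L2[OF ind_pows_lists[OF ys]]] by simp
      also have "\<dots> \<in> Mc"
      proof (intro csubspace_diff[OF csubspace_Mc] csubspace_sum[OF csubspace_Mc] csubspace_scale[OF csubspace_Mc])
        show "Xf ?f (E ys) \<in> Mc" using 0 ys ly by (intro Xf_Mc Suc.IH) auto
        fix k assume k: "k \<in> {..<length ys}"
        show "E (omit k ys) \<in> Mc" using k ly omit_in_lists[OF ys, of k] by (intro Suc.IH) auto
        have "T_op ?f (ys ! k) \<in> ind_pows" using k nth_in_lists[OF ys, of k] f by (intro T_op_ind_pows) auto
        then show "E (T_op ?f (ys ! k) # omit k ys) \<in> Mc"
          using k ly omit_in_lists[OF ys, of k] by (intro Suc.IH) auto
      qed
      finally show ?case .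
    next
      case (Suc k)
      show ?case
        by (rule E_step_Mc[OF Suc.prems ys _ Suc.IH]) (use \<open>\<And>xs. xs \<in> lists ind_pows \<Longrightarrow> length xs \<le> n \<Longrightarrow> E xs \<in> Mc\<close> ly in auto)
    qed
    then show ?thesis using Suc.prems x by (auto simp: ind_pows_def)
  qed
qed

section \<open>Density of the span of words over \<open>ind_pows\<close>\<close>

inductive_set Esp :: "'f set" where
  zero: "0 \<in> Esp"
| step: "x \<in> Esp \<Longrightarrow> xs \<in> lists ind_pows \<Longrightarrow> c *\<^sub>C E xs + x \<in> Esp"

lemma csubspace_Esp: "csubspace Esp"
proof -
  have "x + y \<in> Esp" if "x \<in> Esp" "y \<in> Esp" for x y
    using that by (induction rule: Esp.induct) (auto simp: add.assoc intro: Esp.intros)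
  moreover have "c *\<^sub>C x \<in> Esp" if "x \<in> Esp" for c x
    using that by (induction rule: Esp.induct) (auto simp: scaleC_add_right scaleC_scaleC intro: Esp.intros)
  ultimately show ?thesis by (simp add: csubspace_def Esp.zero)
qed

lemma Esp_Mc: "x \<in> Esp \<Longrightarrow> x \<in> Mc"
  by (induction rule: Esp.induct)
     (auto intro!: csubspace_zero csubspace_add csubspace_scale csubspace_Mc E_ind_pows_Mc)

lemma E_pow_span_Esp:
  assumes "s \<in> pow_span" "ys \<in> lists ind_pows"
  shows "E (s # ys) \<in> Esp"
  using assms(1)
proof (induction rule: pow_span.induct)
  have ysL: "ys \<in> lists L2" using assms(2) by (intro D0_lists_L2 ind_pows_lists)
  {
    case zero
    have "E ((\<lambda>_. 0) # ys) = (\<Sum>i\<in>{}. undefined i *\<^sub>C E (undefined i # ys))"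
      by (rule E_Cons_cong) (use ysL sq_integrable_zero in auto)
    then show ?case by (simp add: Esp.zero)
  next
    case (step s a b c k)
    have "E ((\<lambda>z. c * ind_pow a b k z + s z) # ys) =
        (\<Sum>i\<in>UNIV. (if i then c else 1) *\<^sub>C E ((if i then ind_pow a b k else s) # ys))"
      by (rule E_Cons_cong)
         (use step ysL in \<open>auto simp: UNIV_bool pow_span_L2 ind_pow_L2 intro!: sq_integrable_add sq_integrable_scale\<close>)
    also have "\<dots> = c *\<^sub>C E (ind_pow a b k # ys) + E (s # ys)" by (simp add: UNIV_bool add.commute)
    also have "\<dots> \<in> Esp" using step assms(2) by (intro Esp.step) (auto simp: ind_pows_def)
    finally show ?case .
  }
qed

lemma E_Cons_Esp:
  assumes f: "f \<in> L2" and ys: "ys \<in> lists ind_pows"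
  shows "E (f # ys) \<in> closure Esp"
proof -
  have ysL: "ys \<in> lists L2" using ys by (intro D0_lists_L2 ind_pows_lists)
  have "\<exists>x\<in>Esp. dist x (E (f # ys)) < \<epsilon>" if e: "\<epsilon> > 0" for \<epsilon>
  proof -
    \<comment> \<open>Solves \<open>sqrt (C * \<eta>) * (norm (E ys) + 1) = \<epsilon>\<close>; the
      summand 1 covers \<open>E ys = 0\<close>.\<close>
    define \<eta> where "\<eta> = (\<epsilon> / (norm (E ys) + 1))\<^sup>2 / C"
    have n1: "norm (E ys) + 1 > 0" by (simp add: add_nonneg_pos)
    have "\<eta> > 0" using e C_pos n1 by (simp add: \<eta>_def)
    then obtain s where s: "s \<in> pow_span" "nsq \<nu> (\<lambda>z. f z - s z) < \<eta>"
      using approximable_all[OF f] unfolding approximable_def by blast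
    have sL: "s \<in> L2" using s(1) by (rule pow_span_L2)
    have dL: "(\<lambda>z. f z - s z) \<in> L2" using f sL by (rule sq_integrable_diff)
    have "E (f # ys) = (\<Sum>i\<in>UNIV. 1 *\<^sub>C E ((if i then (\<lambda>z. f z - s z) else s) # ys))"
      by (rule E_Cons_cong) (use f sL dL ysL in \<open>auto simp: UNIV_bool\<close>)
    then have "E (f # ys) - E (s # ys) = E ((\<lambda>z. f z - s z) # ys)" by (simp add: UNIV_bool)
    then have "dist (E (s # ys)) (E (f # ys)) \<le> sqrt (C * nsq \<nu> (\<lambda>z. f z - s z)) * norm (E ys)"
      using E_Cons_bound[OF dL ysL] by (simp add: dist_norm norm_minus_commute)
    also have "\<dots> \<le> sqrt (C * \<eta>) * norm (E ys)"
      using s(2) C_pos by (intro mult_right_mono) auto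
    also have "\<dots> = \<epsilon> / (norm (E ys) + 1) * norm (E ys)"
      using C_pos e n1 by (simp add: \<eta>_def real_sqrt_divide)
    also have "\<dots> < \<epsilon>" using e n1 by (simp add: field_simps)
    finally show ?thesis using E_pow_span_Esp[OF s(1) ys] by blast
  qed
  then show ?thesis by (simp add: closure_approachable)
qed

text \<open>The tail is approximated first. The bounded operator \<open>Cr f\<close> carries the
  approximation along, and \<open>E_Cons_Esp\<close> then deals with the new letter in front of each
  approximating word.\<close>

lemma E_closure_Esp: "xs \<in> lists L2 \<Longrightarrow> E xs \<in> closure Esp"
proof (induction xs rule: list.induct)
  case Nil
  have "1 *\<^sub>C E [] + 0 \<in> Esp" by (rule Esp.step[OF Esp.zero]) simp
  then have "1 *\<^sub>C E [] + 0 \<in> closure Esp" by (rule subsetD[OF closure_subset])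
  then show ?case by simp
next
  case (Cons f xs)
  then have f: "f \<in> L2" and xs: "xs \<in> lists L2" by auto
  note S = csubspace_closure[OF csubspace_Esp]
  have maps: "Cr f x \<in> closure Esp" if "x \<in> Esp" for x
    using that
  proof (induction rule: Esp.induct)
    case zero
    then show ?case using csubspace_zero[OF S] by (simp add: bounded_clinear_zero[OF Cr_bounded[OF f]])
  next
    case (step x ys c)
    have "Cr f (c *\<^sub>C E ys + x) = c *\<^sub>C E (f # ys) + Cr f x"
      using step Cr_E[OF f D0_lists_L2[OF ind_pows_lists[OF step(2)]]]
      by (simp add: bounded_clinear_add_image[OF Cr_bounded[OF f]] bounded_clinear_scaleC[OF Cr_bounded[OF f]])
    then show ?case using step E_Cons_Esp[OF f step(2)] by (simp add: csubspace_add[OF S] csubspace_scale[OF S])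
  qed
  have "bounded_linear (Cr f)" using Cr_bounded[OF f] by (simp add: bounded_clinear_def)
  from bounded_linear_closure_mono[OF this maps Cons.IH[OF xs]] have "Cr f (E xs) \<in> closure Esp" .
  then show ?case using Cr_E[OF f xs] by simp
qed

theorem AX_cyclic: "Mc = UNIV"
proof -
  have "\<iota> ` FV \<subseteq> closure Esp"
  proof
    fix x assume "x \<in> \<iota> ` FV"
    then obtain v where v: "v \<in> FV" "x = \<iota> v" by auto
    show "x \<in> closure Esp" unfolding v(2) iota_expand[OF v(1)]
      using csubspace_closure[OF csubspace_Esp] keys_FV[OF v(1)]
      by (intro csubspace_sum csubspace_scale E_closure_Esp)
  qed
  then have "closure (\<iota> ` FV) \<subseteq> closure Esp" by (simp add: closure_minimal)
  moreover have "closure Esp \<subseteq> Mc" by (rule closure_minimal) (use Esp_Mc in auto)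
  ultimately show ?thesis using iota_dense by auto
qed

end

section \<open>The isomorphisms\<close>

lemma hilbert_iso_inv:
  assumes "hilbert_iso U"
  shows "hilbert_iso (inv U)"
proof -
  have b: "bij U" using assms by (simp add: hilbert_iso_def)
  have r: "U (inv U x) = x" for x using b by (simp add: bij_is_surj surj_f_inv_f)
  have l: "inv U (U x) = x" for x using b by (simp add: bij_is_inj)
  have 1: "inv U (x + y) = inv U x + inv U y" for x y
    using assms l[of "inv U x + inv U y"] by (simp add: hilbert_iso_def r)
  have 2: "inv U (c *\<^sub>C x) = c *\<^sub>C inv U x" for c x
    using assms l[of "c *\<^sub>C inv U x"] by (simp add: hilbert_iso_def r)
  have 3: "cinner (inv U x) (inv U y) = cinner x y" for x y
  proof -
    have "cinner (inv U x) (inv U y) = cinner (U (inv U x)) (U (inv U y))" using assms by (simp add: hilbert_iso_def)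
    then show ?thesis by (simp add: r)
  qed
  show ?thesis unfolding hilbert_iso_def using b 1 2 3 by (simp add: bij_imp_bij_inv)
qed

lemma hilbert_iso_comp: "hilbert_iso U \<Longrightarrow> hilbert_iso V \<Longrightarrow> hilbert_iso (\<lambda>x. U (V x))"
  unfolding hilbert_iso_def using bij_comp[of V U] by (simp add: comp_def)

text \<open>Stated for any algebra between the two: cyclicity of the smaller one gives density, and
  the adjoints in the larger one turn the form of the state into an inner product of
  vectors.\<close>

lemma (in q_fock) L2_alg_iso:
  fixes \<kappa> :: "('f \<Rightarrow> 'f) \<Rightarrow> 'g::chilbert_space"
  assumes \<kappa>: "is_L2_alg \<A> (E []) \<kappa>"
    and alg: "\<A> = alg_generated G" and sub: "AX \<subseteq> \<A>" "\<A> \<subseteq> AXD"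
  obtains U where "hilbert_iso U" "\<And>A. A \<in> \<A> \<Longrightarrow> U (\<kappa> A) = A (E [])"
proof -
  have c: "closure (\<kappa> ` \<A>) = UNIV"
    "\<And>A B. A \<in> \<A> \<Longrightarrow> B \<in> \<A> \<Longrightarrow> \<kappa> (\<lambda>\<xi>. A \<xi> + B \<xi>) = \<kappa> A + \<kappa> B"
    "\<And>c A. A \<in> \<A> \<Longrightarrow> \<kappa> (\<lambda>\<xi>. c *\<^sub>C A \<xi>) = c *\<^sub>C \<kappa> A"
    "\<And>A. A \<in> \<A> \<Longrightarrow> cinner (\<kappa> A) (\<kappa> A) = cinner (A (E [])) (A (E []))"
    using \<kappa> sub(2) state_AXD by (auto simp: is_L2_alg_def is_completion_def)
  have "Mc \<subseteq> closure ((\<lambda>A. A (E [])) ` \<A>)" using sub(1) by (intro closure_mono image_mono)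
  then have d: "closure ((\<lambda>A. A (E [])) ` \<A>) = UNIV" using AX_cyclic by auto
  obtain U where "hilbert_iso U" "\<And>A. A \<in> \<A> \<Longrightarrow> U (\<kappa> A) = A (E [])"
  proof (rule hilbert_iso_completions[OF c(1) d, of "\<lambda>A B \<xi>. A \<xi> + B \<xi>" "\<lambda>c A \<xi>. c *\<^sub>C A \<xi>"])
    show "(\<lambda>\<xi>. A \<xi> + B \<xi>) \<in> \<A>" "(\<lambda>\<xi>. c *\<^sub>C A \<xi>) \<in> \<A>" if "A \<in> \<A>" "B \<in> \<A>" for A B c
      using that unfolding alg by (blast intro: alg_generated.add alg_generated.scale)+
  qed (use c in \<open>assumption | simp\<close>)+
  then show thesis by (rule that)
qed

text \<open>W takes values in the large algebra, so the inverse isomorphism \<open>V\<close> is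
  expressed through \<open>J\<close>, the identification of the two L2 spaces that matches
  \<open>\<kappa>\<close> with \<open>\<kappa>\<Delta>\<close> on the small algebra.\<close>

theorem corollary15:
  fixes q :: real and \<nu> :: "real measure"
    and \<iota> :: "fock_vec \<Rightarrow> 'f::chilbert_space"
    and \<kappa> :: "('f \<Rightarrow> 'f) \<Rightarrow> 'g::chilbert_space"
    and \<kappa>\<Delta> :: "('f \<Rightarrow> 'f) \<Rightarrow> 'h::chilbert_space"
  assumes q: "-1 < q" "q < 1"
    and \<nu>: "prob_space \<nu>" "sets \<nu> = sets borel"
    and compact_support: "\<exists>K. compact K \<and> emeasure \<nu> (UNIV - K) = 0"
    and fock: "is_q_fock q \<nu> \<iota>"
    and L2_X: "is_L2_alg (alg_X q \<nu> \<iota>) (vacuum \<iota>) \<kappa>"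
    and L2_X_Delta: "is_L2_alg (alg_X_Delta q \<nu> \<iota>) (vacuum \<iota>) \<kappa>\<Delta>"
  shows "closure ((\<lambda>A. A (vacuum \<iota>)) ` alg_X q \<nu> \<iota>) = UNIV \<and>
    (\<forall>A\<in>alg_X q \<nu> \<iota>. A (vacuum \<iota>) = 0 \<longrightarrow> A = (\<lambda>_. 0)) \<and>
    inj_on (\<lambda>A. A (vacuum \<iota>)) (alg_X q \<nu> \<iota>) \<and>
    (\<forall>v\<in>fock_D. wick_map q \<nu> \<iota> v \<in> alg_X_Delta q \<nu> \<iota>) \<and>
    (\<forall>v\<in>fock_D. \<forall>w\<in>fock_D. \<iota> v = \<iota> w \<longrightarrow> wick_map q \<nu> \<iota> v = wick_map q \<nu> \<iota> w) \<and>
    (\<exists>(U::'g \<Rightarrow> 'f) (V::'f \<Rightarrow> 'g) (J::'g \<Rightarrow> 'h).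
      hilbert_iso U \<and> (\<forall>A\<in>alg_X q \<nu> \<iota>. U (\<kappa> A) = A (vacuum \<iota>)) \<and>
      hilbert_iso V \<and> V \<circ> U = id \<and> U \<circ> V = id \<and>
      hilbert_iso J \<and> (\<forall>A\<in>alg_X q \<nu> \<iota>. J (\<kappa> A) = \<kappa>\<Delta> A) \<and>
      (\<forall>A\<in>alg_X_Delta q \<nu> \<iota>. U (inv J (\<kappa>\<Delta> A)) = A (vacuum \<iota>)) \<and>
      (\<forall>v\<in>fock_D. V (\<iota> v) = inv J (\<kappa>\<Delta> (wick_map q \<nu> \<iota> v))))"
proof -
  interpret q_fock \<nu> q \<iota>
    using q \<nu> compact_support fock by (simp add: q_fock_def q_fock_axioms_def compact_prob_def)
  have vac: "vacuum \<iota> = E []" by (simp add: vacuum_def E_def)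
  have sub: "AX \<subseteq> AXD" using AX_AXD by blast
  have sep: "A = (\<lambda>_. 0)" if "A \<in> AX" "A (E []) = 0" for A
    using AXD_separating[OF AX_AXD] that by blast
  have inj: "inj_on (\<lambda>A. A (E [])) AX"
  proof (rule inj_onI)
    fix A B assume AB: "A \<in> AX" "B \<in> AX" "A (E []) = B (E [])"
    have "(\<lambda>\<xi>. A \<xi> - B \<xi>) = (\<lambda>_. 0)"
      by (rule sep) (use AB in \<open>auto simp: alg_X_def alg_diff\<close>)
    then show "A = B" by (simp add: fun_eq_iff)
  qed
  obtain U :: "'g \<Rightarrow> 'f" where U: "hilbert_iso U" "\<And>A. A \<in> AX \<Longrightarrow> U (\<kappa> A) = A (E [])"
    using L2_alg_iso[OF L2_X[unfolded vac] alg_X_def order_refl sub] by blast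
  obtain U\<Delta> :: "'h \<Rightarrow> 'f" where U\<Delta>: "hilbert_iso U\<Delta>" "\<And>A. A \<in> AXD \<Longrightarrow> U\<Delta> (\<kappa>\<Delta> A) = A (E [])"
    using L2_alg_iso[OF L2_X_Delta[unfolded vac] alg_X_Delta_def sub order_refl] by blast
  have bU: "bij U" "bij U\<Delta>" using U U\<Delta> by (auto simp: hilbert_iso_def)
  have rU: "U (inv U x) = x" for x using bU by (simp add: bij_is_surj surj_f_inv_f)
  have lU: "inv U (U x) = x" for x using bU by (simp add: bij_is_inj)
  have l\<Delta>: "inv U\<Delta> (U\<Delta> x) = x" for x using bU by (simp add: bij_is_inj)
  \<comment> \<open>The two L2 spaces are compared through the Fock space, to which both are
    isomorphic.\<close>
  define J where "J x = inv U\<Delta> (U x)" for x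
  have J: "hilbert_iso J" unfolding J_def[abs_def] by (rule hilbert_iso_comp[OF hilbert_iso_inv[OF U\<Delta>(1)] U(1)])
  have J\<kappa>: "J (inv U (A (E []))) = \<kappa>\<Delta> A" if "A \<in> AXD" for A
    using l\<Delta>[of "\<kappa>\<Delta> A"] U\<Delta>(2)[OF that] by (simp add: J_def rU)
  have invJ: "inv J (\<kappa>\<Delta> A) = inv U (A (E []))" if "A \<in> AXD" for A
  proof -
    have "inj J" using J by (simp add: hilbert_iso_def bij_is_inj)
    then show ?thesis using J\<kappa>[OF that] by (metis inv_f_f)
  qed
  show ?thesis unfolding vac
  proof (intro conjI exI[of _ U] exI[of _ "inv U"] exI[of _ J])
    show "\<forall>A\<in>AX. J (\<kappa> A) = \<kappa>\<Delta> A"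
      using J\<kappa>[OF AX_AXD] U(2) lU by metis
    show "\<forall>A\<in>AXD. U (inv J (\<kappa>\<Delta> A)) = A (E [])" by (simp add: invJ rU)
    show "\<forall>v\<in>fock_D. inv U (\<iota> v) = inv J (\<kappa>\<Delta> (WM v))"
      by (simp add: invJ wick_map_AXD wick_map_vacuum)
    show "inv U \<circ> U = id" "U \<circ> inv U = id" by (auto simp: fun_eq_iff lU rU)
    show "\<forall>v\<in>fock_D. \<forall>w\<in>fock_D. \<iota> v = \<iota> w \<longrightarrow> WM v = WM w" using wick_map_eqI by blast
  qed (use AX_cyclic sep inj wick_map_AXD U J hilbert_iso_inv in auto)
qed

end
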